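(* Let $\mathcal{B}$ be a Cosserat continuum with second-order non-holonomic material algebroid $A\overline\Omega(\mathcal B)$. Then $\mathcal{B}$ is locally homogeneous if, and only if, for each point $x\in\mathcal{B}$ there exist a local coordinate system $(x^{i})$ over an open set $U\subseteq\mathcal{B}$ with $x\in U$ and a section $\mathcal P:U\times U\to\Pi^1(U,U)$ of $(\alpha,\beta)$, a Lie groupoid morphism with local expression $\mathcal P(x^i,y^j)=(x^i,y^j,P^j_i(x,y))$, such that the local section of $\overline\sharp$ over $U$ given in the induced coordinates $(x^i,v^i,v^j_i,v^j_{,i},v^j_{i,k})$ of $A\tilde J^1(FU)$ by $$\Big(x^{i},\frac{\partial}{\partial x^{l}}\Big)\longmapsto\Big(\Big(x^{i},\frac{\partial}{\partial x^{l}},\frac{\partial P^{j}_{i}}{\partial x^{l}}\Big),\,0,\,\frac{\partial^{2}P^{j}_{i}}{\partial x^{l}\partial x^{k}}+\frac{\partial^{2}P^{j}_{i}}{\partial x^{l}\partial y^{k}}\Big)$$ (all derivatives of $P^j_i(x,y)$ evaluated at $y=x$; the entries are the components $v=\partial/\partial x^l$, $v^j_i$, $v^j_{,i}$, $v^j_{i,k}$) takes values in $A\overline{\Omega}(\mathcal{B})$.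
   Context: Frame bundles. For an $n$-manifold $M$, $FM\to M$ is the linear frame bundle with its right action of $Gl(n,\mathbb R)$; a frame at $x$ is a $1$-jet $j^1_{0,x}\phi$ of a local diffeomorphism $\phi:\mathbb R^n\to M$ with $\phi(0)=x$; coordinates $(x^i)$ on $U$ induce $(x^i,x^i_j)$ on $FU$, $x^i_j(j^1_{0,x}\phi)=\partial(x^i\circ\phi)/\partial x^j|_0$. For a local diffeomorphism $\psi$, $F\psi(j^1_{0,\phi(0)}\phi)=j^1_{0,\psi(\phi(0))}(\psi\circ\phi)$. $\tau_v$ is translation of $\mathbb R^n$ by $v$. A local principal bundle isomorphism is a diffeomorphism $\Psi:FU\to FV$ with $\Psi(z\cdot g)=\Psi(z)\cdot g$. Groupoids. $\Pi^1(M,M)\rightrightarrows M$ is the groupoid of $1$-jets $j^1_{x,y}\psi$ of local diffeomorphisms, with source $\alpha$ and target $\beta$, coordinates $(x^i,y^j,y^j_i)$, $y^j_i=\partial(y^j\circ\psi)/\partial x^i|_x$. $\tilde J^1(FM)\rightrightarrows M$ is the quotient of the groupoid of $1$-jets $j^1_{X,Y}\Psi$ of local principal bundle isomorphisms of $FM$ by the action $j^1_{X,Y}\Psi\cdot g=j^1_{X\cdot g,Y\cdot g}\Psi$ of $Gl(n,\mathbb R)$; the class of $j^1_{X,Y}\Psi$, with $X$ over $x$ and $Y$ over $y$, is written $j^1_{x,y}\Psi$ (source $\overline\alpha=x$, target $\overline\beta=y$). With $e_{1x}$ the frame at $x$ having $x^i_j=\delta^i_j$, coordinates on $\tilde J^1(FU)$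 are $(x^i,y^j,y^j_i,y^j_{,i},y^j_{i,k})$, where $y^j_i=y^j_i(\Psi(e_{1x}))$, $y^j_{,i}=\partial(y^j\circ\Psi)/\partial x^i|_{e_{1x}}$, $y^j_{i,k}=\partial(y^j_i\circ\Psi)/\partial x^k|_{e_{1x}}$. Lie algebroid of a Lie groupoid $\Gamma\rightrightarrows M$ (source $\alpha$, target $\beta$, identities $\epsilon$): $A\Gamma_x=T_{\epsilon(x)}\beta^{-1}(x)$, anchor $T\alpha$, bracket from left-invariant vector fields. Coordinates $(x^i,v^i,v^j_i,v^j_{,i},v^j_{i,k})$ on $A\tilde J^1(FU)$ are the components of a tangent vector at $\overline\epsilon(x)$, tangent to the $\overline\beta$-fibre, along $x^i,y^j_i,y^j_{,i},y^j_{i,k}$ respectively. The anchor of $A\tilde J^1(FM)$ is $\overline\sharp$; the section of $\overline\sharp$ in the claim is extended linearly from the $\partial/\partial x^l$. It is the map $A(\mathcal P^1(\mathcal Q))$ obtained from the second-order prolongation with $\mathcal Q^j_i=\delta^j_i$ in the coordinates. Cosserat media. A body $\mathcal B$ is a $3$-manifold covered by one chart; a Cosserat medium is $F\mathcal B$ (and $\mathcal B$ is called the Cosserat continuum). A configuration is an embedding of principal bundles $F\mathcal B\to F\mathbb R^3$ over the identity of $Gl(3,\mathbb R)$. A reference configuration is fixed and $F\mathcal B$ is identified with its image, so $\mathcal B\subseteq\mathbb R^3$ is open. A deformation is an embedding of principal bundles $\tilde\kappa:F\mathcal B\to F\mathbb R^3$ over the identity of $Gl(3,\mathbb R)$, with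 induced map $\kappa$; $j^1_{y,\kappa(y)}\tilde\kappa$ is an infinitesimal deformation at $y$. The mechanical response is a differentiable map $W:\tilde J^1(F\mathcal B)\to V$ ($V$ a real vector space) with $W(j^1_{x,y}\Psi)=W(j^1_{x,z}(F\tau_{z-y}\circ\Psi))$; by this property $W$ is also defined on elements of $\tilde J^1(F\mathbb R^3)$ with source in $\mathcal B$. $\overline\Omega(\mathcal B)$ consists of the $j^1_{x,y}\Psi\in\tilde J^1(F\mathcal B)$ with $W(j^1_{y,\kappa(y)}\tilde\kappa\cdot j^1_{x,y}\Psi)=W(j^1_{y,\kappa(y)}\tilde\kappa)$ for all infinitesimal deformations at $y$. Standing assumption: $\overline\Omega(\mathcal B)$ is a Lie subgroupoid of $\tilde J^1(F\mathcal B)$; $A\overline\Omega(\mathcal B)$ is its Lie algebroid. Homogeneity. An open $U\subseteq\mathcal B$ is homogeneous if there is a deformation $\tilde\kappa$ defined over $U$ such that for all $x,y\in U$, $j^1_{x,y}(\tilde\kappa^{-1}\circ F\tau_{\kappa(y)-\kappa(x)}\circ\tilde\kappa)\in\overline\Omega(\mathcal B)$. $\mathcal B$ is locally homogeneous if it is covered by homogeneous open sets. *)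

theory Defs
  imports "HOL-Analysis.Analysis"
begin

section \<open>Smooth maps, submanifolds and tangent vectors\<close>

text \<open>
  The recursion goes through directional
  derivatives, so that the type of the map does not change; it is meant for open sets of
  finite-dimensional spaces.
\<close>

primrec times_differentiable_on ::
  "nat \<Rightarrow> 'a::real_normed_vector set \<Rightarrow> ('a \<Rightarrow> 'b::real_normed_vector) \<Rightarrow> bool" where
  "times_differentiable_on 0 S f \<longleftrightarrow> continuous_on S f"
| "times_differentiable_on (Suc n) S f \<longleftrightarrow> (\<forall>x\<in>S. f differentiable (at x)) \<and>
     (\<forall>v. times_differentiable_on n S (\<lambda>x. frechet_derivative f (at x) v))"

definition smooth_on :: "'a::real_normed_vector set \<Rightarrow> ('a \<Rightarrow> 'b::real_normed_vector) \<Rightarrow> bool" where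
  "smooth_on S f \<longleftrightarrow> (\<forall>n. times_differentiable_on n S f)"

definition diffeomorphism ::
  "'a::real_normed_vector set \<Rightarrow> 'b::real_normed_vector set \<Rightarrow> ('a \<Rightarrow> 'b) \<Rightarrow> bool" where
  "diffeomorphism U V f \<longleftrightarrow> open U \<and> open V \<and> bij_betw f U V \<and>
     smooth_on U f \<and> smooth_on V (inv_into U f)"

definition embedded_submanifold :: "'a::euclidean_space set \<Rightarrow> bool" where
  "embedded_submanifold N \<longleftrightarrow> (\<forall>p\<in>N. \<exists>X Y E. \<exists>F::'a \<Rightarrow> 'a.
     p \<in> X \<and> diffeomorphism X Y F \<and> subspace E \<and> F ` (X \<inter> N) = Y \<inter> E)"

text \<open>
  An immersed submanifold of a Euclidean space is given by its underlying set \<open>topspace \<tau>\<close>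
  and its manifold topology \<open>\<tau>\<close>, which may be finer than the subspace topology. Locally in \<open>\<tau>\<close>
  an injective immersion is an embedding, and this determines the smooth structure.
\<close>

definition immersed_submanifold :: "'a::euclidean_space topology \<Rightarrow> bool" where
  "immersed_submanifold \<tau> \<longleftrightarrow> Hausdorff_space \<tau> \<and> second_countable \<tau> \<and>
     (\<forall>p\<in>topspace \<tau>. \<exists>N. openin \<tau> N \<and> p \<in> N \<and> embedded_submanifold N \<and>
        subtopology \<tau> N = top_of_set N)"

text \<open>
  Smooth maps between (immersed) submanifolds: continuous for the manifold topologies, and locally
  the restriction of a smooth map between the ambient spaces.
\<close>

definition smooth_map ::
  "'a::real_normed_vector topology \<Rightarrow> 'b::real_normed_vector topology \<Rightarrow> ('a \<Rightarrow> 'b) \<Rightarrow> bool" where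
  "smooth_map \<sigma> \<tau> f \<longleftrightarrow> continuous_map \<sigma> \<tau> f \<and>
     (\<forall>p\<in>topspace \<sigma>. \<exists>N X F. openin \<sigma> N \<and> p \<in> N \<and> open X \<and> N \<subseteq> X \<and> smooth_on X F \<and>
        (\<forall>q\<in>N. F q = f q))"

definition tangent_space :: "'a::real_normed_vector topology \<Rightarrow> 'a \<Rightarrow> 'a set" where
  "tangent_space \<tau> p = {v. \<exists>(\<gamma>::real \<Rightarrow> 'a) \<epsilon>. \<epsilon> > 0 \<and> smooth_map (top_of_set {-\<epsilon><..<\<epsilon>}) \<tau> \<gamma> \<and>
     \<gamma> 0 = p \<and> (\<gamma> has_vector_derivative v) (at 0)}"


section \<open>Groupoids\<close>

text \<open>
  The ambient groupoids below all have an open subset of a Euclidean space as set of arrows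
  and as set of objects, so that one global chart describes their smooth structure.
  \<open>gpd_mult G g h\<close> is defined when \<open>gpd_src G g = gpd_tgt G h\<close> (first \<open>h\<close>, then \<open>g\<close>).
\<close>

record ('g, 'm) groupoid =
  gpd_arr :: "'g set"
  gpd_obj :: "'m set"
  gpd_src :: "'g \<Rightarrow> 'm"
  gpd_tgt :: "'g \<Rightarrow> 'm"
  gpd_id :: "'m \<Rightarrow> 'g"
  gpd_mult :: "'g \<Rightarrow> 'g \<Rightarrow> 'g"
  gpd_inv :: "'g \<Rightarrow> 'g"

definition composable :: "('g, 'm) groupoid \<Rightarrow> 'g set \<Rightarrow> ('g \<times> 'g) set" where
  "composable G S = {(g, h). g \<in> S \<and> h \<in> S \<and> gpd_src G g = gpd_tgt G h}"

definition lie_groupoid_morphism ::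
  "('g::real_normed_vector, 'm::real_normed_vector) groupoid \<Rightarrow>
   ('h::real_normed_vector, 'k::real_normed_vector) groupoid \<Rightarrow> ('g \<Rightarrow> 'h) \<Rightarrow> ('m \<Rightarrow> 'k) \<Rightarrow> bool" where
  "lie_groupoid_morphism G H F f \<longleftrightarrow>
     F ` gpd_arr G \<subseteq> gpd_arr H \<and> f ` gpd_obj G \<subseteq> gpd_obj H \<and>
     smooth_on (gpd_arr G) F \<and> smooth_on (gpd_obj G) f \<and>
     (\<forall>g\<in>gpd_arr G. gpd_src H (F g) = f (gpd_src G g) \<and> gpd_tgt H (F g) = f (gpd_tgt G g)) \<and>
     (\<forall>x\<in>gpd_obj G. F (gpd_id G x) = gpd_id H (f x)) \<and>
     (\<forall>(g, h)\<in>composable G (gpd_arr G). F (gpd_mult G g h) = gpd_mult H (F g) (F h))"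

text \<open>
  A Lie subgroupoid over the same base: a subgroupoid which carries the structure of
  an immersed submanifold \<open>\<tau>\<close>, making it a Lie groupoid.
\<close>

definition lie_subgroupoid ::
  "('g::euclidean_space, 'm::euclidean_space) groupoid \<Rightarrow> 'g topology \<Rightarrow> bool" where
  "lie_subgroupoid G \<tau> \<longleftrightarrow> (let S = topspace \<tau> in
     S \<subseteq> gpd_arr G \<and>
     (\<forall>x\<in>gpd_obj G. gpd_id G x \<in> S) \<and>
     (\<forall>g\<in>S. gpd_inv G g \<in> S) \<and>
     (\<forall>(g, h)\<in>composable G S. gpd_mult G g h \<in> S) \<and>
     immersed_submanifold \<tau> \<and>
     smooth_map \<tau> (top_of_set (gpd_obj G)) (gpd_src G) \<and>
     smooth_map \<tau> (top_of_set (gpd_obj G)) (gpd_tgt G) \<and>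
     smooth_map (top_of_set (gpd_obj G)) \<tau> (gpd_id G) \<and>
     smooth_map \<tau> \<tau> (gpd_inv G) \<and>
     smooth_map (subtopology (prod_topology \<tau> \<tau>) (composable G S)) \<tau> (\<lambda>(g, h). gpd_mult G g h) \<and>
     (\<forall>g\<in>S. frechet_derivative (gpd_src G) (at g) ` tangent_space \<tau> g = UNIV) \<and>
     (\<forall>g\<in>S. frechet_derivative (gpd_tgt G) (at g) ` tangent_space \<tau> g = UNIV))"

text \<open>The fibre \<open>T\<^bsub>\<epsilon>(x)\<^esub> \<beta>\<^sup>-\<^sup>1(x)\<close> of the Lie algebroid, \<open>\<beta>\<close> being the target.\<close>

definition algebroid_fibre ::
  "('g::euclidean_space, 'm::euclidean_space) groupoid \<Rightarrow> 'g topology \<Rightarrow> 'm \<Rightarrow> 'g set" where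
  "algebroid_fibre G \<tau> x =
     tangent_space (subtopology \<tau> {g \<in> topspace \<tau>. gpd_tgt G g = x}) (gpd_id G x)"

definition pair_groupoid :: "'m set \<Rightarrow> ('m \<times> 'm, 'm) groupoid" where
  "pair_groupoid U = \<lparr>gpd_arr = U \<times> U, gpd_obj = U, gpd_src = fst, gpd_tgt = snd,
     gpd_id = (\<lambda>x. (x, x)), gpd_mult = (\<lambda>(y, z) (x, y'). (x, z)), gpd_inv = (\<lambda>(x, y). (y, x))\<rparr>"


section \<open>The groupoid of 1-jets of local diffeomorphisms\<close>

text \<open>
  For open \<open>U \<subseteq> \<real>\<^sup>n\<close> the 1-jet of \<open>\<psi>\<close> at \<open>x\<close> is \<open>(x, \<psi>(x), D\<psi>(x))\<close>, i.e. its coordinates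
  \<open>(x\<^sup>i, y\<^sup>j, y\<^sup>j\<^sub>i)\<close>; the matrix entry \<open>y\<^sup>j\<^sub>i\<close> is \<open>A $ j $ i\<close>.
\<close>

type_synonym 'n jet = "(real^'n) \<times> (real^'n) \<times> (real^'n^'n)"

definition jet1 :: "(real^'n \<Rightarrow> real^'n) \<Rightarrow> real^'n \<Rightarrow> 'n::finite jet" where
  "jet1 \<psi> x = (x, \<psi> x, jacobian \<psi> (at x))"

fun jet1_mult :: "'n::finite jet \<Rightarrow> 'n::finite jet \<Rightarrow> 'n::finite jet" where
  "jet1_mult (y, z, B) (x, y', A) = (x, z, B ** A)"

fun jet1_inv :: "'n::finite jet \<Rightarrow> 'n::finite jet" where
  "jet1_inv (x, y, A) = (y, x, matrix_inv A)"

definition jet_groupoid :: "(real^'n) set \<Rightarrow> ('n::finite jet, real^'n) groupoid" where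
  "jet_groupoid M = \<lparr>
     gpd_arr = {jet1 \<psi> x |\<psi> x. \<exists>U V. U \<subseteq> M \<and> V \<subseteq> M \<and> x \<in> U \<and> diffeomorphism U V \<psi>},
     gpd_obj = M, gpd_src = (\<lambda>(x, y, A). x), gpd_tgt = (\<lambda>(x, y, A). y),
     gpd_id = (\<lambda>x. (x, x, mat 1)), gpd_mult = jet1_mult, gpd_inv = jet1_inv\<rparr>"


section \<open>Frame bundles and 1-jets of principal bundle isomorphisms\<close>

text \<open>
  The frame \<open>j\<^sup>1\<^bsub>0,x\<^esub>\<phi>\<close> is represented by \<open>(x, D\<phi>(0))\<close>, that is by its coordinates
  \<open>(x\<^sup>i, x\<^sup>i\<^sub>j)\<close> with \<open>x\<^sup>i\<^sub>j = A $ i $ j\<close>. In particular \<open>e\<^sub>1\<^sub>x = (x, mat 1)\<close>.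
\<close>

type_synonym 'n frame = "(real^'n) \<times> (real^'n^'n)"

definition frames :: "(real^'n) set \<Rightarrow> 'n::finite frame set" where
  "frames U = {(x, A). x \<in> U \<and> invertible A}"

fun frame_act :: "'n::finite frame \<Rightarrow> real^'n^'n \<Rightarrow> 'n::finite frame" where
  "frame_act (x, A) g = (x, A ** g)"

definition equivariant_on :: "'n::finite frame set \<Rightarrow> ('n::finite frame \<Rightarrow> 'n::finite frame) \<Rightarrow> bool" where
  "equivariant_on Z \<Psi> \<longleftrightarrow> (\<forall>z\<in>Z. \<forall>g. invertible g \<longrightarrow> \<Psi> (frame_act z g) = frame_act (\<Psi> z) g)"

definition frame_map :: "(real^'n \<Rightarrow> real^'n) \<Rightarrow> 'n::finite frame \<Rightarrow> 'n::finite frame" where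
  "frame_map \<psi> = (\<lambda>(x, A). (\<psi> x, jacobian \<psi> (at x) ** A))"

definition translation :: "real^'n \<Rightarrow> real^'n \<Rightarrow> real^'n" where
  "translation v = (\<lambda>x. x + v)"

definition local_bundle_iso ::
  "(real^'n) set \<Rightarrow> (real^'n) set \<Rightarrow> ('n::finite frame \<Rightarrow> 'n::finite frame) \<Rightarrow> bool" where
  "local_bundle_iso U V \<Psi> \<longleftrightarrow> open U \<and> open V \<and>
     diffeomorphism (frames U) (frames V) \<Psi> \<and> equivariant_on (frames U) \<Psi>"

text \<open>
  The class \<open>j\<^sup>1\<^bsub>x,y\<^esub>\<Psi>\<close> modulo the linear group is represented by the 1-jet of \<open>\<Psi>\<close> at the frame
  \<open>e\<^sub>1\<^sub>x\<close>, written in the coordinates \<open>(x\<^sup>i, y\<^sup>j, y\<^sup>j\<^sub>i, y\<^sup>j\<^sub>,\<^sub>i, y\<^sup>j\<^sub>i\<^sub>,\<^sub>k)\<close> of the standard chart of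
  \<open>\<real>\<^sup>n\<close>; lemma \<open>frame_jet_eq_iff\<close> shows that this represents the quotient.
  The last component is indexed as \<open>T $ j $ i $ k\<close>.
\<close>

type_synonym 'n frame_jet =
  "(real^'n) \<times> (real^'n) \<times> (real^'n^'n) \<times> (real^'n^'n) \<times> (real^'n^'n^'n)"

definition frame_jet :: "('n::finite frame \<Rightarrow> 'n::finite frame) \<Rightarrow> real^'n \<Rightarrow> 'n::finite frame_jet" where
  "frame_jet \<Psi> x = (let e = (x, mat 1); D = frechet_derivative \<Psi> (at e) in
     (x, fst (\<Psi> e), snd (\<Psi> e), (\<chi> j i. fst (D (axis i 1, 0)) $ j),
      (\<chi> j i k. snd (D (axis k 1, 0)) $ j $ i)))"

fun fj_src :: "'n::finite frame_jet \<Rightarrow> real^'n" where "fj_src (x, y, A, M, T) = x"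
fun fj_tgt :: "'n::finite frame_jet \<Rightarrow> real^'n" where "fj_tgt (x, y, A, M, T) = y"

definition fj_id :: "real^'n \<Rightarrow> 'n::finite frame_jet" where
  "fj_id x = (x, x, mat 1, mat 1, 0)"

text \<open>
  If \<open>\<Psi>(u, C) = (\<psi>(u), Q(u) ** C)\<close>, then \<open>A = Q(x)\<close>, \<open>M = D\<psi>(x)\<close> and \<open>T\<^sup>j\<^sub>i\<^sub>,\<^sub>k = \<partial>\<^sub>kQ\<^sup>j\<^sub>i(x)\<close>. The
  formula below is the chain rule for \<open>j\<^sup>1\<^bsub>y,z\<^esub>\<Phi> \<cdot> j\<^sup>1\<^bsub>x,y\<^esub>\<Psi> = j\<^sup>1\<^bsub>x,z\<^esub>(\<Phi> \<circ> \<Psi>)\<close>; see lemma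
  \<open>frame_jet_comp\<close>.
\<close>

fun fj_mult :: "'n::finite frame_jet \<Rightarrow> 'n::finite frame_jet \<Rightarrow> 'n::finite frame_jet" where
  "fj_mult (y, z, B, N, S) (x, y', A, M, T) = (x, z, B ** A, N ** M,
     (\<chi> j i k. (\<Sum>m\<in>UNIV. \<Sum>l\<in>UNIV. S $ j $ m $ l * M $ l $ k * A $ m $ i) +
               (\<Sum>m\<in>UNIV. B $ j $ m * T $ m $ i $ k)))"

fun fj_inv :: "'n::finite frame_jet \<Rightarrow> 'n::finite frame_jet" where
  "fj_inv (x, y, A, M, T) = (let A' = matrix_inv A; M' = matrix_inv M in (y, x, A', M',
     (\<chi> j i k. - (\<Sum>m\<in>UNIV. \<Sum>p\<in>UNIV. \<Sum>l\<in>UNIV.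
        A' $ j $ m * T $ m $ p $ l * M' $ l $ k * A' $ p $ i))))"

text \<open>The groupoid of 1-jets of local principal bundle isomorphisms of the frame bundle of \<open>M\<close>.\<close>

definition frame_jet_groupoid :: "(real^'n) set \<Rightarrow> ('n::finite frame_jet, real^'n) groupoid" where
  "frame_jet_groupoid M = \<lparr>
     gpd_arr = {frame_jet \<Psi> x |\<Psi> x. \<exists>U V. U \<subseteq> M \<and> V \<subseteq> M \<and> x \<in> U \<and> local_bundle_iso U V \<Psi>},
     gpd_obj = M, gpd_src = fj_src, gpd_tgt = fj_tgt, gpd_id = fj_id,
     gpd_mult = fj_mult, gpd_inv = fj_inv\<rparr>"


lemma invertible_mat_1: "invertible (mat 1 :: real^'n::finite^'n)"
  unfolding invertible_def by (metis matrix_mul_lid)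

lemma local_bundle_iso_differentiable:
  assumes "local_bundle_iso U V \<Psi>" "z \<in> frames U"
  shows "\<Psi> differentiable (at z)"
proof -
  have "smooth_on (frames U) \<Psi>"
    using assms by (auto simp: local_bundle_iso_def diffeomorphism_def)
  then have "times_differentiable_on (Suc 0) (frames U) \<Psi>"
    unfolding smooth_on_def by blast
  then show ?thesis using assms(2) by simp
qed

lemma bounded_linear_matrix_mult_left: "bounded_linear (\<lambda>C::real^'n::finite^'n. R ** C)"
  by (intro linear_conv_bounded_linear[THEN iffD1] linearI)
     (auto simp: matrix_add_ldistrib vec_eq_iff matrix_matrix_mult_def sum.distrib algebra_simps sum_distrib_left)

lemma bounded_linear_matrix_mult_right: "bounded_linear (\<lambda>C::real^'n::finite^'n. C ** R)"
  by (intro linear_conv_bounded_linear[THEN iffD1] linearI)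
     (auto simp: vec_eq_iff matrix_matrix_mult_def sum.distrib algebra_simps sum_distrib_left)

lemma local_bundle_iso_act:
  assumes "local_bundle_iso U V \<Psi>" "x \<in> U" "invertible A"
  shows "\<Psi> (x, A) = frame_act (\<Psi> (x, mat 1)) A"
proof -
  have "(x, mat 1) \<in> frames U"
    using assms(2) by (simp add: frames_def invertible_mat_1)
  then have "\<Psi> (frame_act (x, mat 1) A) = frame_act (\<Psi> (x, mat 1)) A"
    using assms unfolding local_bundle_iso_def equivariant_on_def by blast
  then show ?thesis by simp
qed

lemma bundle_iso_derivative:
  assumes iso: "local_bundle_iso U V \<Psi>" and x: "x \<in> U" and A: "invertible A"
  defines "D \<equiv> frechet_derivative \<Psi> (at (x, mat 1))"
  shows "frechet_derivative \<Psi> (at (x, A)) (v, C) =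
    (fst (D (v, 0)), snd (D (v, 0)) ** A + snd (\<Psi> (x, mat 1)) ** C)"
proof -
  have opn: "open (frames U)"
    using iso by (auto simp: local_bundle_iso_def diffeomorphism_def)
  have eq: "\<Psi> (frame_act z g) = frame_act (\<Psi> z) g" if "z \<in> frames U" "invertible g" for z g
    using iso that by (auto simp: local_bundle_iso_def equivariant_on_def)
  have in1: "(x, mat 1) \<in> frames U" and inA: "(x, A) \<in> frames U"
    using x A by (auto simp: frames_def invertible_mat_1)
  have D: "(\<Psi> has_derivative D) (at (x, mat 1))"
    unfolding D_def using local_bundle_iso_differentiable[OF iso in1] frechet_derivative_works by blast
  let ?E = "frechet_derivative \<Psi> (at (x, A))"
  have E: "(\<Psi> has_derivative ?E) (at (x, A))"
    using local_bundle_iso_differentiable[OF iso inA] frechet_derivative_works by blast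
  let ?R = "\<lambda>z. (fst z, snd z ** A) :: 'a frame"
  have R: "bounded_linear ?R"
    by (intro bounded_linear_Pair bounded_linear_fst
        bounded_linear_compose[OF bounded_linear_matrix_mult_right bounded_linear_snd])
  have "((\<lambda>z. \<Psi> (?R z)) has_derivative (\<lambda>h. ?E (?R h))) (at (x, mat 1))"
    by (rule has_derivative_compose[OF bounded_linear.has_derivative[OF R has_derivative_ident]])
       (use E in simp)
  moreover have "((\<lambda>z. \<Psi> (?R z)) has_derivative (\<lambda>h. ?R (D h))) (at (x, mat 1))"
  proof (rule has_derivative_transform_within_open[OF bounded_linear.has_derivative[OF R D] opn in1])
    fix z assume z: "z \<in> frames U"
    show "?R (\<Psi> z) = \<Psi> (?R z)" using eq[OF z A] by (cases z; cases "\<Psi> z") auto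
  qed
  ultimately have "(\<lambda>h. ?E (?R h)) = (\<lambda>h. ?R (D h))" by (rule has_derivative_unique)
  from fun_cong[OF this, of "(v, 0)"]
  have horiz: "?E (v, 0) = (fst (D (v, 0)), snd (D (v, 0)) ** A)" by simp
  let ?L = "\<lambda>C. (fst (\<Psi> (x, mat 1)), snd (\<Psi> (x, mat 1)) ** C)"
  have opn': "open {C. (x, C) \<in> frames U}"
    using open_vimage[OF opn, of "\<lambda>C. (x, C)"] by (simp add: vimage_def continuous_intros)
  have "((\<lambda>C. \<Psi> (x, C)) has_derivative (\<lambda>h. ?E (0, h))) (at A)"
    by (rule has_derivative_compose[of "\<lambda>C. (x, C)" "\<lambda>h. (0, h)"])
       (use E in \<open>auto intro!: derivative_eq_intros\<close>)
  moreover have "((\<lambda>C. \<Psi> (x, C)) has_derivative (\<lambda>h. (0, snd (\<Psi> (x, mat 1)) ** h))) (at A)"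
  proof (rule has_derivative_transform_within_open[OF _ opn', of ?L])
    show "(?L has_derivative (\<lambda>h. (0, snd (\<Psi> (x, mat 1)) ** h))) (at A)"
      by (intro has_derivative_Pair has_derivative_const
          bounded_linear.has_derivative[OF bounded_linear_matrix_mult_left has_derivative_ident])
    fix C assume "C \<in> {C. (x, C) \<in> frames U}"
    then have "invertible C" by (simp add: frames_def)
    from eq[OF in1 this] show "?L C = \<Psi> (x, C)" by (cases "\<Psi> (x, mat 1)") auto
  qed (use inA in simp)
  ultimately have "(\<lambda>h. ?E (0, h)) = (\<lambda>h. (0, snd (\<Psi> (x, mat 1)) ** h))"
    by (rule has_derivative_unique)
  from fun_cong[OF this, of C] have vert: "?E (0, C) = (0, snd (\<Psi> (x, mat 1)) ** C)" .
  have "?E (v, C) = ?E (v, 0) + ?E (0, C)"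
    using linear_add[OF has_derivative_linear[OF E], of "(v, 0)" "(0, C)"] by simp
  then show ?thesis using horiz vert by simp
qed

text \<open>
  The class of a 1-jet under the action of the linear group determines and is determined by
  \<open>frame_jet\<close>: the values agree iff the 1-jets agree at one, equivalently at every, frame over \<open>x\<close>.
\<close>

lemma frame_jet_eq_iff:
  fixes \<Psi> \<Phi> :: "'n::finite frame \<Rightarrow> 'n frame"
  assumes "local_bundle_iso U V \<Psi>" "local_bundle_iso U' V' \<Phi>" "x \<in> U" "x \<in> U'" "invertible A"
  shows "frame_jet \<Psi> x = frame_jet \<Phi> x \<longleftrightarrow> \<Psi> (x, A) = \<Phi> (x, A) \<and>
    frechet_derivative \<Psi> (at (x, A)) = frechet_derivative \<Phi> (at (x, A))"
proof -
  let ?D = "\<lambda>\<Psi>. frechet_derivative \<Psi> (at (x, mat 1)) :: 'n frame \<Rightarrow> 'n frame"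
  have lin: "linear (?D \<Psi>)" "linear (?D \<Phi>)"
    using assms by (auto intro!: linear_frechet_derivative local_bundle_iso_differentiable
        simp: frames_def invertible_mat_1)
  have canc: "X ** A = Y ** A \<longleftrightarrow> X = Y" for X Y :: "real^'n^'n"
    using assms(5) unfolding invertible_def by (metis matrix_mul_assoc matrix_mul_rid)
  have "\<Psi> (x, A) = \<Phi> (x, A) \<longleftrightarrow> \<Psi> (x, mat 1) = \<Phi> (x, mat 1)"
    unfolding local_bundle_iso_act[OF assms(1,3,5)] local_bundle_iso_act[OF assms(2,4,5)]
    by (cases "\<Psi> (x, mat 1)"; cases "\<Phi> (x, mat 1)") (auto simp: canc)
  moreover have "(\<forall>k. ?D \<Psi> (axis k 1, 0) = ?D \<Phi> (axis k 1, 0)) \<longleftrightarrow> (\<forall>v. ?D \<Psi> (v, 0) = ?D \<Phi> (v, 0))"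
  proof
    assume *: "\<forall>k. ?D \<Psi> (axis k 1, 0) = ?D \<Phi> (axis k 1, 0)"
    have l: "linear (\<lambda>v. f (v, 0))" if "linear f" for f :: "'n frame \<Rightarrow> 'n frame"
    proof -
      have "linear (\<lambda>v. (v, 0) :: 'n frame)"
        by (auto intro!: linearI)
      from linear_compose[OF this that] show ?thesis by (simp add: o_def)
    qed
    have "(\<lambda>v. ?D \<Psi> (v, 0)) = (\<lambda>v. ?D \<Phi> (v, 0))"
      by (rule linear_eq_stdbasis[OF l[OF lin(1)] l[OF lin(2)]])
         (use * in \<open>auto simp: Basis_vec_def\<close>)
    then show "\<forall>v. ?D \<Psi> (v, 0) = ?D \<Phi> (v, 0)" by metis
  qed auto
  moreover have "frame_jet \<Psi> x = frame_jet \<Phi> x \<longleftrightarrow> \<Psi> (x, mat 1) = \<Phi> (x, mat 1) \<and>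
      (\<forall>k. ?D \<Psi> (axis k 1, 0) = ?D \<Phi> (axis k 1, 0))"
    unfolding frame_jet_def Let_def by (auto simp: vec_eq_iff prod_eq_iff)
  moreover have "frechet_derivative \<Psi> (at (x, A)) = frechet_derivative \<Phi> (at (x, A)) \<longleftrightarrow>
      (\<forall>v. ?D \<Psi> (v, 0) = ?D \<Phi> (v, 0))" if "\<Psi> (x, mat 1) = \<Phi> (x, mat 1)"
  proof
    assume *: "frechet_derivative \<Psi> (at (x, A)) = frechet_derivative \<Phi> (at (x, A))"
    show "\<forall>v. ?D \<Psi> (v, 0) = ?D \<Phi> (v, 0)"
    proof
      fix v
      from fun_cong[OF *, of "(v, 0)"] show "?D \<Psi> (v, 0) = ?D \<Phi> (v, 0)"
        unfolding bundle_iso_derivative[OF assms(1,3,5)] bundle_iso_derivative[OF assms(2,4,5)]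
        by (simp add: that canc prod_eq_iff)
    qed
  next
    assume *: "\<forall>v. ?D \<Psi> (v, 0) = ?D \<Phi> (v, 0)"
    show "frechet_derivative \<Psi> (at (x, A)) = frechet_derivative \<Phi> (at (x, A))"
    proof (rule ext)
      fix h :: "'n frame"
      obtain v C where h: "h = (v, C)" by (cases h)
      show "frechet_derivative \<Psi> (at (x, A)) h = frechet_derivative \<Phi> (at (x, A)) h"
        unfolding h bundle_iso_derivative[OF assms(1,3,5)] bundle_iso_derivative[OF assms(2,4,5)]
        using that * by simp
    qed
  qed
  ultimately show ?thesis by blast
qed

lemma frame_jet_comp:
  fixes \<Psi> \<Phi> :: "'n::finite frame \<Rightarrow> 'n frame"
  assumes "local_bundle_iso U V \<Psi>" "local_bundle_iso V' X \<Phi>" "x \<in> U" "fst (\<Psi> (x, mat 1)) \<in> V'"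
  shows "frame_jet (\<Phi> \<circ> \<Psi>) x = fj_mult (frame_jet \<Phi> (fst (\<Psi> (x, mat 1)))) (frame_jet \<Psi> x)"
proof -
  have in1: "(x, mat 1) \<in> frames U" using assms by (auto simp: frames_def invertible_mat_1)
  obtain y A where yA: "\<Psi> (x, mat 1) = (y, A)" by (cases "\<Psi> (x, mat 1)")
  have "\<Psi> (x, mat 1) \<in> frames V"
    using assms(1) in1 by (auto simp: local_bundle_iso_def diffeomorphism_def bij_betw_def)
  with yA have A: "invertible A" by (simp add: frames_def)
  have y: "y \<in> V'" using assms(4) yA by simp
  let ?D = "frechet_derivative \<Psi> (at (x, mat 1))" and ?E = "frechet_derivative \<Phi> (at (y, mat 1))"
  have "frechet_derivative (\<Phi> \<circ> \<Psi>) (at (x, mat 1)) = frechet_derivative \<Phi> (at (y, A)) \<circ> ?D"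
    using frechet_derivative_compose[of \<Psi> "(x, mat 1)" \<Phi>] yA y A
      local_bundle_iso_differentiable[OF assms(1) in1]
      local_bundle_iso_differentiable[OF assms(2), of "(y, A)"]
    by (simp add: frames_def)
  then have d: "frechet_derivative (\<Phi> \<circ> \<Psi>) (at (x, mat 1)) h =
      (fst (?E (fst (?D h), 0)), snd (?E (fst (?D h), 0)) ** A + snd (\<Phi> (y, mat 1)) ** snd (?D h))" for h
    using bundle_iso_derivative[OF assms(2) y A, of "fst (?D h)" "snd (?D h)"] by simp
  have "linear ?E"
    using assms y by (auto intro!: linear_frechet_derivative local_bundle_iso_differentiable
        simp: frames_def invertible_mat_1)
  moreover have "linear (\<lambda>v. (v, 0) :: 'n frame)"
    by (auto intro!: linearI)
  ultimately have l: "linear (\<lambda>v. ?E (v, 0))"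
    using linear_compose[of "\<lambda>v. (v, 0)" ?E] by (simp add: o_def)
  have e: "?E (v, 0) = (\<Sum>l\<in>UNIV. v $ l *\<^sub>R ?E (axis l 1, 0))" for v
  proof -
    have v: "v = (\<Sum>l\<in>UNIV. v $ l *\<^sub>R axis l 1)"
      using basis_expansion[of v] by (simp add: scalar_mult_eq_scaleR)
    have "?E (\<Sum>l\<in>UNIV. v $ l *\<^sub>R axis l 1, 0) = (\<Sum>l\<in>UNIV. ?E (v $ l *\<^sub>R axis l 1, 0))"
      by (rule linear_sum[OF l])
    also have "\<dots> = (\<Sum>l\<in>UNIV. v $ l *\<^sub>R ?E (axis l 1, 0))"
      by (rule sum.cong[OF refl], rule linear_cmul[OF l])
    finally show ?thesis using v by metis
  qed
  have val: "\<Phi> (y, A) = frame_act (\<Phi> (y, mat 1)) A"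
    by (rule local_bundle_iso_act[OF assms(2) y A])
  have c1: "fst (\<Phi> (y, A)) = fst (\<Phi> (y, mat 1))" "snd (\<Phi> (y, A)) = snd (\<Phi> (y, mat 1)) ** A"
    unfolding val by (cases "\<Phi> (y, mat 1)"; simp)+
  show ?thesis
    unfolding frame_jet_def Let_def d yA
    apply (simp add: yA c1 prod_eq_iff vec_eq_iff matrix_matrix_mult_def)
    apply (intro conjI allI)
    subgoal for j i
      by (subst e[of "fst (?D (axis i 1, 0))"]) (simp add: fst_sum sum_component mult.commute)
    subgoal for j i k
      apply (subst e[of "fst (?D (axis k 1, 0))"])
      apply (simp add: snd_sum sum_component sum_distrib_right sum_distrib_left)
      by (simp add: mult_ac)
    done
qed

lemma fj_mult_id: "fj_mult (fj_id y) (x, y, A, M, T) = (x, y, A, M, T)"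
proof -
  have "(\<Sum>m\<in>UNIV. mat 1 $ j $ m * T $ m $ i $ k) = T $ j $ i $ k" for j i k
    by (simp add: mat_def if_distrib[of "\<lambda>t. t * _"] cong: if_cong)
  then show ?thesis by (simp add: fj_id_def vec_eq_iff)
qed

lemma frame_jet_translation:
  fixes x v :: "real^'n::finite"
  shows "frame_jet (frame_map (translation v)) x = (x, x + v, mat 1, mat 1, 0)"
proof -
  have "((\<lambda>x. x + v) has_derivative id) (at u)" for u
    by (auto intro!: derivative_eq_intros simp: id_def)
  then have "frechet_derivative (\<lambda>x. x + v) (at u) = id" for u
    by (metis frechet_derivative_at)
  then have "jacobian (\<lambda>x. x + v) (at u) = mat 1" for u
    by (simp add: jacobian_def matrix_id_mat_1)
  then have *: "frame_map (translation v) = (\<lambda>z. (fst z + v, snd z))"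
    by (simp add: frame_map_def translation_def fun_eq_iff)
  have "((\<lambda>z::'n frame. (fst z + v, snd z)) has_derivative (\<lambda>z. (fst z, snd z))) (at (x, mat 1))"
    by (intro has_derivative_Pair has_derivative_add_const has_derivative_fst has_derivative_snd
        has_derivative_ident)
  from frechet_derivative_at[OF this]
  have "frechet_derivative (\<lambda>z::'n frame. (fst z + v, snd z)) (at (x, mat 1)) = (\<lambda>z. (fst z, snd z))"
    by simp
  then show ?thesis
    unfolding * frame_jet_def Let_def by (simp add: vec_eq_iff mat_def axis_def)
qed
lemma fj_mult_inv_left:
  fixes A M :: "real^'n::finite^'n"
  assumes "invertible A" "invertible M"
  shows "fj_mult (fj_inv (x, y, A, M, T)) (x, y, A, M, T) = fj_id x"
proof -
  have 1: "(matrix_inv A) ** A = mat 1" "A ** matrix_inv A = mat 1"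
     "(matrix_inv M) ** M = mat 1" "M ** matrix_inv M = mat 1" 
    using assms unfolding invertible_def matrix_inv_def by (metis (mono_tags, lifting) someI_ex)+
  have iA: "(\<Sum>m\<in>UNIV. matrix_inv A $ p $ m * A $ m $ i) = (if p = i then 1 else 0)" for p i
    using arg_cong[OF 1(1), of "\<lambda>X. X $ p $ i"] by (simp add: matrix_matrix_mult_def mat_def)
  have iM: "(\<Sum>m\<in>UNIV. matrix_inv M $ p $ m * M $ m $ i) = (if p = i then 1 else 0)" for p i
    using arg_cong[OF 1(3), of "\<lambda>X. X $ p $ i"] by (simp add: matrix_matrix_mult_def mat_def)
  let ?A = "matrix_inv A" and ?M = "matrix_inv M"
  have "(\<Sum>m\<in>UNIV. \<Sum>l\<in>UNIV. (\<Sum>q\<in>UNIV. \<Sum>p\<in>UNIV. \<Sum>r\<in>UNIV.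
        ?A $ j $ q * T $ q $ p $ r * ?M $ r $ l * ?A $ p $ m) * M $ l $ k * A $ m $ i)
      = (\<Sum>q\<in>UNIV. ?A $ j $ q * T $ q $ i $ k)" (is "?l = ?r") for j i k
  proof -
    have "?l = (\<Sum>m\<in>UNIV. \<Sum>l\<in>UNIV. \<Sum>q\<in>UNIV. \<Sum>p\<in>UNIV. \<Sum>r\<in>UNIV.
       ?A $ j $ q * T $ q $ p $ r * (?M $ r $ l * M $ l $ k) * (?A $ p $ m * A $ m $ i))"
      by (simp add: sum_distrib_left sum_distrib_right mult_ac)
    also have "\<dots> = (\<Sum>m\<in>UNIV. \<Sum>q\<in>UNIV. \<Sum>p\<in>UNIV. \<Sum>r\<in>UNIV. \<Sum>l\<in>UNIV.
       ?A $ j $ q * T $ q $ p $ r * (?M $ r $ l * M $ l $ k) * (?A $ p $ m * A $ m $ i))"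
      by (rule sum.cong[OF refl], subst sum.swap, rule sum.cong[OF refl], subst sum.swap,
          rule sum.cong[OF refl], subst sum.swap, rule refl)
    also have "\<dots> = (\<Sum>q\<in>UNIV. \<Sum>p\<in>UNIV. \<Sum>m\<in>UNIV. \<Sum>r\<in>UNIV. \<Sum>l\<in>UNIV.
       ?A $ j $ q * T $ q $ p $ r * (?M $ r $ l * M $ l $ k) * (?A $ p $ m * A $ m $ i))"
      by (subst sum.swap, rule sum.cong[OF refl], subst sum.swap, rule refl)
    also have "\<dots> = (\<Sum>q\<in>UNIV. \<Sum>p\<in>UNIV. \<Sum>m\<in>UNIV. \<Sum>r\<in>UNIV.
       ?A $ j $ q * T $ q $ p $ r * (\<Sum>l\<in>UNIV. ?M $ r $ l * M $ l $ k) * (?A $ p $ m * A $ m $ i))"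
      by (simp add: sum_distrib_left sum_distrib_right)
    also have "\<dots> = (\<Sum>q\<in>UNIV. \<Sum>p\<in>UNIV. ?A $ j $ q * T $ q $ p $ k * (\<Sum>m\<in>UNIV. ?A $ p $ m * A $ m $ i))"
      by (simp add: iM sum_distrib_left if_distrib[of "\<lambda>t. _ * t"] if_distrib[of "\<lambda>t. t * _"] cong: if_cong)
    also have "\<dots> = ?r"
      by (simp add: iA if_distrib[of "\<lambda>t. _ * t"] cong: if_cong)
    finally show ?thesis .
  qed
  then show ?thesis
    by (simp add: Let_def fj_id_def 1 vec_eq_iff sum_negf)
qed


section \<open>Cosserat media\<close>

text \<open>
  Embeddings of principal bundles from the frame bundle of \<open>U\<close> to that of \<open>\<real>\<^sup>n\<close> over the
  identity of the structure group.
\<close>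

definition deformation :: "(real^'n) set \<Rightarrow> ('n::finite frame \<Rightarrow> 'n::finite frame) \<Rightarrow> bool" where
  "deformation U K \<longleftrightarrow> open U \<and> K ` frames U \<subseteq> frames UNIV \<and> equivariant_on (frames U) K \<and>
     smooth_on (frames U) K \<and> (\<forall>z\<in>frames U. inj (frechet_derivative K (at z))) \<and>
     (\<exists>K'. homeomorphism (frames U) (K ` frames U) K K')"

definition base_map :: "('n::finite frame \<Rightarrow> 'n::finite frame) \<Rightarrow> real^'n \<Rightarrow> real^'n" where
  "base_map K x = fst (K (x, mat 1))"

text \<open>\<open>j\<^sup>1\<^bsub>x,y\<^esub>\<Psi> \<mapsto> j\<^sup>1\<^bsub>x,z\<^esub>(F\<tau>\<^bsub>z - y\<^esub> \<circ> \<Psi>)\<close>\<close>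

definition move_target :: "real^'n \<Rightarrow> 'n::finite frame_jet \<Rightarrow> 'n::finite frame_jet" where
  "move_target z g =
     fj_mult (frame_jet (frame_map (translation (z - fj_tgt g))) (fj_tgt g)) g"

definition mechanical_response ::
  "(real^'n) set \<Rightarrow> ('n::finite frame_jet \<Rightarrow> 'v::real_normed_vector) \<Rightarrow> bool" where
  "mechanical_response B W \<longleftrightarrow> W differentiable_on gpd_arr (frame_jet_groupoid B) \<and>
     (\<forall>g\<in>gpd_arr (frame_jet_groupoid B). \<forall>z\<in>B. W g = W (move_target z g))"

text \<open>
  The extension of the response to jets with source in \<open>B\<close> and arbitrary target: the target
  is translated back into \<open>B\<close>. By the invariance of \<open>W\<close> any point of \<open>B\<close> could be used
  instead of the source.
\<close>

definition extended_response :: "('n::finite frame_jet \<Rightarrow> 'v) \<Rightarrow> 'n::finite frame_jet \<Rightarrow> 'v" where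
  "extended_response W g = W (move_target (fj_src g) g)"

definition material_groupoid ::
  "(real^'n) set \<Rightarrow> ('n::finite frame_jet \<Rightarrow> 'v::real_normed_vector) \<Rightarrow> 'n::finite frame_jet set" where
  "material_groupoid B W = {g \<in> gpd_arr (frame_jet_groupoid B). \<forall>K. deformation B K \<longrightarrow>
     extended_response W (fj_mult (frame_jet K (fj_tgt g)) g) =
     extended_response W (frame_jet K (fj_tgt g))}"

definition homogeneous_on ::
  "(real^'n) set \<Rightarrow> ('n::finite frame_jet \<Rightarrow> 'v::real_normed_vector) \<Rightarrow> (real^'n) set \<Rightarrow> bool" where
  "homogeneous_on B W U \<longleftrightarrow> open U \<and> U \<subseteq> B \<and> (\<exists>K. deformation U K \<and> (\<forall>x\<in>U. \<forall>y\<in>U.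
     frame_jet (inv_into (frames U) K \<circ>
       frame_map (translation (base_map K y - base_map K x)) \<circ> K) x \<in> material_groupoid B W))"

definition locally_homogeneous ::
  "(real^'n) set \<Rightarrow> ('n::finite frame_jet \<Rightarrow> 'v::real_normed_vector) \<Rightarrow> bool" where
  "locally_homogeneous B W \<longleftrightarrow> (\<forall>x\<in>B. \<exists>U. x \<in> U \<and> homogeneous_on B W U)"


section \<open>Local coordinates\<close>

definition local_coordinates :: "(real^'n) set \<Rightarrow> (real^'n \<Rightarrow> real^'n) \<Rightarrow> bool" where
  "local_coordinates U \<phi> \<longleftrightarrow> diffeomorphism U (\<phi> ` U) \<phi>"

text \<open>
  The coordinates induced by a chart \<open>\<phi>\<close> on jets: \<open>j\<^sup>1\<psi>\<close> is sent to \<open>j\<^sup>1(\<phi> \<circ> \<psi> \<circ> \<phi>\<^sup>-\<^sup>1)\<close>,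
  and \<open>j\<^sup>1\<Psi>\<close> to \<open>j\<^sup>1(F\<phi> \<circ> \<Psi> \<circ> (F\<phi>)\<^sup>-\<^sup>1)\<close>.
\<close>

definition jet_coordinates :: "(real^'n \<Rightarrow> real^'n) \<Rightarrow> 'n::finite jet \<Rightarrow> 'n::finite jet" where
  "jet_coordinates \<phi> = (\<lambda>(x, y, A).
     jet1_mult (jet1 \<phi> y) (jet1_mult (x, y, A) (jet1_inv (jet1 \<phi> x))))"

definition frame_jet_coordinates :: "(real^'n \<Rightarrow> real^'n) \<Rightarrow> 'n::finite frame_jet \<Rightarrow> 'n::finite frame_jet" where
  "frame_jet_coordinates \<phi> g = fj_mult (frame_jet (frame_map \<phi>) (fj_tgt g))
     (fj_mult g (fj_inv (frame_jet (frame_map \<phi>) (fj_src g))))"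

text \<open>The functions \<open>P\<^sup>j\<^sub>i(x, y)\<close>, defined on \<open>\<phi>(U) \<times> \<phi>(U)\<close>, in the local expression of \<open>\<P>\<close>.\<close>

definition local_expression ::
  "(real^'n) set \<Rightarrow> (real^'n \<Rightarrow> real^'n) \<Rightarrow> ((real^'n) \<times> (real^'n) \<Rightarrow> 'n::finite jet) \<Rightarrow>
   (real^'n) \<times> (real^'n) \<Rightarrow> real^'n^'n" where
  "local_expression U \<phi> \<P> =
     (\<lambda>(a, b). snd (snd (jet_coordinates \<phi> (\<P> (inv_into U \<phi> a, inv_into U \<phi> b)))))"

abbreviation partial_x :: "'n \<Rightarrow> ((real^'n) \<times> (real^'n) \<Rightarrow> 'b::real_normed_vector) \<Rightarrow>
   (real^'n) \<times> (real^'n) \<Rightarrow> 'b" where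
  "partial_x l P \<equiv> (\<lambda>z. frechet_derivative P (at z) (axis l 1, 0))"

abbreviation partial_y :: "'n \<Rightarrow> ((real^'n) \<times> (real^'n) \<Rightarrow> 'b::real_normed_vector) \<Rightarrow>
   (real^'n) \<times> (real^'n) \<Rightarrow> 'b" where
  "partial_y l P \<equiv> (\<lambda>z. frechet_derivative P (at z) (0, axis l 1))"

text \<open>
  The value on \<open>\<partial>/\<partial>x\<^sup>l\<close>, at the point with coordinates \<open>a\<close>, of the section determined by \<open>P\<close>.
  Its entries are the components of a tangent vector along \<open>x\<^sup>i, y\<^sup>j, y\<^sup>j\<^sub>i, y\<^sup>j\<^sub>,\<^sub>i, y\<^sup>j\<^sub>i\<^sub>,\<^sub>k\<close>; the
  second one vanishes because algebroid elements are tangent to the target fibre.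
\<close>

definition section_components ::
  "((real^'n) \<times> (real^'n) \<Rightarrow> real^'n^'n) \<Rightarrow> real^'n \<Rightarrow> 'n \<Rightarrow> 'n::finite frame_jet" where
  "section_components P a l = (axis l 1, 0, partial_x l P (a, a), 0,
     (\<chi> j i k. (partial_x l (partial_x k P) (a, a) + partial_x l (partial_y k P) (a, a)) $ j $ i))"

end

theory Submission
  imports Defs
begin

text \<open>
  Over a chart \<open>\<kappa>\<close> and a field \<open>Q\<close> of invertible matrices on \<open>U\<close>, a deformation is
  \<open>K(u, C) = (\<kappa>(u), Q(u) C)\<close>, and a parallelism is \<open>P(x, y) = Q(y)\<^sup>-\<^sup>1 Q(x)\<close>; both data are
  equivalent. The jets \<open>G(x, y)\<close> of \<open>K\<^sup>-\<^sup>1 \<circ> F\<tau> \<circ> K\<close> form a cocycle, and the prescribed section is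
  their velocity at the units, read in the coordinates induced by \<open>\<kappa>\<close>. Homogeneity says that \<open>G\<close>
  lies in \<open>\<Omega>\<close>, the right hand side that its velocity lies in the algebroid of \<open>\<Omega>\<close>.

  If the velocity is in the algebroid, then the left invariant fields it generates are tangent to
  \<open>\<Omega>\<close>, so that their integral curves \<open>t \<mapsto> G(x\<^sub>t, z)\<close> stay in a fixed embedded piece of \<open>\<Omega>\<close> near
  the diagonal (Gronwall). Conversely, \<open>\<Omega>\<close> is only immersed, so it has to be shown that
  \<open>t \<mapsto> G(x\<^sub>t, z)\<close> is continuous for its manifold topology. By Baire's theorem this holds for sources
  in a dense set, where the left invariant fields are therefore tangent to \<open>\<Omega>\<close>; the source map is
  open on \<open>\<Omega>\<close>, so they are tangent everywhere, and the first argument applies again.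
\<close>

text \<open>The shape of the prescribed section comes from using the base map of the deformation as
  chart. In the induced coordinates the transition from a to b covers the translation by b - a and
  has matrix part P(u, u + b - a) at u. Its jet therefore has the unit matrix as y^j_{,i} and the
  derivative of P along the diagonal direction (e_k, e_k) as y^j_{i,k}. Moving the source alone
  differentiates once more in x^l, which gives the zero and the sum of the two second derivatives.
  For a fixed chart vector w the left invariant field has source curves that are straight lines in
  the chart, so a source x near z is reached at time 1 with w = \<kappa>(x) - \<kappa>(z). That the
  curve stays in the embedded piece is shown by estimating its distance from the straightened piece,
  so no differential equation has to be solved inside it. The obstacle in the other direction is
  that sheets of \<Omega> may accumulate on each other. A curve lying in \<Omega> as a set could
  pass from sheet to sheet, and its ambient velocity is then not evidently tangent to
  \<Omega>.\<close>

section \<open>Calculus of smooth maps\<close>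

text \<open>The last hypothesis, congruence at level \<open>n\<close>, breaks a circularity: the
  rule is applied inside the induction that proves congruence, where only the induction hypothesis
  is at hand.\<close>

lemma times_differentiable_on_SucI:
  assumes "open S" "\<And>x. x \<in> S \<Longrightarrow> (f has_derivative f' x) (at x)"
    and "\<And>v. times_differentiable_on n S (\<lambda>x. f' x v)"
    and cong: "\<And>g h. (\<And>x. x \<in> S \<Longrightarrow> g x = h x) \<Longrightarrow>
      times_differentiable_on n S g \<Longrightarrow> times_differentiable_on n S (h :: _ \<Rightarrow> 'b)"
  shows "times_differentiable_on (Suc n) S (f :: 'a::real_normed_vector \<Rightarrow> 'b::real_normed_vector)"
proof -
  have "frechet_derivative f (at x) = f' x" if "x \<in> S" for x
    using assms(2)[OF that] by (metis frechet_derivative_at)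
  then have "times_differentiable_on n S (\<lambda>x. frechet_derivative f (at x) v)" for v
    using cong[OF _ assms(3)[of v]] by simp
  then show ?thesis
    using assms(2) by (auto simp: differentiable_def)
qed

lemma times_differentiable_on_cong:
  assumes "open S" "\<And>x. x \<in> S \<Longrightarrow> f x = g x" "times_differentiable_on n S f"
  shows "times_differentiable_on n S g"
  using assms(2,3)
proof (induction n arbitrary: f g)
  case 0
  then show ?case using continuous_on_cong by (metis times_differentiable_on.simps(1))
next
  case (Suc n)
  have "(g has_derivative frechet_derivative f (at x)) (at x)" if "x \<in> S" for x
    using Suc.prems that assms(1)
    by (auto intro: has_derivative_transform_within_open[of f _ x UNIV S] simp: frechet_derivative_works)
  then show ?case
    using Suc by (intro times_differentiable_on_SucI[OF assms(1)]) auto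
qed

lemma times_differentiable_on_Suc_intro:
  assumes "open S" "\<And>x. x \<in> S \<Longrightarrow> (f has_derivative f' x) (at x)"
    and "\<And>v. times_differentiable_on n S (\<lambda>x. f' x v)"
  shows "times_differentiable_on (Suc n) S f"
  using times_differentiable_on_SucI[OF assms] times_differentiable_on_cong[OF assms(1)] by blast

lemma times_differentiable_on_has_derivative:
  assumes "times_differentiable_on (Suc n) S f" "x \<in> S"
  shows "(f has_derivative frechet_derivative f (at x)) (at x)"
  using assms by (auto simp: frechet_derivative_works)

lemma times_differentiable_on_subset:
  "times_differentiable_on n S f \<Longrightarrow> S' \<subseteq> S \<Longrightarrow> times_differentiable_on n S' f"
  by (induction n arbitrary: f) (auto intro: continuous_on_subset)

lemma times_differentiable_on_Suc_imp:
  "times_differentiable_on (Suc n) S f \<Longrightarrow> times_differentiable_on n S f"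
proof (induction n arbitrary: f)
  case 0
  then have "\<forall>x\<in>S. isCont f x"
    using differentiable_imp_continuous_within by auto
  then show ?case
    by (simp add: continuous_at_imp_continuous_on)
next
  case (Suc n)
  from Suc.prems show ?case
    unfolding times_differentiable_on.simps(2)[of _ _ f]
    by (intro conjI allI Suc.IH) auto
qed

lemma times_differentiable_on_const: "times_differentiable_on n S (\<lambda>x. c)"
  by (induction n arbitrary: c) auto

lemma times_differentiable_on_linear:
  assumes "bounded_linear f" shows "times_differentiable_on n S f"
proof (cases n)
  case (Suc m)
  have "frechet_derivative f (at x) = f" for x
    using bounded_linear_imp_has_derivative[OF assms] by (metis frechet_derivative_at)
  then show ?thesis
    using bounded_linear_imp_differentiable[OF assms] Suc by (auto simp: times_differentiable_on_const)
qed (simp add: linear_continuous_on assms)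

lemma times_differentiable_on_add:
  assumes "open S" "times_differentiable_on n S f" "times_differentiable_on n S g"
  shows "times_differentiable_on n S (\<lambda>x. f x + g x)"
  using assms(2,3)
proof (induction n arbitrary: f g)
  case (Suc n)
  show ?case
  proof (rule times_differentiable_on_Suc_intro[OF assms(1)])
    show "((\<lambda>x. f x + g x) has_derivative
      (\<lambda>v. frechet_derivative f (at x) v + frechet_derivative g (at x) v)) (at x)" if "x \<in> S" for x
      using Suc.prems that by (intro has_derivative_add times_differentiable_on_has_derivative)
  qed (use Suc in auto)
qed (auto intro: continuous_on_add)

lemma times_differentiable_on_bilinear:
  fixes f :: "'a::real_normed_vector \<Rightarrow> 'b::real_normed_vector"
    and g :: "'a \<Rightarrow> 'c::real_normed_vector" and m :: "'b \<Rightarrow> 'c \<Rightarrow> 'd::real_normed_vector"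
  assumes "open S" "bounded_bilinear m" "times_differentiable_on n S f" "times_differentiable_on n S g"
  shows "times_differentiable_on n S (\<lambda>x. m (f x) (g x))"
  using assms(3,4)
proof (induction n arbitrary: f g)
  case 0
  then show ?case using bounded_bilinear.continuous_on[OF assms(2)] by auto
next
  case (Suc n)
  show ?case
  proof (rule times_differentiable_on_Suc_intro[OF assms(1)])
    show "((\<lambda>x. m (f x) (g x)) has_derivative
      (\<lambda>v. m (f x) (frechet_derivative g (at x) v) + m (frechet_derivative f (at x) v) (g x))) (at x)"
      if "x \<in> S" for x
      using Suc.prems that
      by (intro bounded_bilinear.FDERIV[OF assms(2)] times_differentiable_on_has_derivative)
  next
    fix v
    have "times_differentiable_on n S f" "times_differentiable_on n S g"
      using Suc.prems times_differentiable_on_Suc_imp by blast+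
    then show "times_differentiable_on n S (\<lambda>x. m (f x) (frechet_derivative g (at x) v) +
        m (frechet_derivative f (at x) v) (g x))"
      using Suc.prems by (intro times_differentiable_on_add[OF assms(1)] Suc.IH) auto
  qed
qed

lemma times_differentiable_on_sum:
  assumes "open S" "\<And>i. i \<in> I \<Longrightarrow> times_differentiable_on n S (f i)"
  shows "times_differentiable_on n S (\<lambda>x. \<Sum>i\<in>I. f i x)"
  using assms(2)
proof (induction I rule: infinite_finite_induct)
  case (insert i F)
  then have "times_differentiable_on n S (\<lambda>x. f i x + (\<Sum>i\<in>F. f i x))"
    by (intro times_differentiable_on_add assms(1)) auto
  then show ?case using insert by simp
qed (simp_all add: times_differentiable_on_const)

text \<open>The chain rule produces the derivative of \<open>g\<close> in the direction
  \<open>f' x v\<close>, which varies with \<open>x\<close>, whereas the recursion knows only fixed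
  directions. Expanding the direction in \<open>Basis\<close> leaves products of scalar functions
  with fixed directional derivatives of \<open>g\<close> composed with \<open>f\<close>, to which
  the induction hypothesis applies. This is why the middle space is Euclidean.\<close>

lemma times_differentiable_on_compose:
  fixes f :: "'a::real_normed_vector \<Rightarrow> 'b::euclidean_space" and g :: "'b \<Rightarrow> 'c::real_normed_vector"
  assumes "open S" "open T" "times_differentiable_on n S f" "times_differentiable_on n T g"
    and "\<And>x. x \<in> S \<Longrightarrow> f x \<in> T"
  shows "times_differentiable_on n S (\<lambda>x. g (f x))"
  using assms(3,4)
proof (induction n arbitrary: g)
  case 0
  then show ?case
    using assms(5) by (auto intro!: continuous_on_compose2[of T g S f])
next
  case (Suc n)
  let ?f' = "\<lambda>x. frechet_derivative f (at x)" and ?g' = "\<lambda>x. frechet_derivative g (at x)"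
  have f': "(f has_derivative ?f' x) (at x)" if "x \<in> S" for x
    using Suc.prems(1) that by (rule times_differentiable_on_has_derivative)
  have g': "(g has_derivative ?g' x) (at x)" if "x \<in> T" for x
    using Suc.prems(2) that by (rule times_differentiable_on_has_derivative)
  show ?case
  proof (rule times_differentiable_on_Suc_intro[OF assms(1)])
    show "((\<lambda>x. g (f x)) has_derivative (\<lambda>v. \<Sum>b\<in>Basis. (?f' x v \<bullet> b) *\<^sub>R ?g' (f x) b)) (at x)"
      if x: "x \<in> S" for x
    proof -
      interpret g': bounded_linear "?g' (f x)"
        using g'[OF assms(5)[OF x]] by (rule has_derivative_bounded_linear)
      have "?g' (f x) w = (\<Sum>b\<in>Basis. (w \<bullet> b) *\<^sub>R ?g' (f x) b)" for w
        by (subst euclidean_representation[of w, symmetric]) (simp only: g'.sum g'.scaleR)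
      then have eq: "(\<lambda>v. ?g' (f x) (?f' x v)) =
          (\<lambda>v. \<Sum>b\<in>Basis. (?f' x v \<bullet> b) *\<^sub>R ?g' (f x) b)" by (intro ext) blast
      show ?thesis
        using has_derivative_compose[OF f'[OF x] g'[OF assms(5)[OF x]]] unfolding eq .
    qed
  next
    fix v
    have "times_differentiable_on n S (\<lambda>x. ?f' x v \<bullet> b)" for b
      using Suc.prems(1)
      by (intro times_differentiable_on_bilinear[OF assms(1) bounded_bilinear_inner])
         (auto simp: times_differentiable_on_const)
    moreover have "times_differentiable_on n S (\<lambda>x. ?g' (f x) b)" for b
      using Suc.prems times_differentiable_on_Suc_imp by (intro Suc.IH) auto
    ultimately show "times_differentiable_on n S (\<lambda>x. \<Sum>b\<in>Basis. (?f' x v \<bullet> b) *\<^sub>R ?g' (f x) b)"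
      by (intro times_differentiable_on_sum[OF assms(1)]
          times_differentiable_on_bilinear[OF assms(1) bounded_bilinear_scaleR]) auto
  qed
qed

lemma smooth_on_cong: "open S \<Longrightarrow> (\<And>x. x \<in> S \<Longrightarrow> f x = g x) \<Longrightarrow> smooth_on S f \<Longrightarrow> smooth_on S g"
  unfolding smooth_on_def using times_differentiable_on_cong by blast

lemma smooth_on_subset: "smooth_on S f \<Longrightarrow> S' \<subseteq> S \<Longrightarrow> smooth_on S' f"
  unfolding smooth_on_def using times_differentiable_on_subset by blast

lemma smooth_on_imp_has_derivative:
  "smooth_on S f \<Longrightarrow> x \<in> S \<Longrightarrow> (f has_derivative frechet_derivative f (at x)) (at x)"
  unfolding smooth_on_def using times_differentiable_on_has_derivative by blast

lemma smooth_on_imp_continuous_on: "smooth_on S f \<Longrightarrow> continuous_on S f"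
  unfolding smooth_on_def using times_differentiable_on.simps(1) by blast

lemma smooth_on_frechet_derivative: "smooth_on S f \<Longrightarrow> smooth_on S (\<lambda>x. frechet_derivative f (at x) v)"
  unfolding smooth_on_def using times_differentiable_on.simps(2) by blast

lemma smooth_on_const: "smooth_on S (\<lambda>x. c)"
  by (simp add: smooth_on_def times_differentiable_on_const)

lemma smooth_on_linear: "bounded_linear f \<Longrightarrow> smooth_on S f"
  by (simp add: smooth_on_def times_differentiable_on_linear)

lemma smooth_on_id: "smooth_on S (\<lambda>x. x)"
  by (rule smooth_on_linear[OF bounded_linear_ident])

lemma smooth_on_compose:
  fixes f :: "'a::real_normed_vector \<Rightarrow> 'b::euclidean_space"
  shows "\<lbrakk>open S; open T; smooth_on T g; smooth_on S f; \<And>x. x \<in> S \<Longrightarrow> f x \<in> T\<rbrakk> \<Longrightarrow>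
    smooth_on S (\<lambda>x. g (f x))"
  unfolding smooth_on_def using times_differentiable_on_compose by blast

lemma smooth_on_linear_compose:
  fixes f :: "'a::real_normed_vector \<Rightarrow> 'b::euclidean_space"
  shows "\<lbrakk>open S; bounded_linear g; smooth_on S f\<rbrakk> \<Longrightarrow> smooth_on S (\<lambda>x. g (f x))"
  by (rule smooth_on_compose[OF _ open_UNIV smooth_on_linear]) auto

lemma smooth_on_bilinear:
  "\<lbrakk>open S; bounded_bilinear m; smooth_on S f; smooth_on S g\<rbrakk> \<Longrightarrow> smooth_on S (\<lambda>x. m (f x) (g x))"
  unfolding smooth_on_def using times_differentiable_on_bilinear by blast

lemma smooth_on_add:
  "\<lbrakk>open S; smooth_on S f; smooth_on S g\<rbrakk> \<Longrightarrow> smooth_on S (\<lambda>x. f x + g x)"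
  unfolding smooth_on_def using times_differentiable_on_add by blast

lemma smooth_on_scaleR:
  "\<lbrakk>open S; smooth_on S f; smooth_on S g\<rbrakk> \<Longrightarrow> smooth_on S (\<lambda>x. f x *\<^sub>R g x)"
  by (rule smooth_on_bilinear[OF _ bounded_bilinear_scaleR])

lemma smooth_on_minus:
  assumes "open S" "smooth_on S f" shows "smooth_on S (\<lambda>x. - f x)"
  using smooth_on_scaleR[OF assms(1) smooth_on_const[of S "-1"] assms(2)] by simp

lemma smooth_on_diff:
  assumes "open S" "smooth_on S f" "smooth_on S g" shows "smooth_on S (\<lambda>x. f x - g x)"
  using smooth_on_add[OF assms(1,2) smooth_on_minus[OF assms(1,3)]] by simp

lemma smooth_on_sum:
  "\<lbrakk>open S; \<And>i. i \<in> I \<Longrightarrow> smooth_on S (f i)\<rbrakk> \<Longrightarrow> smooth_on S (\<lambda>x. \<Sum>i\<in>I. f i x)"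
  by (auto simp: smooth_on_def intro!: times_differentiable_on_sum)

lemma smooth_on_Pair:
  fixes f :: "'a::real_normed_vector \<Rightarrow> 'b::euclidean_space" and g :: "'a \<Rightarrow> 'c::euclidean_space"
  assumes "open S" "smooth_on S f" "smooth_on S g" shows "smooth_on S (\<lambda>x. (f x, g x))"
proof -
  have l: "bounded_linear (\<lambda>u::'b. (u, 0::'c))" "bounded_linear (\<lambda>v::'c. (0::'b, v))"
    by (intro bounded_linear_Pair bounded_linear_ident bounded_linear_zero)+
  have "smooth_on S (\<lambda>x. (f x, 0) + (0, g x))"
    by (rule smooth_on_add[OF assms(1) smooth_on_linear_compose[OF assms(1) l(1) assms(2)]
        smooth_on_linear_compose[OF assms(1) l(2) assms(3)]])
  then show ?thesis by simp
qed

lemma smooth_on_fst: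
  "open S \<Longrightarrow> smooth_on S f \<Longrightarrow> smooth_on S (\<lambda>x. fst (f x :: 'b::euclidean_space \<times> 'c::euclidean_space))"
  by (rule smooth_on_linear_compose[OF _ bounded_linear_fst])

lemma smooth_on_snd:
  "open S \<Longrightarrow> smooth_on S f \<Longrightarrow> smooth_on S (\<lambda>x. snd (f x :: 'b::euclidean_space \<times> 'c::euclidean_space))"
  by (rule smooth_on_linear_compose[OF _ bounded_linear_snd])

lemma smooth_on_vec_nth:
  "open S \<Longrightarrow> smooth_on S f \<Longrightarrow> smooth_on S (\<lambda>x. (f x :: 'b::euclidean_space^'n) $ i)"
  by (rule smooth_on_linear_compose[OF _ bounded_linear_vec_nth])

lemma bounded_linear_axis: "bounded_linear (\<lambda>v::'b::euclidean_space. axis i v :: 'b^'n)"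
  by (rule linear_conv_bounded_linear[THEN iffD1]) (rule linearI; simp add: axis_def vec_eq_iff)

lemma smooth_on_vec_lambda:
  assumes "open S" "\<And>i. smooth_on S (\<lambda>x. f x i :: 'b::euclidean_space)"
  shows "smooth_on S (\<lambda>x. (\<chi> i. f x i) :: 'b^'n)"
proof -
  have "(\<chi> i. f x i) = (\<Sum>i\<in>UNIV. axis i (f x i))" for x
    by (simp add: vec_eq_iff sum_component axis_def)
  then show ?thesis
    by (simp only:)
       (rule smooth_on_sum[OF assms(1) smooth_on_linear_compose[OF assms(1) bounded_linear_axis assms(2)]])
qed

lemma smooth_on_mult:
  fixes f g :: "'a::real_normed_vector \<Rightarrow> real"
  shows "\<lbrakk>open S; smooth_on S f; smooth_on S g\<rbrakk> \<Longrightarrow> smooth_on S (\<lambda>x. f x * g x)"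
  by (rule smooth_on_bilinear[OF _ bounded_bilinear_mult])

lemma bounded_bilinear_matrix_mult: "bounded_bilinear ((**) :: real^'m^'n \<Rightarrow> real^'p^'m \<Rightarrow> real^'p^'n)"
proof (rule bilinear_conv_bounded_bilinear[THEN iffD1])
  have "linear (\<lambda>B :: real^'p^'m. A ** B)" for A :: "real^'m^'n"
    by (rule linearI)
      (simp_all add: matrix_matrix_mult_def vec_eq_iff sum_distrib_left mult_ac distrib_right distrib_left sum.distrib)
  moreover have "linear (\<lambda>A :: real^'m^'n. A ** B)" for B :: "real^'p^'m"
    by (rule linearI)
      (simp_all add: matrix_matrix_mult_def vec_eq_iff sum_distrib_left mult_ac distrib_right distrib_left sum.distrib)
  ultimately show "bilinear ((**) :: real^'m^'n \<Rightarrow> real^'p^'m \<Rightarrow> real^'p^'n)"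
    by (simp add: bilinear_def)
qed

lemma smooth_on_matrix_mult:
  fixes A :: "'a::real_normed_vector \<Rightarrow> real^'m^'n" and B :: "'a \<Rightarrow> real^'p^'m"
  shows "\<lbrakk>open S; smooth_on S A; smooth_on S B\<rbrakk> \<Longrightarrow> smooth_on S (\<lambda>x. A x ** B x)"
  by (rule smooth_on_bilinear[OF _ bounded_bilinear_matrix_mult])

lemma bounded_bilinear_matrix_vector_mult: "bounded_bilinear ((*v) :: real^'m^'n \<Rightarrow> real^'m \<Rightarrow> real^'n)"
proof (rule bilinear_conv_bounded_bilinear[THEN iffD1])
  have "linear (\<lambda>A :: real^'m^'n. A *v v)" for v :: "real^'m"
    by (rule linearI) (simp_all add: matrix_vector_mult_def vec_eq_iff
        sum_distrib_left mult_ac distrib_right distrib_left sum.distrib)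
  then show "bilinear ((*v) :: real^'m^'n \<Rightarrow> real^'m \<Rightarrow> real^'n)"
    by (simp add: bilinear_def)
qed

lemma smooth_on_matrix_vector_mult:
  fixes A :: "'a::real_normed_vector \<Rightarrow> real^'m^'n"
  shows "\<lbrakk>open S; smooth_on S A; smooth_on S v\<rbrakk> \<Longrightarrow> smooth_on S (\<lambda>x. A x *v v x)"
  by (rule smooth_on_bilinear[OF _ bounded_bilinear_matrix_vector_mult])

lemma frechet_derivative_euclidean_sum:
  fixes f :: "'a::euclidean_space \<Rightarrow> 'b::real_normed_vector"
  assumes "f differentiable at x"
  shows "frechet_derivative f (at x) v = (\<Sum>b\<in>Basis. (v \<bullet> b) *\<^sub>R frechet_derivative f (at x) b)"
proof -
  interpret f: linear "frechet_derivative f (at x)" by (rule linear_frechet_derivative[OF assms])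
  show ?thesis
    by (subst euclidean_representation[of v, symmetric]) (simp only: f.sum f.scaleR)
qed

text \<open>The moving direction is again expanded in \<open>Basis\<close>; this gives smoothness
  jointly in the base point and the direction.\<close>

lemma smooth_on_frechet_derivative_apply:
  fixes f :: "'a::euclidean_space \<Rightarrow> 'b::euclidean_space" and g v :: "'c::real_normed_vector \<Rightarrow> 'a"
  assumes "open S" "open T" "smooth_on T f" "smooth_on S g" "smooth_on S v" "\<And>x. x \<in> S \<Longrightarrow> g x \<in> T"
  shows "smooth_on S (\<lambda>x. frechet_derivative f (at (g x)) (v x))"
proof (rule smooth_on_cong[OF assms(1)])
  show "smooth_on S (\<lambda>x. \<Sum>b\<in>Basis. (v x \<bullet> b) *\<^sub>R frechet_derivative f (at (g x)) b)"
    using assms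
    by (intro smooth_on_sum smooth_on_scaleR smooth_on_bilinear[OF _ bounded_bilinear_inner] smooth_on_const
        smooth_on_compose[OF assms(1,2) smooth_on_frechet_derivative]) auto
  show "(\<Sum>b\<in>Basis. (v x \<bullet> b) *\<^sub>R frechet_derivative f (at (g x)) b) = frechet_derivative f (at (g x)) (v x)"
    if "x \<in> S" for x
    using smooth_on_imp_has_derivative[OF assms(3) assms(6)[OF that]]
    by (intro frechet_derivative_euclidean_sum[symmetric]) (auto simp: differentiable_def)
qed

section \<open>Smoothness of matrix inversion\<close>

lemma matrix_inv_mult:
  fixes A :: "real^'n::finite^'n" assumes "invertible A"
  shows "A ** matrix_inv A = mat 1" "matrix_inv A ** A = mat 1"
  using assms unfolding invertible_def matrix_inv_def by (metis (mono_tags, lifting) someI_ex)+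

lemma invertible_matrix_inv: "invertible A \<Longrightarrow> invertible (matrix_inv (A :: real^'n::finite^'n))"
  using matrix_inv_mult invertible_def by blast

lemma open_invertible: "open {A :: real^'n::finite^'n. invertible A}"
proof -
  have "continuous_on UNIV (det :: real^'n^'n \<Rightarrow> real)"
    unfolding det_def by (intro continuous_intros)
  then have "open (det -` (- {0}) :: (real^'n^'n) set)"
    by (intro open_vimage) auto
  then show ?thesis by (simp add: vimage_def invertible_det_nz)
qed

text \<open>By Cramer's rule the entries of the inverse are quotients of determinants, hence of
  polynomials in the entries.\<close>

lemma continuous_on_matrix_inv: "continuous_on {A :: real^'n::finite^'n. invertible A} matrix_inv"
proof -
  define M where "M A = (\<chi> k i. det (\<chi> p q. if q = k then axis i 1 $ p else A $ p $ q) / det A)"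
    for A :: "real^'n^'n"
  have eq: "matrix_inv A = M A" if A: "invertible A" for A :: "real^'n^'n"
  proof -
    have "A ** M A = mat 1"
    proof -
      have "A *v (\<chi> k. M A $ k $ i) = axis i 1" for i
        using cramer[of A "\<chi> k. M A $ k $ i" "axis i 1"] A invertible_det_nz
        by (auto simp: M_def)
      then show ?thesis
        by (auto simp: vec_eq_iff matrix_vector_mult_def matrix_matrix_mult_def mat_def axis_def)
    qed
    then show ?thesis
      by (metis A matrix_inv_mult(2) matrix_mul_assoc matrix_mul_lid matrix_mul_rid)
  qed
  have d: "continuous_on S (\<lambda>x. det (f x))" if "\<And>p q. continuous_on S (\<lambda>x. f x $ p $ q)"
    for S :: "(real^'n^'n) set" and f :: "_ \<Rightarrow> real^'n^'n"
    unfolding det_def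
    by (intro continuous_on_sum continuous_on_mult continuous_on_const continuous_on_prod that)
  have "continuous_on {A :: real^'n::finite^'n. invertible A} M"
    unfolding M_def
    apply (intro continuous_on_vec_lambda continuous_on_divide d)
    subgoal for i j p q by (cases "q = i") (auto intro!: continuous_intros)
    by (auto simp: invertible_det_nz intro!: continuous_intros)
  then show ?thesis
    by (rule continuous_on_cong[THEN iffD1, rotated 2]) (use eq in auto)
qed

text \<open>The remainder of the linear approximation equals (A^{-1} - X^{-1})(X - A)A^{-1} exactly.
  Its quotient by the norm of X - A tends to 0 because inversion is continuous.\<close>

lemma has_derivative_matrix_inv:
  fixes A :: "real^'n::finite^'n" assumes "invertible A"
  shows "(matrix_inv has_derivative (\<lambda>H. - (matrix_inv A ** H ** matrix_inv A))) (at A)"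
proof -
  have inv: "invertible X" if "X \<in> {A. invertible A}" for X :: "real^'n^'n" using that by simp
  have bl: "bounded_linear (\<lambda>H. - (matrix_inv A ** H ** matrix_inv A))"
    by (intro bounded_linear_minus bounded_linear_compose[OF bounded_linear_matrix_mult_right]
        bounded_linear_matrix_mult_left)
  let ?F = "at A"
  have ev: "eventually (\<lambda>X. X \<in> {A :: real^'n^'n. invertible A}) ?F"
    using open_invertible assms by (intro eventually_at_in_open') auto
  have cont: "((\<lambda>X. matrix_inv X) \<longlongrightarrow> matrix_inv A) ?F"
    using continuous_on_matrix_inv assms open_invertible
    by (metis continuous_on_eq_continuous_at isCont_def mem_Collect_eq)
  have id: "matrix_inv X - matrix_inv A - (- (matrix_inv A ** (X - A) ** matrix_inv A)) =
      (matrix_inv A - matrix_inv X) ** (X - A) ** matrix_inv A" if "invertible X" for X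
  proof -
    interpret m: bounded_bilinear "(**) :: real^'n^'n \<Rightarrow> real^'n^'n \<Rightarrow> real^'n^'n"
      by (rule bounded_bilinear_matrix_mult)
    have "matrix_inv X ** X = mat 1" "(matrix_inv X ** A) ** matrix_inv A = matrix_inv X"
      using matrix_inv_mult(2)[OF that] matrix_inv_mult(1)[OF assms] by (simp_all flip: matrix_mul_assoc)
    then show ?thesis
      unfolding m.diff_left m.diff_right by (simp add: matrix_inv_mult[OF assms])
  qed
  obtain K where K: "norm (P ** R) \<le> norm P * norm R * K" "K > 0" for P R :: "real^'n^'n"
    using bounded_bilinear.pos_bounded[OF bounded_bilinear_matrix_mult] by metis
  have bnd: "norm ((matrix_inv A - matrix_inv X) ** (X - A) ** matrix_inv A) \<le>
      norm (X - A) * (norm (matrix_inv A - matrix_inv X) * norm (matrix_inv A) * K * K)" for X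
    using order_trans[OF K(1)[of "(matrix_inv A - matrix_inv X) ** (X - A)" "matrix_inv A"]
       mult_right_mono[OF mult_right_mono[OF K(1)[of "matrix_inv A - matrix_inv X" "X - A"] norm_ge_zero]]]
       K(2) by (simp add: mult_ac)
  show ?thesis
    unfolding has_derivative_iff_norm
  proof (intro conjI bl)
    let ?g = "\<lambda>X. norm (matrix_inv A - matrix_inv X) * norm (matrix_inv A) * K * K"
    have "(?g \<longlongrightarrow> norm (matrix_inv A - matrix_inv A) * norm (matrix_inv A) * K * K) ?F"
      by (intro tendsto_intros cont)
    then have g: "(?g \<longlongrightarrow> 0) ?F" by simp
    show "((\<lambda>X. norm (matrix_inv X - matrix_inv A - (- (matrix_inv A ** (X - A) ** matrix_inv A)))
        / norm (X - A)) \<longlongrightarrow> 0) ?F"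
    proof (rule tendsto_sandwich[OF _ _ tendsto_const g])
      show "eventually (\<lambda>X. norm (matrix_inv X - matrix_inv A - (- (matrix_inv A ** (X - A) ** matrix_inv A)))
        / norm (X - A) \<le> ?g X) ?F"
        using ev eventually_neq_at_within[of A A UNIV]
      proof eventually_elim
        case (elim X)
        then show ?case
          using bnd[of X] id[of X] by (simp add: divide_le_eq mult.commute)
      qed
    qed auto
  qed
qed

text \<open>Bootstrapping: the derivative is a polynomial expression in the inverse itself, so each
  order of differentiability yields the next.\<close>

lemma smooth_on_matrix_inv: "smooth_on {A :: real^'n::finite^'n. invertible A} matrix_inv"
  unfolding smooth_on_def
proof
  fix n show "times_differentiable_on n {A :: real^'n^'n. invertible A} matrix_inv"
  proof (induction n)
    case (Suc n)
    show ?case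
    proof (rule times_differentiable_on_Suc_intro[OF open_invertible has_derivative_matrix_inv])
      fix H :: "real^'n^'n"
      have "times_differentiable_on n {A :: real^'n^'n. invertible A}
          (\<lambda>A. (-1) *\<^sub>R (matrix_inv A ** H ** matrix_inv A))"
        by (intro times_differentiable_on_bilinear[OF open_invertible bounded_bilinear_matrix_mult] Suc
            times_differentiable_on_const
            times_differentiable_on_bilinear[OF open_invertible bounded_bilinear_scaleR])
      then show "times_differentiable_on n {A :: real^'n^'n. invertible A}
          (\<lambda>A. - (matrix_inv A ** H ** matrix_inv A))" by simp
    qed simp
  qed (simp add: continuous_on_matrix_inv)
qed

lemma smooth_on_matrix_inv_compose:
  "\<lbrakk>open S; smooth_on S A; \<And>x. x \<in> S \<Longrightarrow> invertible (A x)\<rbrakk> \<Longrightarrow>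
    smooth_on S (\<lambda>x. matrix_inv (A x :: real^'n::finite^'n))"
  by (rule smooth_on_compose[OF _ open_invertible smooth_on_matrix_inv]) auto

section \<open>Diffeomorphisms\<close>

lemma frechet_derivative_eq: "(f has_derivative f') (at x) \<Longrightarrow> frechet_derivative f (at x) = f'"
  by (metis frechet_derivative_at)

lemma diffeomorphism_inverse_has_derivative:
  fixes f :: "'a::euclidean_space \<Rightarrow> 'a"
  assumes "diffeomorphism U V f" "x \<in> U"
  defines "f' \<equiv> frechet_derivative f (at x)" and "g' \<equiv> frechet_derivative (inv_into U f) (at (f x))"
  shows "(f has_derivative f') (at x)" "(inv_into U f has_derivative g') (at (f x))"
    "g' (f' v) = v" "f' (g' v) = v"
proof -
  have U: "open U" "open V" "bij_betw f U V" "smooth_on U f" "smooth_on V (inv_into U f)"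
    using assms(1) by (auto simp: diffeomorphism_def)
  have fx: "f x \<in> V" using U(3) assms(2) by (auto simp: bij_betw_def)
  show f: "(f has_derivative f') (at x)"
    using smooth_on_imp_has_derivative[OF U(4) assms(2)] by (simp add: f'_def)
  show g: "(inv_into U f has_derivative g') (at (f x))"
    using smooth_on_imp_has_derivative[OF U(5) fx] by (simp add: g'_def)
  have "((\<lambda>x. inv_into U f (f x)) has_derivative (\<lambda>v. g' (f' v))) (at x)"
    by (rule has_derivative_compose[OF f g])
  moreover have "((\<lambda>x. inv_into U f (f x)) has_derivative (\<lambda>v. v)) (at x)"
    by (rule has_derivative_transform_within_open[OF has_derivative_ident U(1) assms(2)])
       (use U(3) in \<open>simp add: bij_betw_def\<close>)
  ultimately have gf: "(\<lambda>v. g' (f' v)) = (\<lambda>v. v)" by (rule has_derivative_unique)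
  then show gf': "g' (f' v) = v" for v by metis
  have lin: "linear f'" "linear g'"
    using f g by (auto intro: has_derivative_linear)
  have "inj f'" using gf' by (metis injI)
  then have "surj f'" using lin(1) linear_injective_imp_surjective by blast
  then show "f' (g' v) = v" by (metis gf' surj_def)
qed

lemma diffeomorphism_inv_into:
  assumes "diffeomorphism U V f" shows "diffeomorphism V U (inv_into U f)"
proof -
  have U: "open U" "open V" "bij_betw f U V" "smooth_on U f" "smooth_on V (inv_into U f)"
    using assms by (auto simp: diffeomorphism_def)
  moreover have "smooth_on U (inv_into V (inv_into U f))"
    by (rule smooth_on_cong[OF U(1) _ U(4)]) (simp add: inv_into_inv_into_eq[OF U(3)])
  ultimately show ?thesis
    by (simp add: diffeomorphism_def bij_betw_inv_into)
qed

lemma diffeomorphism_restrict: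
  assumes "diffeomorphism U V f" "open U'" "U' \<subseteq> U"
  shows "diffeomorphism U' (f ` U') f"
proof -
  have U: "open U" "open V" "bij_betw f U V" "smooth_on U f" "smooth_on V (inv_into U f)"
    using assms(1) by (auto simp: diffeomorphism_def)
  have inj: "inj_on f U" using U(3) by (simp add: bij_betw_def)
  have im: "f ` U' = V \<inter> inv_into U f -` U'"
  proof (intro equalityI subsetI)
    fix y assume "y \<in> V \<inter> inv_into U f -` U'"
    then have "f (inv_into U f y) = y" "inv_into U f y \<in> U'"
      using U(3) by (auto simp: bij_betw_def f_inv_into_f)
    then show "y \<in> f ` U'" by (metis imageI)
  next
    fix y assume "y \<in> f ` U'"
    then show "y \<in> V \<inter> inv_into U f -` U'"
      using U(3) inj assms(3) by (auto simp: bij_betw_def inv_into_f_f subset_iff)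
  qed
  have opn: "open (f ` U')"
    unfolding im by (rule continuous_open_preimage[OF smooth_on_imp_continuous_on[OF U(5)] U(2) assms(2)])
  have "smooth_on (f ` U') (inv_into U' f)"
  proof (rule smooth_on_cong[OF opn])
    show "smooth_on (f ` U') (inv_into U f)"
      by (rule smooth_on_subset[OF U(5)]) (simp add: im)
    show "inv_into U f y = inv_into U' f y" if "y \<in> f ` U'" for y
      using that inj inj_on_subset[OF inj assms(3)] assms(3) by (auto simp: inv_into_f_f subset_iff)
  qed
  then show ?thesis
    using assms(2) opn inj_on_subset[OF inj assms(3)] smooth_on_subset[OF U(4) assms(3)]
    by (simp add: diffeomorphism_def bij_betw_def)
qed

lemma smooth_on_jacobian:
  fixes f :: "real^'n \<Rightarrow> real^'m"
  assumes "open S" "smooth_on S f"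
  shows "smooth_on S (\<lambda>x. jacobian f (at x))"
  unfolding jacobian_def matrix_def
  by (intro smooth_on_vec_lambda smooth_on_vec_nth smooth_on_frechet_derivative assms)

lemma jacobian_apply:
  fixes f :: "real^'n \<Rightarrow> real^'m"
  assumes "f differentiable at x"
  shows "jacobian f (at x) *v v = frechet_derivative f (at x) v"
  unfolding jacobian_def using assms by (simp add: matrix_works linear_frechet_derivative)

lemma invertible_jacobianI:
  fixes f :: "real^'n \<Rightarrow> real^'n"
  assumes "f differentiable at x" "inj (frechet_derivative f (at x))"
  shows "invertible (jacobian f (at x))"
  using assms unfolding invertible_left_inverse matrix_left_invertible_injective
  by (simp add: jacobian_apply inj_def)

lemma invertible_jacobian:
  fixes f :: "real^'n \<Rightarrow> real^'n"
  assumes "diffeomorphism U V f" "x \<in> U"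
  shows "invertible (jacobian f (at x))"
proof -
  note d = diffeomorphism_inverse_has_derivative[OF assms]
  have "inj (frechet_derivative f (at x))" using d(3) by (metis injI)
  then show ?thesis
    using d(1) by (intro invertible_jacobianI) (auto simp: differentiable_def)
qed

text \<open>Invariance of domain makes the image open and the inverse continuous; smoothness is then
  bootstrapped from the formula for the derivative of the inverse.\<close>

lemma diffeomorphism_on_image:
  fixes f :: "real^'n \<Rightarrow> real^'n"
  assumes "open S" "smooth_on S f" "inj_on f S" "\<And>x. x \<in> S \<Longrightarrow> inj (frechet_derivative f (at x))"
  shows "diffeomorphism S (f ` S) f"
proof -
  let ?g = "inv_into S f"
  have opn: "open (f ` S)"
    using invariance_of_domain[OF smooth_on_imp_continuous_on[OF assms(2)] assms(1,3)] .
  have fd: "(f has_derivative frechet_derivative f (at x)) (at x)" if "x \<in> S" for x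
    using smooth_on_imp_has_derivative[OF assms(2) that] .
  have inv: "invertible (jacobian f (at x))" if "x \<in> S" for x
    using assms(4)[OF that] fd[OF that] by (intro invertible_jacobianI) (auto simp: differentiable_def)
  let ?J = "\<lambda>x. matrix_inv (jacobian f (at x))"
  have gd: "(?g has_derivative (\<lambda>v. ?J (?g y) *v v)) (at y)" if "y \<in> f ` S" for y
  proof -
    have "(?g has_derivative (\<lambda>v. ?J x *v v)) (at (f x))" if x: "x \<in> S" for x
    proof (rule has_derivative_inverse_on[OF assms(1) fd _ _ x])
      have "frechet_derivative f (at x) = (*v) (jacobian f (at x))"
        using jacobian_apply[OF differentiableI[OF fd[OF x]]] by (simp add: fun_eq_iff)
      then show "frechet_derivative f (at x) \<circ> (\<lambda>v. ?J x *v v) = id"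
        by (simp add: fun_eq_iff matrix_vector_mul_assoc matrix_inv_mult(1)[OF inv[OF x]])
    qed (simp_all add: assms(3))
    then show ?thesis using that assms(3) by auto
  qed
  have gS: "?g y \<in> S" if "y \<in> f ` S" for y using that by (simp add: inv_into_into)
  have "times_differentiable_on n (f ` S) ?g" for n
  proof (induction n)
    case 0
    show ?case
      using has_derivative_continuous[OF gd] by (simp add: continuous_at_imp_continuous_on)
  next
    case (Suc n)
    show ?case
    proof (rule times_differentiable_on_Suc_intro[OF opn gd])
      fix v
      have "smooth_on S (\<lambda>x. ?J x *v v)"
        using assms(1,2) inv
        by (intro smooth_on_matrix_vector_mult smooth_on_const smooth_on_matrix_inv_compose smooth_on_jacobian)
      then show "times_differentiable_on n (f ` S) (\<lambda>y. ?J (?g y) *v v)"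
        using times_differentiable_on_compose[OF opn assms(1) Suc _ gS, of "\<lambda>x. ?J x *v v"]
        unfolding smooth_on_def by blast
    qed
  qed
  then show ?thesis
    using assms opn by (simp add: diffeomorphism_def smooth_on_def bij_betw_def)
qed

section \<open>The algebra of frame jets\<close>

text \<open>The last component of a frame jet read as the linear map sending a direction to the
  derivative of the matrix part. In this form the index sums of \<open>fj_mult\<close> and
  \<open>fj_inv\<close> become matrix identities.\<close>

definition tensor_at :: "real^'n^'n^'n \<Rightarrow> real^'n \<Rightarrow> real^'n^'n" where
  "tensor_at T v = (\<chi> j i. \<Sum>k\<in>UNIV. T $ j $ i $ k * v $ k)"

definition tensor_of :: "(real^'n \<Rightarrow> real^'n^'n) \<Rightarrow> real^'n^'n^'n" where
  "tensor_of L = (\<chi> j i k. L (axis k 1) $ j $ i)"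

lemma linear_tensor_at: "linear (tensor_at T)"
  by (rule linearI) (simp_all add: tensor_at_def vec_eq_iff distrib_left sum.distrib sum_distrib_left mult_ac)

lemma tensor_of_at: "tensor_of (tensor_at T) = T"
  by (simp add: tensor_of_def tensor_at_def vec_eq_iff axis_def if_distrib[of "\<lambda>t. _ * t"] cong: if_cong)

lemma tensor_at_of: 
  assumes "linear L" shows "tensor_at (tensor_of L) v = L v"
proof -
  interpret L: linear L by (rule assms)
  have "L v = L (\<Sum>k\<in>UNIV. v $ k *\<^sub>R axis k 1)"
    using basis_expansion[of v] by (simp add: scalar_mult_eq_scaleR)
  also have "\<dots> = (\<Sum>k\<in>UNIV. v $ k *\<^sub>R L (axis k 1))"
    by (simp only: L.sum L.scaleR)
  finally show ?thesis
    by (simp add: tensor_at_def tensor_of_def vec_eq_iff sum_component mult.commute)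
qed

lemma tensor_at_0: "tensor_at 0 v = 0"
  by (simp add: tensor_at_def vec_eq_iff)

lemma tensor_of_0: "tensor_of (\<lambda>v. 0) = 0"
  by (simp add: tensor_of_def vec_eq_iff)

lemma linear_matrix_mult_left:
  fixes f :: "'a::real_vector \<Rightarrow> real^'n^'k" and B :: "real^'k^'m"
  shows "linear f \<Longrightarrow> linear (\<lambda>v. B ** f v)"
  using linear_compose[OF _ bounded_linear.linear[OF
      bounded_bilinear.bounded_linear_right[OF bounded_bilinear_matrix_mult, of B]], of f]
  by (simp add: o_def)

lemma linear_matrix_mult_right:
  fixes f :: "'a::real_vector \<Rightarrow> real^'k^'m" and A :: "real^'n^'k"
  shows "linear f \<Longrightarrow> linear (\<lambda>v. f v ** A)"
  using linear_compose[OF _ bounded_linear.linear[OF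
      bounded_bilinear.bounded_linear_left[OF bounded_bilinear_matrix_mult, of A]], of f]
  by (simp add: o_def)

lemma linear_tensor_at_matrix: "linear (\<lambda>v. tensor_at T (M *v v))"
  using linear_compose[OF matrix_vector_mul_linear[of M] linear_tensor_at[of T]] by (simp add: o_def)

text \<open>The last component is the product rule for the matrix field of a composite: the outer
  field is differentiated along the image direction \<open>M *v v\<close>, the inner one along
  \<open>v\<close>.\<close>

lemma fj_mult_tensor:
  "fj_mult (y, z, B, N, S) (x, y', A, M, T) =
    (x, z, B ** A, N ** M, tensor_of (\<lambda>v. tensor_at S (M *v v) ** A + B ** tensor_at T v))"
proof -
  have "(\<Sum>m\<in>UNIV. \<Sum>l\<in>UNIV. S $ j $ m $ l * M $ l $ k * A $ m $ i) =
     (tensor_at S (M *v axis k 1) ** A) $ j $ i" for j i k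
    by (simp add: tensor_at_def matrix_matrix_mult_def matrix_vector_mult_def axis_def sum_distrib_right
        if_distrib[of "\<lambda>t. _ * t"] cong: if_cong)
  moreover have "(\<Sum>m\<in>UNIV. B $ j $ m * T $ m $ i $ k) = (B ** tensor_at T (axis k 1)) $ j $ i" for j i k
    by (simp add: tensor_at_def matrix_matrix_mult_def axis_def
        if_distrib[of "\<lambda>t. _ * t"] cong: if_cong)
  ultimately show ?thesis
    by (simp add: tensor_of_def vec_eq_iff)
qed

lemma fj_inv_tensor:
  "fj_inv (x, y, A, M, T) = (y, x, matrix_inv A, matrix_inv M,
    tensor_of (\<lambda>v. - (matrix_inv A ** tensor_at T (matrix_inv M *v v) ** matrix_inv A)))"
proof -
  let ?A = "matrix_inv A" and ?M = "matrix_inv M"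
  have "(?A ** tensor_at T (?M *v axis k 1) ** ?A) $ j $ i =
      (\<Sum>m\<in>UNIV. \<Sum>p\<in>UNIV. \<Sum>l\<in>UNIV. ?A $ j $ m * T $ m $ p $ l * ?M $ l $ k * ?A $ p $ i)" for j i k
  proof -
    have "(?A ** tensor_at T (?M *v axis k 1) ** ?A) $ j $ i =
       (\<Sum>p\<in>UNIV. \<Sum>m\<in>UNIV. \<Sum>l\<in>UNIV. ?A $ j $ m * T $ m $ p $ l * ?M $ l $ k * ?A $ p $ i)"
      by (simp add: tensor_at_def matrix_matrix_mult_def matrix_vector_mult_def axis_def
          sum_distrib_right sum_distrib_left if_distrib[of "\<lambda>t. _ * t"] mult.assoc cong: if_cong)
    then show ?thesis by (subst sum.swap) simp
  qed
  then show ?thesis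
    by (simp add: tensor_of_def Let_def vec_eq_iff)
qed

text \<open>Valid for all tuples, composable or not, since the product never compares its middle
  points. In tensor form both sides expand to the same three terms.\<close>

lemma fj_mult_assoc: "fj_mult (fj_mult g h) k = fj_mult g (fj_mult h k)"
proof -
  obtain a b A M T where g: "g = (a, b, A, M, T)" by (metis prod.exhaust)
  obtain a' b' A' M' T' where h: "h = (a', b', A', M', T')" by (metis prod.exhaust)
  obtain a'' b'' A'' M'' T'' where k: "k = (a'', b'', A'', M'', T'')" by (metis prod.exhaust)
  have l: "linear (\<lambda>v. tensor_at T (M' *v v) ** A' + A ** tensor_at T' v)"
    for T T' M' A and A' :: "real^'a^'a"
    by (intro linear_compose_add linear_matrix_mult_left linear_matrix_mult_right linear_tensor_at
        linear_tensor_at_matrix)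
  show ?thesis
    unfolding g h k fj_mult_tensor
    by (simp add: tensor_at_of[OF l] matrix_mul_assoc matrix_vector_mul_assoc matrix_add_ldistrib
        bounded_bilinear.add_left[OF bounded_bilinear_matrix_mult] add.assoc)
qed

lemma fj_mult_id_left: "fj_tgt g = y \<Longrightarrow> fj_mult (fj_id y) g = g"
  by (cases g rule: fj_tgt.cases) (use fj_mult_id in auto)

lemma fj_mult_id_right: "fj_src g = x \<Longrightarrow> fj_mult g (fj_id x) = g"
  by (cases g rule: fj_tgt.cases) (simp add: fj_id_def fj_mult_tensor tensor_at_0 tensor_of_at del: fj_mult.simps)

lemma fj_mult_inv_right:
  assumes "invertible A" "invertible M"
  shows "fj_mult (x, y, A, M, T) (fj_inv (x, y, A, M, T)) = fj_id y"
proof -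
  have l: "linear (\<lambda>v. - (matrix_inv A ** tensor_at T (matrix_inv M *v v) ** matrix_inv A))"
    by (intro linear_compose_neg linear_matrix_mult_left linear_matrix_mult_right linear_tensor_at
        linear_tensor_at_matrix)
  show ?thesis
    unfolding fj_inv_tensor fj_mult_tensor fj_id_def
    by (simp add: tensor_at_of[OF l] matrix_inv_mult assms matrix_mul_assoc tensor_of_0
        bounded_bilinear.minus_right[OF bounded_bilinear_matrix_mult])
qed

lemma fj_src_mult: "fj_src (fj_mult g h) = fj_src h"
  by (cases g rule: fj_tgt.cases; cases h rule: fj_tgt.cases) simp

lemma fj_tgt_mult: "fj_tgt (fj_mult g h) = fj_tgt g"
  by (cases g rule: fj_tgt.cases; cases h rule: fj_tgt.cases) simp

lemma fj_src_eq: "fj_src = fst" and fj_tgt_eq: "fj_tgt = fst \<circ> snd"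
  by (auto simp: fun_eq_iff)

lemma smooth_on_fj_mult:
  fixes f g :: "'a::real_normed_vector \<Rightarrow> 'n::finite frame_jet"
  assumes "open S" "smooth_on S f" "smooth_on S g"
  shows "smooth_on S (\<lambda>p. fj_mult (f p) (g p))"
proof -
  have eq: "fj_mult a b = (fst b, fst (snd a), fst (snd (snd a)) ** fst (snd (snd b)),
      fst (snd (snd (snd a))) ** fst (snd (snd (snd b))),
      (\<chi> j i k. (\<Sum>m\<in>UNIV. \<Sum>l\<in>UNIV. snd (snd (snd (snd a))) $ j $ m $ l *
            fst (snd (snd (snd b))) $ l $ k * fst (snd (snd b)) $ m $ i) +
          (\<Sum>m\<in>UNIV. fst (snd (snd a)) $ j $ m * snd (snd (snd (snd b))) $ m $ i $ k)))"
    for a b :: "'n frame_jet"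
    by (cases a rule: fj_tgt.cases; cases b rule: fj_tgt.cases) simp
  show ?thesis
    unfolding eq
    by (intro smooth_on_Pair smooth_on_vec_lambda smooth_on_add smooth_on_sum smooth_on_mult
        smooth_on_vec_nth smooth_on_matrix_mult smooth_on_fst smooth_on_snd assms)
qed

lemma smooth_on_fj_inv:
  fixes f :: "'a::real_normed_vector \<Rightarrow> 'n::finite frame_jet"
  assumes "open S" "smooth_on S f"
    and "\<And>p. p \<in> S \<Longrightarrow> invertible (fst (snd (snd (f p))))"
    and "\<And>p. p \<in> S \<Longrightarrow> invertible (fst (snd (snd (snd (f p)))))"
  shows "smooth_on S (\<lambda>p. fj_inv (f p))"
proof -
  have eq: "fj_inv a = (fst (snd a), fst a, matrix_inv (fst (snd (snd a))), matrix_inv (fst (snd (snd (snd a)))),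
     (\<chi> j i k. - (\<Sum>m\<in>UNIV. \<Sum>p\<in>UNIV. \<Sum>l\<in>UNIV.
        matrix_inv (fst (snd (snd a))) $ j $ m * snd (snd (snd (snd a))) $ m $ p $ l *
        matrix_inv (fst (snd (snd (snd a)))) $ l $ k * matrix_inv (fst (snd (snd a))) $ p $ i)))"
    for a :: "'n frame_jet"
    by (cases a rule: fj_tgt.cases) (simp add: Let_def)
  show ?thesis
    unfolding eq
    by (intro smooth_on_Pair smooth_on_vec_lambda smooth_on_minus smooth_on_sum smooth_on_mult
        smooth_on_vec_nth smooth_on_matrix_inv_compose smooth_on_fst smooth_on_snd assms)
qed

section \<open>Bundle maps over a chart\<close>

definition bundle_map ::
  "(real^'n \<Rightarrow> real^'n) \<Rightarrow> (real^'n \<Rightarrow> real^'n^'n) \<Rightarrow> 'n::finite frame \<Rightarrow> 'n::finite frame" where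
  "bundle_map \<kappa> Q = (\<lambda>(u, C). (\<kappa> u, Q u ** C))"

definition bundle_jet ::
  "(real^'n \<Rightarrow> real^'n) \<Rightarrow> (real^'n \<Rightarrow> real^'n^'n) \<Rightarrow> real^'n \<Rightarrow> 'n::finite frame_jet" where
  "bundle_jet \<kappa> Q x = (x, \<kappa> x, Q x, jacobian \<kappa> (at x), tensor_of (frechet_derivative Q (at x)))"

text \<open>The middle points are irrelevant for \<open>fj_mult\<close>, so that no translation is needed here.\<close>

definition transition_jet ::
  "(real^'n \<Rightarrow> real^'n) \<Rightarrow> (real^'n \<Rightarrow> real^'n^'n) \<Rightarrow> real^'n \<Rightarrow> real^'n \<Rightarrow> 'n::finite frame_jet" where
  "transition_jet \<kappa> Q x y = fj_mult (fj_inv (bundle_jet \<kappa> Q y)) (bundle_jet \<kappa> Q x)"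

lemma frame_map_eq_bundle_map: "frame_map \<psi> = bundle_map \<psi> (\<lambda>x. jacobian \<psi> (at x))"
  by (simp add: frame_map_def bundle_map_def)

lemma frames_eq: "frames U = U \<times> {A. invertible A}"
  by (auto simp: frames_def)

lemma open_frames: "open U \<Longrightarrow> open (frames U)"
  unfolding frames_eq by (intro open_Times open_invertible)

lemma mat_1_in_frames: "x \<in> U \<Longrightarrow> (x, mat 1) \<in> frames U"
  by (simp add: frames_def invertible_mat_1)

text \<open>Both functions have the same derivatives at \<open>x\<close> in the sense of
  \<open>has_derivative\<close>, so the choice behind \<open>frechet_derivative\<close> returns the
  same map, differentiable or not.\<close>

lemma frechet_derivative_cong_open:
  assumes "open S" "x \<in> S" "\<And>z. z \<in> S \<Longrightarrow> f z = g z"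
  shows "frechet_derivative f (at x) = frechet_derivative g (at x)"
proof -
  have "(f has_derivative D) (at x) \<longleftrightarrow> (g has_derivative D) (at x)" for D
    using has_derivative_transform_within_open[of f D x UNIV S g]
      has_derivative_transform_within_open[of g D x UNIV S f] assms by auto
  then show ?thesis by (simp add: frechet_derivative_def)
qed

lemma frame_jet_cong:
  assumes "open U" "x \<in> U" "\<And>z. z \<in> frames U \<Longrightarrow> K z = K' z"
  shows "frame_jet K x = frame_jet K' x"
  using assms frechet_derivative_cong_open[OF open_frames[OF assms(1)] mat_1_in_frames[OF assms(2)] assms(3)]
  by (simp add: frame_jet_def mat_1_in_frames)

lemma bundle_map_derivative:
  fixes \<kappa> :: "real^'n \<Rightarrow> real^'n"
  assumes "\<kappa> differentiable at x" "Q differentiable at x"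
  shows "frechet_derivative (bundle_map \<kappa> Q) (at (x, mat 1)) =
    (\<lambda>h. (frechet_derivative \<kappa> (at x) (fst h), Q x ** snd h + frechet_derivative Q (at x) (fst h)))"
proof -
  let ?k = "frechet_derivative \<kappa> (at x)" and ?q = "frechet_derivative Q (at x)"
  have k: "(\<kappa> has_derivative ?k) (at x)" and q: "(Q has_derivative ?q) (at x)"
    using assms by (simp_all add: frechet_derivative_works)
  have k': "((\<lambda>z. \<kappa> (fst z)) has_derivative (\<lambda>h. ?k (fst h))) (at (x, mat 1 :: real^'n^'n))"
    by (rule has_derivative_compose[OF has_derivative_fst[OF has_derivative_ident]]) (simp add: k)
  have q': "((\<lambda>z. Q (fst z)) has_derivative (\<lambda>h. ?q (fst h))) (at (x, mat 1 :: real^'n^'n))"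
    by (rule has_derivative_compose[OF has_derivative_fst[OF has_derivative_ident]]) (simp add: q)
  have "((\<lambda>z. (\<kappa> (fst z), Q (fst z) ** snd z)) has_derivative
      (\<lambda>h. (?k (fst h), Q (fst (x, mat 1 :: real^'n^'n)) ** snd h +
        ?q (fst h) ** snd (x, mat 1 :: real^'n^'n)))) (at (x, mat 1))"
    by (rule has_derivative_Pair[OF k' bounded_bilinear.FDERIV[OF bounded_bilinear_matrix_mult q'
        has_derivative_snd[OF has_derivative_ident]]])
  from frechet_derivative_eq[OF this] show ?thesis
    by (simp add: bundle_map_def case_prod_beta')
qed

lemma frame_jet_bundle_map:
  fixes \<kappa> :: "real^'n \<Rightarrow> real^'n"
  assumes "\<kappa> differentiable at x" "Q differentiable at x"
  shows "frame_jet (bundle_map \<kappa> Q) x = bundle_jet \<kappa> Q x"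
proof -
  have 0: "Q x ** 0 = 0" by (rule bounded_bilinear.zero_right[OF bounded_bilinear_matrix_mult])
  show ?thesis
    unfolding frame_jet_def Let_def bundle_map_derivative[OF assms]
    by (simp add: 0 bundle_map_def bundle_jet_def jacobian_def matrix_def tensor_of_def)
qed

lemma smooth_on_bundle_map:
  fixes \<kappa> :: "real^'n \<Rightarrow> real^'n"
  assumes "open U" "smooth_on U \<kappa>" "smooth_on U Q"
  shows "smooth_on (frames U) (bundle_map \<kappa> Q)"
proof -
  have opn: "open (frames U :: 'n frame set)" by (rule open_frames[OF assms(1)])
  have f: "smooth_on (frames U) (fst :: 'n frame \<Rightarrow> _)" "smooth_on (frames U) (snd :: 'n frame \<Rightarrow> _)"
    by (intro smooth_on_linear bounded_linear_fst bounded_linear_snd)+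
  have "smooth_on (frames U) (\<lambda>z :: 'n frame. \<kappa> (fst z))" "smooth_on (frames U) (\<lambda>z :: 'n frame. Q (fst z))"
    by (rule smooth_on_compose[OF opn assms(1) _ f(1)]; use assms in \<open>auto simp: frames_def\<close>)+
  then show ?thesis
    unfolding bundle_map_def case_prod_beta'
    by (intro smooth_on_Pair smooth_on_matrix_mult opn f)
qed

lemma equivariant_on_bundle_map: "equivariant_on Z (bundle_map \<kappa> Q)"
  by (auto simp: equivariant_on_def bundle_map_def matrix_mul_assoc)

lemma local_bundle_iso_bundle_map:
  fixes \<kappa> :: "real^'n \<Rightarrow> real^'n"
  assumes "diffeomorphism U V \<kappa>" "smooth_on U Q" and Q: "\<And>u. u \<in> U \<Longrightarrow> invertible (Q u)"
  shows "local_bundle_iso U V (bundle_map \<kappa> Q)"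
proof -
  have U: "open U" "open V" "bij_betw \<kappa> U V" "smooth_on U \<kappa>" "smooth_on V (inv_into U \<kappa>)"
    using assms(1) by (auto simp: diffeomorphism_def)
  let ?k = "inv_into U \<kappa>"
  \<comment> \<open>The inverse is again a bundle map, over the inverse chart, so its smoothness is
    an instance of the result for bundle maps.\<close>
  let ?L = "bundle_map ?k (\<lambda>v. matrix_inv (Q (?k v)))"
  have k: "?k v \<in> U" "\<kappa> (?k v) = v" if "v \<in> V" for v
    using U(3) that by (auto simp: bij_betw_def inv_into_into f_inv_into_f)
  have k': "\<kappa> u \<in> V" "?k (\<kappa> u) = u" if "u \<in> U" for u
    using U(3) that by (auto simp: bij_betw_def)
  have 1: "bundle_map \<kappa> Q z \<in> frames V \<and> ?L (bundle_map \<kappa> Q z) = z" if "z \<in> frames U" for z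
    using that Q k' by (auto simp: frames_def bundle_map_def matrix_mul_assoc matrix_inv_mult
        invertible_mult)
  have 2: "?L z \<in> frames U \<and> bundle_map \<kappa> Q (?L z) = z" if "z \<in> frames V" for z
    using that Q k by (auto simp: frames_def bundle_map_def matrix_mul_assoc matrix_inv_mult
        invertible_mult invertible_matrix_inv)
  have bij: "bij_betw (bundle_map \<kappa> Q) (frames U) (frames V)"
    by (rule bij_betw_byWitness[of _ ?L]) (use 1 2 in auto)
  have "smooth_on (frames V) (inv_into (frames U) (bundle_map \<kappa> Q))"
  proof (rule smooth_on_cong[OF open_frames[OF U(2)]])
    have "smooth_on V (\<lambda>v. Q (?k v))"
      by (rule smooth_on_compose[OF U(2,1) assms(2) U(5) k(1)])
    then show "smooth_on (frames V) ?L"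
      using k Q by (intro smooth_on_bundle_map U smooth_on_matrix_inv_compose) auto
    show "?L z = inv_into (frames U) (bundle_map \<kappa> Q) z" if "z \<in> frames V" for z
      using 2[OF that] bij_betw_inv_into_left[OF bij, of "?L z"] by simp
  qed
  then show ?thesis
    using U bij open_frames[OF U(1)] open_frames[OF U(2)] smooth_on_bundle_map[OF U(1,4) assms(2)]
    by (simp add: local_bundle_iso_def diffeomorphism_def equivariant_on_bundle_map)
qed

lemma local_bundle_iso_inv_into:
  assumes "local_bundle_iso U V \<Psi>"
  shows "local_bundle_iso V U (inv_into (frames U) \<Psi>)"
proof -
  have *: "open U" "open V" "diffeomorphism (frames U) (frames V) \<Psi>" "equivariant_on (frames U) \<Psi>"
    using assms by (auto simp: local_bundle_iso_def)
  let ?I = "inv_into (frames U) \<Psi>"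
  have bij: "bij_betw \<Psi> (frames U) (frames V)" using *(3) by (simp add: diffeomorphism_def)
  have "?I (frame_act z g) = frame_act (?I z) g" if z: "z \<in> frames V" and g: "invertible g" for z g
  proof -
    have Iz: "?I z \<in> frames U" "\<Psi> (?I z) = z"
      using bij z by (auto simp: bij_betw_def inv_into_into f_inv_into_f)
    then have "\<Psi> (frame_act (?I z) g) = frame_act z g"
      using *(4) g by (simp add: equivariant_on_def)
    moreover have "frame_act (?I z) g \<in> frames U"
      using Iz(1) g by (cases "?I z") (auto simp: frames_def invertible_mult)
    ultimately show ?thesis using bij_betw_inv_into_left[OF bij, of "frame_act (?I z) g"] by simp
  qed
  then show ?thesis
    using * diffeomorphism_inv_into by (auto simp: local_bundle_iso_def equivariant_on_def)
qed

lemma frame_jet_ident: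
  fixes x :: "real^'n"
  shows "frame_jet (\<lambda>z. z) x = fj_id x"
proof -
  have "(\<lambda>z::'n frame. z) = bundle_map (\<lambda>x. x) (\<lambda>x. mat 1)"
    by (simp add: bundle_map_def case_prod_beta')
  then have "frame_jet (\<lambda>z. z) x = bundle_jet (\<lambda>x. x) (\<lambda>x. mat 1) x"
    using frame_jet_bundle_map[of "\<lambda>x. x" x "\<lambda>x. mat 1"] by simp
  then show ?thesis
    by (simp add: bundle_jet_def fj_id_def jacobian_def tensor_of_0 matrix_id_mat_1[unfolded id_def])
qed

section \<open>The cocycle of transition jets\<close>

locale bundle_chart =
  fixes U :: "(real^'n) set" and \<kappa> :: "real^'n \<Rightarrow> real^'n" and Q :: "real^'n \<Rightarrow> real^'n^'n"
  assumes diffeo: "diffeomorphism U (\<kappa> ` U) \<kappa>" and smooth_Q: "smooth_on U Q"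
    and invertible_Q: "u \<in> U \<Longrightarrow> invertible (Q u)"
begin

abbreviation "j \<equiv> bundle_jet \<kappa> Q"
abbreviation "G \<equiv> transition_jet \<kappa> Q"
abbreviation "k \<equiv> inv_into U \<kappa>"

lemma open_U: "open U" and open_image: "open (\<kappa> ` U)" and smooth_kappa: "smooth_on U \<kappa>"
  and smooth_k: "smooth_on (\<kappa> ` U) k" and inj_kappa: "inj_on \<kappa> U"
  using diffeo by (auto simp: diffeomorphism_def bij_betw_def)

lemma k_kappa: "u \<in> U \<Longrightarrow> k (\<kappa> u) = u"
  using inj_kappa by simp

lemma invertible_D: "u \<in> U \<Longrightarrow> invertible (jacobian \<kappa> (at u))"
  using diffeo by (rule invertible_jacobian)

lemma kappa_derivative: "u \<in> U \<Longrightarrow> (\<kappa> has_derivative (\<lambda>v. jacobian \<kappa> (at u) *v v)) (at u)"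
  using smooth_on_imp_has_derivative[OF smooth_kappa] jacobian_apply[OF differentiableI] 
  by (metis (no_types, lifting) ext)

lemma Q_derivative: "u \<in> U \<Longrightarrow> (Q has_derivative frechet_derivative Q (at u)) (at u)"
  using smooth_on_imp_has_derivative[OF smooth_Q] .

lemma smooth_on_j: "smooth_on U j"
  unfolding bundle_jet_def tensor_of_def
  by (intro smooth_on_Pair smooth_on_vec_lambda smooth_on_vec_nth smooth_on_frechet_derivative
      smooth_on_jacobian smooth_on_id open_U smooth_kappa smooth_Q)

lemma smooth_on_G: 
  fixes f g :: "'a::real_normed_vector \<Rightarrow> real^'n"
  assumes "open S" "smooth_on S f" "smooth_on S g" "\<And>p. p \<in> S \<Longrightarrow> f p \<in> U" "\<And>p. p \<in> S \<Longrightarrow> g p \<in> U"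
  shows "smooth_on S (\<lambda>p. G (f p) (g p))"
proof -
  have "smooth_on U (\<lambda>u. fj_inv (j u))"
    by (rule smooth_on_fj_inv[OF open_U smooth_on_j]) (auto simp: bundle_jet_def invertible_Q invertible_D)
  from smooth_on_compose[OF assms(1) open_U this assms(3,5)]
    smooth_on_compose[OF assms(1) open_U smooth_on_j assms(2,4)]
  show ?thesis
    unfolding transition_jet_def by (intro smooth_on_fj_mult assms(1))
qed

lemma G_src: "fj_src (G x y) = x" and G_tgt: "fj_tgt (G x y) = y"
  by (simp_all add: transition_jet_def fj_src_mult fj_tgt_mult bundle_jet_def Let_def)

lemma j_inverse:
  assumes "u \<in> U"
  shows "fj_mult (fj_inv (j u)) (j u) = fj_id u" "fj_mult (j u) (fj_inv (j u)) = fj_id (\<kappa> u)"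
  unfolding bundle_jet_def
  by (intro fj_mult_inv_left fj_mult_inv_right invertible_Q invertible_D assms)+

lemma fj_inv_j_src: "fj_src (fj_inv (j u)) = \<kappa> u" and fj_inv_j_tgt: "fj_tgt (fj_inv (j u)) = u"
  by (simp_all add: bundle_jet_def Let_def)

lemma G_id: "x \<in> U \<Longrightarrow> G x x = fj_id x"
  by (simp add: transition_jet_def j_inverse)

lemma fj_mult_cong_right:
  assumes "snd (snd h) = snd (snd h')" "fst h = fst h'"
  shows "fj_mult g h = fj_mult g h'"
  using assms by (cases g rule: fj_tgt.cases; cases h rule: fj_tgt.cases; cases h' rule: fj_tgt.cases) simp

lemma G_mult: 
  assumes "y \<in> U" shows "fj_mult (G y z) (G x y) = G x z"
proof -
  have "fj_mult (G y z) (G x y) =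
      fj_mult (fj_inv (j z)) (fj_mult (fj_mult (j y) (fj_inv (j y))) (j x))"
    by (simp only: transition_jet_def fj_mult_assoc)
  also have "\<dots> = fj_mult (fj_inv (j z)) (fj_mult (fj_id (\<kappa> y)) (j x))"
    by (simp only: j_inverse[OF assms])
  \<comment> \<open>The unit at \<open>\<kappa> y\<close> moved the target of \<open>j x\<close>
    from \<open>\<kappa> x\<close> to \<open>\<kappa> y\<close>, which the outer product does not
    see: this is the translation hidden in \<open>G\<close>.\<close>
  also have "\<dots> = fj_mult (fj_inv (j z)) (fj_mult (fj_id (\<kappa> x)) (j x))"
    by (rule fj_mult_cong_right) (simp_all add: fj_id_def bundle_jet_def)
  also have "\<dots> = G x z"
    using fj_mult_id_left[of "j x" "\<kappa> x"] by (simp add: transition_jet_def bundle_jet_def)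
  finally show ?thesis .
qed

lemma frame_jet_bundle_map': "u \<in> U \<Longrightarrow> frame_jet (bundle_map \<kappa> Q) u = j u"
  using kappa_derivative Q_derivative by (intro frame_jet_bundle_map) (auto simp: differentiable_def)

lemma local_bundle_iso: "local_bundle_iso U (\<kappa> ` U) (bundle_map \<kappa> Q)"
  by (rule local_bundle_iso_bundle_map[OF diffeo smooth_Q invertible_Q])

text \<open>The chain rule for \<open>?I \<circ> ?K\<close>, which is the identity on
  \<open>frames U\<close>, makes the jet of \<open>?I\<close> a left inverse of \<open>j y\<close>;
  cancelling \<open>j y\<close> on the right identifies it with \<open>fj_inv (j y)\<close>.\<close>

lemma frame_jet_inv_into:
  assumes "y \<in> U"
  shows "frame_jet (inv_into (frames U) (bundle_map \<kappa> Q)) (\<kappa> y) = fj_inv (j y)"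
proof -
  let ?K = "bundle_map \<kappa> Q"
  let ?I = "inv_into (frames U) ?K"
  have inj: "inj_on ?K (frames U)"
    using local_bundle_iso by (auto simp: local_bundle_iso_def diffeomorphism_def bij_betw_def)
  have "fj_mult (frame_jet ?I (\<kappa> y)) (j y) = frame_jet (?I \<circ> ?K) y"
    using frame_jet_comp[OF local_bundle_iso local_bundle_iso_inv_into[OF local_bundle_iso] assms] assms
    by (simp add: bundle_map_def frame_jet_bundle_map'[OF assms, unfolded bundle_map_def])
  also have "\<dots> = frame_jet (\<lambda>z. z) y"
    by (rule frame_jet_cong[OF open_U assms]) (simp add: inj)
  finally have "fj_mult (fj_mult (frame_jet ?I (\<kappa> y)) (j y)) (fj_inv (j y)) = fj_mult (fj_id y) (fj_inv (j y))"
    by (simp add: frame_jet_ident)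
  then show ?thesis
    by (simp add: fj_mult_assoc j_inverse[OF assms] fj_mult_id_left fj_inv_j_tgt fj_mult_id_right
        frame_jet_def Let_def)
qed

text \<open>This ties the jets in the definition of homogeneity to \<open>G\<close>. Following
  \<open>K\<close> by a translation replaces \<open>\<kappa>\<close> by \<open>\<kappa> + v\<close>
  and leaves \<open>Q\<close> and all derivatives unchanged, so the jet differs from
  \<open>j x\<close> in its target only, and \<open>fj_mult\<close> ignores that entry of its right
  factor.\<close>

lemma frame_jet_translated:
  assumes "x \<in> U" "y \<in> U" and K: "\<And>z. z \<in> frames U \<Longrightarrow> K z = bundle_map \<kappa> Q z"
  shows "frame_jet (inv_into (frames U) K \<circ> frame_map (translation (base_map K y - base_map K x)) \<circ> K) x =
    G x y"
proof -
  let ?K = "bundle_map \<kappa> Q"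
  let ?I = "inv_into (frames U) ?K"
  define v where "v = \<kappa> y - \<kappa> x"
  let ?T = "bundle_map (\<lambda>u. \<kappa> u + v) Q"
  \<comment> \<open>\<open>inv_into\<close> chooses by a predicate that sees \<open>K\<close> on
    \<open>frames U\<close> only, so the two inverses agree as total functions, also off the
    images.\<close>
  have I: "inv_into (frames U) K = ?I"
  proof
    fix z
    have "(\<lambda>w. w \<in> frames U \<and> K w = z) = (\<lambda>w. w \<in> frames U \<and> ?K w = z)"
      using K by auto
    then show "inv_into (frames U) K z = ?I z" by (simp add: inv_into_def)
  qed
  have v: "base_map K y - base_map K x = v"
    using assms by (simp add: base_map_def K mat_1_in_frames bundle_map_def v_def)
  have "((\<lambda>x. x + v) has_derivative id) (at u)" for u
    by (auto intro!: derivative_eq_intros simp: id_def)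
  from frechet_derivative_eq[OF this] have "jacobian (\<lambda>x. x + v) (at u) = mat 1" for u
    by (simp add: jacobian_def matrix_id_mat_1)
  then have "frame_map (translation v) \<circ> ?K = ?T"
    by (simp add: frame_map_def translation_def fun_eq_iff bundle_map_def)
  then have T: "frame_map (translation v) (?K z) = ?T z" for z
    by (metis comp_apply)
  then have "frame_jet (inv_into (frames U) K \<circ> frame_map (translation (base_map K y - base_map K x)) \<circ> K) x
      = frame_jet (?I \<circ> ?T) x"
    unfolding v I using K by (intro frame_jet_cong[OF open_U assms(1)]) simp
  also have "\<dots> = fj_mult (frame_jet ?I (fst (?T (x, mat 1)))) (frame_jet ?T x)"
  proof (rule frame_jet_comp[OF _ local_bundle_iso_inv_into[OF local_bundle_iso] assms(1)])
    have dt: "((\<lambda>u. \<kappa> u + v) has_derivative (\<lambda>h. jacobian \<kappa> (at u) *v h)) (at u)" if "u \<in> U" for u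
      by (intro has_derivative_add_const kappa_derivative that)
    have "diffeomorphism U ((\<lambda>u. \<kappa> u + v) ` U) (\<lambda>u. \<kappa> u + v)"
    proof (rule diffeomorphism_on_image[OF open_U smooth_on_add[OF open_U smooth_kappa smooth_on_const]])
      show "inj_on (\<lambda>u. \<kappa> u + v) U"
        using inj_kappa by (simp add: inj_on_def)
      show "inj (frechet_derivative (\<lambda>u. \<kappa> u + v) (at u))" if "u \<in> U" for u
        unfolding frechet_derivative_eq[OF dt[OF that]] using invertible_D[OF that]
        by (simp add: invertible_left_inverse matrix_left_invertible_injective)
    qed
    then show "local_bundle_iso U ((\<lambda>u. \<kappa> u + v) ` U) ?T"
      by (rule local_bundle_iso_bundle_map[OF _ smooth_Q invertible_Q])
    show "fst (?T (x, mat 1)) \<in> \<kappa> ` U"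
      using assms by (simp add: bundle_map_def v_def)
  qed
  also have "fst (?T (x, mat 1)) = \<kappa> y"
    by (simp add: bundle_map_def v_def)
  also have "frame_jet ?T x = bundle_jet (\<lambda>u. \<kappa> u + v) Q x"
    using kappa_derivative[OF assms(1)] Q_derivative[OF assms(1)]
    by (intro frame_jet_bundle_map) (auto simp: differentiable_def intro!: exI has_derivative_add_const)
  also have "frame_jet ?I (\<kappa> y) = fj_inv (j y)"
    by (rule frame_jet_inv_into[OF assms(2)])
  also have "fj_mult (fj_inv (j y)) (bundle_jet (\<lambda>u. \<kappa> u + v) Q x) = G x y"
    unfolding transition_jet_def
  proof (rule fj_mult_cong_right)
    have "frechet_derivative (\<lambda>u. \<kappa> u + v) (at x) = frechet_derivative \<kappa> (at x)"
      using frechet_derivative_eq[OF has_derivative_add_const[OF kappa_derivative[OF assms(1)]]]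
        frechet_derivative_eq[OF kappa_derivative[OF assms(1)]] by simp
    then show "snd (snd (bundle_jet (\<lambda>u. \<kappa> u + v) Q x)) = snd (snd (j x))"
      by (simp add: bundle_jet_def jacobian_def)
  qed (simp add: bundle_jet_def)
  finally show ?thesis .
qed

lemma deformation_bundle_map: "deformation U (bundle_map \<kappa> Q)"
proof -
  let ?K = "bundle_map \<kappa> Q"
  have d: "diffeomorphism (frames U) (frames (\<kappa> ` U)) ?K"
    using local_bundle_iso by (simp add: local_bundle_iso_def)
  then have K: "bij_betw ?K (frames U) (frames (\<kappa> ` U))" "smooth_on (frames U) ?K"
      "smooth_on (frames (\<kappa> ` U)) (inv_into (frames U) ?K)"
    by (simp_all add: diffeomorphism_def)
  have im: "?K ` frames U = frames (\<kappa> ` U)" and inj: "inj_on ?K (frames U)"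
    using K(1) by (auto simp: bij_betw_def)
  have "homeomorphism (frames U) (?K ` frames U) ?K (inv_into (frames U) ?K)"
    using inj im smooth_on_imp_continuous_on[OF K(2)] smooth_on_imp_continuous_on[OF K(3)]
    by (intro homeomorphismI) (auto simp: f_inv_into_f inv_into_into)
  moreover have "inj (frechet_derivative ?K (at z))" if "z \<in> frames U" for z
    using diffeomorphism_inverse_has_derivative(3)[OF d that] by (metis injI)
  moreover have "frames (\<kappa> ` U) \<subseteq> frames UNIV" by (auto simp: frames_def)
  ultimately show ?thesis
    using K im equivariant_on_bundle_map open_U by (auto simp: deformation_def)
qed

lemma restrict: 
  assumes "open U'" "U' \<subseteq> U" shows "bundle_chart U' \<kappa> Q"
  by unfold_locales
    (use assms diffeo smooth_Q invertible_Q in \<open>auto intro: diffeomorphism_restrict smooth_on_subset\<close>)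

end

text \<open>By equivariance \<open>K\<close> is determined by its values at the frames
  \<open>(u, mat 1)\<close>. Injectivity of \<open>K\<close> and of its derivative descend to the
  base map because a suitable vertical displacement cancels the fibre component.\<close>

lemma deformation_bundle_chart:
  fixes K :: "'n::finite frame \<Rightarrow> 'n frame"
  assumes "deformation U K"
  defines "Q \<equiv> \<lambda>u. snd (K (u, mat 1))"
  shows "bundle_chart U (base_map K) Q" "\<And>z. z \<in> frames U \<Longrightarrow> K z = bundle_map (base_map K) Q z"
proof -
  obtain K' where K: "open U" "K ` frames U \<subseteq> frames UNIV" "equivariant_on (frames U) K"
      "smooth_on (frames U) K" "\<And>z. z \<in> frames U \<Longrightarrow> inj (frechet_derivative K (at z))"
      "homeomorphism (frames U) (K ` frames U) K K'"
    using assms(1) by (auto simp: deformation_def)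
  show eq: "K z = bundle_map (base_map K) Q z" if z: "z \<in> frames U" for z
  proof -
    obtain u C where u: "z = (u, C)" "u \<in> U" "invertible C" using z by (auto simp: frames_def)
    then have "K (frame_act (u, mat 1) C) = frame_act (K (u, mat 1)) C"
      using K(3) mat_1_in_frames[OF u(2)] unfolding equivariant_on_def by blast
    then show ?thesis
      using u by (cases "K (u, mat 1)") (simp add: bundle_map_def base_map_def Q_def)
  qed
  let ?\<kappa> = "base_map K"
  have K1: "smooth_on U (\<lambda>u. K (u, mat 1))"
    by (rule smooth_on_compose[OF K(1) open_frames[OF K(1)] K(4)])
       (simp_all add: mat_1_in_frames smooth_on_Pair smooth_on_id smooth_on_const K(1))
  have sm: "smooth_on U ?\<kappa>" "smooth_on U Q"
    unfolding base_map_def Q_def by (intro smooth_on_fst smooth_on_snd K1 K(1))+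
  have inv: "invertible (Q u)" if "u \<in> U" for u
    using K(2) mat_1_in_frames[OF that] by (force simp: frames_def Q_def)
  have injK: "inj_on K (frames U)"
    using K(6) by (metis homeomorphism_def inj_on_inverseI)
  \<comment> \<open>The frame with matrix \<open>matrix_inv (Q u)\<close> over \<open>u\<close> is
    sent to the unit frame over the image of \<open>u\<close>, so equal base values give equal
    values of \<open>K\<close>.\<close>
  have inj: "inj_on ?\<kappa> U"
  proof (rule inj_onI)
    fix u v assume uv: "u \<in> U" "v \<in> U" "?\<kappa> u = ?\<kappa> v"
    have f: "(u, matrix_inv (Q u)) \<in> frames U" "(v, matrix_inv (Q v)) \<in> frames U"
      using uv inv invertible_matrix_inv by (auto simp: frames_def)
    have "K (u, matrix_inv (Q u)) = K (v, matrix_inv (Q v))"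
      unfolding eq[OF f(1)] eq[OF f(2)] using uv inv by (simp add: bundle_map_def matrix_inv_mult)
    then show "u = v" using injK f by (auto dest: inj_onD)
  qed
  have injD: "inj (frechet_derivative ?\<kappa> (at u))" if u: "u \<in> U" for u
  proof -
    have k: "(?\<kappa> has_derivative frechet_derivative ?\<kappa> (at u)) (at u)"
      and q: "(Q has_derivative frechet_derivative Q (at u)) (at u)"
      using sm u smooth_on_imp_has_derivative by blast+
    let ?k = "frechet_derivative ?\<kappa> (at u)" and ?q = "frechet_derivative Q (at u)"
    have D: "frechet_derivative K (at (u, mat 1)) = (\<lambda>h. (?k (fst h), Q u ** snd h + ?q (fst h)))"
      using frechet_derivative_cong_open[OF open_frames[OF K(1)] mat_1_in_frames[OF u] eq]
        bundle_map_derivative[OF differentiableI[OF k] differentiableI[OF q]] by simp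
    have lin: "linear ?k" "linear ?q"
      using k q by (auto intro: has_derivative_linear)
    \<comment> \<open>A kernel vector \<open>v\<close> of the base derivative lifts to a kernel
      vector of the derivative of \<open>K\<close>, with vertical part chosen to cancel
      \<open>?q v\<close>.\<close>
    have "v = 0" if "?k v = 0" for v
    proof -
      have "Q u ** - (matrix_inv (Q u) ** ?q v) + ?q v = 0"
        by (simp add: bounded_bilinear.minus_right[OF bounded_bilinear_matrix_mult] matrix_mul_assoc
            matrix_inv_mult inv[OF u])
      then have "frechet_derivative K (at (u, mat 1)) (v, - (matrix_inv (Q u) ** ?q v)) =
          frechet_derivative K (at (u, mat 1)) (0, 0)"
        unfolding D using that lin
        by (simp add: linear_0 bounded_bilinear.zero_right[OF bounded_bilinear_matrix_mult])
      from injD[OF K(5)[OF mat_1_in_frames[OF u]] this] show "v = 0" by simp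
    qed
    then show ?thesis using lin(1) by (simp add: linear_injective_0)
  qed
  show "bundle_chart U ?\<kappa> Q"
    using diffeomorphism_on_image[OF K(1) sm(1) inj injD] sm(2) inv by unfold_locales auto
qed

section \<open>Velocities of transition jets\<close>

text \<open>The value at \<open>q\<close> of the left invariant field that extends \<open>v\<close>.
  It is taken from the derivative of the full product, a smooth map on all pairs of tuples, so that
  it is smooth in \<open>q\<close> and \<open>v\<close> together.\<close>

definition left_velocity :: "'n::finite frame_jet \<Rightarrow> 'n frame_jet \<Rightarrow> 'n frame_jet" where
  "left_velocity q v =
     frechet_derivative (\<lambda>z. fj_mult (fst z) (snd z)) (at (q, fj_id (fj_src q))) (0, v)"

lemma smooth_on_fj_mult_pair:
  "smooth_on UNIV (\<lambda>z :: 'n::finite frame_jet \<times> 'n frame_jet. fj_mult (fst z) (snd z))"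
  by (intro smooth_on_fj_mult smooth_on_linear bounded_linear_fst bounded_linear_snd open_UNIV)

lemma smooth_on_fj_src:
  assumes "open S" "smooth_on S f" shows "smooth_on S (\<lambda>p. fj_src (f p :: 'n::finite frame_jet))"
  unfolding fj_src_eq by (intro smooth_on_fst assms)

lemma smooth_on_fj_tgt:
  assumes "open S" "smooth_on S f" shows "smooth_on S (\<lambda>p. fj_tgt (f p :: 'n::finite frame_jet))"
  unfolding fj_tgt_eq comp_def by (intro smooth_on_fst smooth_on_snd assms)

lemma smooth_on_fj_id:
  assumes "open S" "smooth_on S f" shows "smooth_on S (\<lambda>p. fj_id (f p) :: 'n::finite frame_jet)"
  unfolding fj_id_def by (intro smooth_on_Pair smooth_on_const assms)

lemma smooth_on_left_velocity:
  assumes "open S" "smooth_on S f" "smooth_on S v"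
  shows "smooth_on S (\<lambda>p. left_velocity (f p) (v p))"
  unfolding left_velocity_def
  by (rule smooth_on_frechet_derivative_apply[OF assms(1) open_UNIV smooth_on_fj_mult_pair])
     (intro smooth_on_Pair smooth_on_const smooth_on_fj_id smooth_on_fj_src assms UNIV_I)+

lemma fj_mult_left_has_vector_derivative:
  assumes "(\<delta> has_vector_derivative v) (at s)" "\<delta> s = fj_id (fj_src q)"
  shows "((\<lambda>s. fj_mult q (\<delta> s)) has_vector_derivative left_velocity q v) (at s)"
proof -
  let ?m = "\<lambda>z :: 'a frame_jet \<times> 'a frame_jet. fj_mult (fst z) (snd z)"
  let ?D = "frechet_derivative ?m (at (q, fj_id (fj_src q)))"
  have m: "(?m has_derivative ?D) (at (q, \<delta> s))"
    unfolding assms(2) by (rule smooth_on_imp_has_derivative[OF smooth_on_fj_mult_pair UNIV_I])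
  have "((\<lambda>s. (q, \<delta> s)) has_derivative (\<lambda>h. (0, h *\<^sub>R v))) (at s)"
    using assms(1) unfolding has_vector_derivative_def by (intro has_derivative_Pair has_derivative_const)
  from has_derivative_compose[OF this m]
  have "((\<lambda>s. fj_mult q (\<delta> s)) has_derivative (\<lambda>h. ?D (0, h *\<^sub>R v))) (at s)" by simp
  moreover have "?D (0, h *\<^sub>R v) = h *\<^sub>R ?D (0, v)" for h
    using linear_cmul[OF has_derivative_linear[OF m], of h "(0, v)"] by simp
  ultimately show ?thesis
    by (simp add: has_vector_derivative_def left_velocity_def)
qed

lemma has_derivative_vec_lambda:
  fixes f :: "'a::real_normed_vector \<Rightarrow> 'n::finite \<Rightarrow> 'b::euclidean_space"
  assumes "\<And>i. ((\<lambda>x. f x i) has_derivative (\<lambda>h. f' h i)) F"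
  shows "((\<lambda>x. \<chi> i. f x i) has_derivative (\<lambda>h. \<chi> i. f' h i)) F"
proof -
  have eq: "(\<chi> i. g i) = (\<Sum>i\<in>UNIV. axis i (g i))" for g :: "'n \<Rightarrow> 'b"
    by (simp add: vec_eq_iff sum_component axis_def)
  show ?thesis
    unfolding eq by (intro has_derivative_sum bounded_linear.has_derivative[OF bounded_linear_axis] assms)
qed

lemma matrix_inv_unique:
  fixes A B :: "real^'n::finite^'n"
  assumes "A ** B = mat 1" "B ** A = mat 1"
  shows "matrix_inv A = B"
proof -
  have "invertible A" using assms invertible_def by blast
  then have "matrix_inv A ** (A ** B) = B"
    by (simp add: matrix_mul_assoc matrix_inv_mult)
  then show ?thesis by (simp add: assms)
qed

section \<open>Transition jets as integral curves of left invariant fields\<close>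

context bundle_chart
begin

text \<open>A vector at the unit of \<open>p\<close> tangent to the target fibre: the source leaves
  \<open>p\<close> along the chart direction \<open>w\<close> while the target stays at
  \<open>p\<close>. Differentiating a function of both points makes smoothness in \<open>p\<close>
  available.\<close>

definition velocity :: "real^'n \<Rightarrow> real^'n \<Rightarrow> 'n frame_jet" where
  "velocity w p = frechet_derivative (\<lambda>z. G (k (fst z)) (snd z)) (at (\<kappa> p, p)) (w, 0)"

lemma k_in: "a \<in> \<kappa> ` U \<Longrightarrow> k a \<in> U" and kappa_k: "a \<in> \<kappa> ` U \<Longrightarrow> \<kappa> (k a) = a"
  by (auto simp: inv_into_into f_inv_into_f)

lemma smooth_on_G_chart: "smooth_on (\<kappa> ` U \<times> U) (\<lambda>z. G (k (fst z)) (snd z))"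
proof (rule smooth_on_G)
  show o: "open (\<kappa> ` U \<times> U)" by (intro open_Times open_image open_U)
  show "smooth_on (\<kappa> ` U \<times> U) (\<lambda>z. k (fst z))"
    by (rule smooth_on_compose[OF o open_image smooth_k smooth_on_linear[OF bounded_linear_fst]]) auto
qed (auto intro: smooth_on_linear bounded_linear_snd k_in)

lemma velocity_has_derivative:
  assumes "p \<in> U"
  shows "((\<lambda>a. G (k a) p) has_derivative (\<lambda>w. velocity w p)) (at (\<kappa> p))"
proof -
  have "((\<lambda>z. G (k (fst z)) (snd z)) has_derivative
      frechet_derivative (\<lambda>z. G (k (fst z)) (snd z)) (at (\<kappa> p, p))) (at (\<kappa> p, p))"
    using assms by (intro smooth_on_imp_has_derivative[OF smooth_on_G_chart]) auto
  from has_derivative_compose[of "\<lambda>a. (a, p)" "\<lambda>w. (w, 0)" "\<kappa> p" UNIV, OF _ this]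
  show ?thesis
    by (simp add: velocity_def has_derivative_Pair has_derivative_ident has_derivative_const)
qed

lemma smooth_on_velocity: "smooth_on U (velocity w)"
  unfolding velocity_def[abs_def]
  by (rule smooth_on_frechet_derivative_apply[OF open_U _ smooth_on_G_chart])
     (auto intro!: open_Times open_image open_U smooth_on_Pair smooth_kappa smooth_on_id smooth_on_const)

lemma line_has_vector_derivative:
  "((\<lambda>s. a + s *\<^sub>R w) has_vector_derivative w) (at t)" for a w :: "'a::real_normed_vector"
  by (auto intro!: derivative_eq_intros)

lemma velocity_has_vector_derivative:
  assumes "p \<in> U"
  shows "((\<lambda>s. G (k (\<kappa> p + s *\<^sub>R w)) p) has_vector_derivative velocity w p) (at 0)"
proof -
  have "((\<lambda>s. G (k (\<kappa> p + s *\<^sub>R w)) p) has_derivative (\<lambda>h. velocity (h *\<^sub>R w) p)) (at 0)"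
    by (rule has_derivative_compose[OF line_has_vector_derivative[unfolded has_vector_derivative_def]])
       (use velocity_has_derivative[OF assms] in simp)
  moreover have "velocity (h *\<^sub>R w) p = h *\<^sub>R velocity w p" for h
    using linear_cmul[OF has_derivative_linear[OF velocity_has_derivative[OF assms]]] .
  ultimately show ?thesis by (simp add: has_vector_derivative_def)
qed

text \<open>By the cocycle identity, transition jets are integral curves of left invariant fields.\<close>

lemma G_has_vector_derivative:
  assumes "\<kappa> z + t *\<^sub>R w \<in> \<kappa> ` U"
  defines "p \<equiv> k (\<kappa> z + t *\<^sub>R w)"
  shows "((\<lambda>s. G (k (\<kappa> z + s *\<^sub>R w)) z) has_vector_derivative
    left_velocity (G p z) (velocity w p)) (at t)"
proof -
  have p: "p \<in> U" "\<kappa> p = \<kappa> z + t *\<^sub>R w"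
    using assms by (simp_all add: k_in kappa_k)
  let ?\<delta> = "\<lambda>s. G (k (\<kappa> p + (s - t) *\<^sub>R w)) p"
  have "((\<lambda>s. s - t) has_vector_derivative 1) (at t)"
    by (auto intro!: derivative_eq_intros)
  then have "(?\<delta> has_vector_derivative velocity w p) (at t)"
    using vector_diff_chain_at[of "\<lambda>s. s - t" 1 t "\<lambda>s. G (k (\<kappa> p + s *\<^sub>R w)) p" "velocity w p"]
      velocity_has_vector_derivative[OF p(1), of w]
    by (simp add: o_def)
  moreover have "?\<delta> t = fj_id (fj_src (G p z))"
    by (simp add: G_src k_kappa G_id p(1))
  ultimately have "((\<lambda>s. fj_mult (G p z) (?\<delta> s)) has_vector_derivative
      left_velocity (G p z) (velocity w p)) (at t)"
    by (rule fj_mult_left_has_vector_derivative)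
  then show ?thesis
    unfolding G_mult[OF p(1)] by (simp add: p(2) algebra_simps)
qed

section \<open>The induced coordinates\<close>

abbreviation "jF \<equiv> bundle_jet \<kappa> (\<lambda>u. jacobian \<kappa> (at u))"

lemma frame_chart: "bundle_chart U \<kappa> (\<lambda>u. jacobian \<kappa> (at u))"
  by unfold_locales (auto intro: diffeo invertible_D smooth_on_jacobian open_U smooth_kappa)

text \<open>The matrix field of \<open>bundle_map \<kappa> Q\<close> in the induced coordinates:
  composed with the inverse of F\<kappa> it becomes
  \<open>bundle_map (\<lambda>a. a) R\<close>.\<close>

definition R :: "real^'n \<Rightarrow> real^'n^'n" where
  "R a = Q (k a) ** matrix_inv (jacobian \<kappa> (at (k a)))"

lemma ident_chart: "bundle_chart (\<kappa> ` U) (\<lambda>a. a) R"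
proof
  have "diffeomorphism (\<kappa> ` U) (\<kappa> ` U) (\<lambda>a. a)"
  proof -
    have "inv_into (\<kappa> ` U) (\<lambda>a. a) b = b" if "b \<in> \<kappa> ` U" for b
      using that inv_into_f_f[of "\<lambda>a. a" "\<kappa> ` U" b] by simp
    from smooth_on_cong[OF open_image this[symmetric] smooth_on_id]
    show ?thesis
      by (simp add: diffeomorphism_def open_image smooth_on_id bij_betw_def)
  qed
  then show "diffeomorphism (\<kappa> ` U) ((\<lambda>a. a) ` \<kappa> ` U) (\<lambda>a. a)" by simp
  have "smooth_on U (\<lambda>x. Q x ** matrix_inv (jacobian \<kappa> (at x)))"
    using invertible_D
    by (intro smooth_on_matrix_mult smooth_on_matrix_inv_compose smooth_on_jacobian smooth_Q smooth_kappa open_U)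
  from smooth_on_compose[OF open_image open_U this smooth_k k_in]
  show "smooth_on (\<kappa> ` U) R" by (simp add: R_def[abs_def])
  show "invertible (R a)" if "a \<in> \<kappa> ` U" for a
    using that by (simp add: R_def invertible_mult invertible_Q invertible_D invertible_matrix_inv k_in)
qed

text \<open>The jet of \<open>?K \<circ> ?I\<close> is computed twice, as a product by the chain
  rule and from the explicit form of the composite over the identity chart.\<close>

lemma j_jF: 
  assumes "a \<in> \<kappa> ` U"
  shows "fj_mult (j (k a)) (fj_inv (jF (k a))) = bundle_jet (\<lambda>a. a) R a"
proof -
  interpret F: bundle_chart U \<kappa> "\<lambda>u. jacobian \<kappa> (at u)" by (rule frame_chart)
  interpret I: bundle_chart "\<kappa> ` U" "\<lambda>a. a" R by (rule ident_chart)
  let ?F = "bundle_map \<kappa> (\<lambda>u. jacobian \<kappa> (at u))" and ?K = "bundle_map \<kappa> Q"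
  let ?I = "inv_into (frames U) ?F"
  have F: "bij_betw ?F (frames U) (frames (\<kappa> ` U))"
    using F.local_bundle_iso by (simp add: local_bundle_iso_def diffeomorphism_def)
  have eqI: "?I (b, C) = (k b, matrix_inv (jacobian \<kappa> (at (k b))) ** C)" if "b \<in> \<kappa> ` U" "invertible C" for b C
  proof -
    have "(k b, matrix_inv (jacobian \<kappa> (at (k b))) ** C) \<in> frames U"
      using that by (simp add: frames_def k_in invertible_mult invertible_matrix_inv invertible_D)
    from bij_betw_inv_into_left[OF F this] show ?thesis
      using that by (simp add: bundle_map_def kappa_k matrix_mul_assoc matrix_inv_mult invertible_D k_in)
  qed
  have "fst (?I (a, mat 1)) = k a"
    using assms by (simp add: eqI invertible_mat_1)
  then have "frame_jet (?K \<circ> ?I) a = fj_mult (j (k a)) (frame_jet ?I a)"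
    using frame_jet_comp[OF local_bundle_iso_inv_into[OF F.local_bundle_iso] local_bundle_iso assms] assms
    by (simp add: k_in frame_jet_bundle_map')
  also have "frame_jet ?I a = fj_inv (jF (k a))"
    using F.frame_jet_inv_into[OF k_in[OF assms]] assms by (simp add: kappa_k)
  also have "frame_jet (?K \<circ> ?I) a = frame_jet (bundle_map (\<lambda>a. a) R) a"
  proof (rule frame_jet_cong[OF open_image assms])
    fix z :: "'n frame" assume "z \<in> frames (\<kappa> ` U)"
    then obtain b C where z: "z = (b, C)" "b \<in> \<kappa> ` U" "invertible C" by (auto simp: frames_def)
    have "(?K \<circ> ?I) z = ?K (k b, matrix_inv (jacobian \<kappa> (at (k b))) ** C)"
      by (simp add: z eqI)
    then show "(?K \<circ> ?I) z = bundle_map (\<lambda>a. a) R z"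
      using z by (simp add: bundle_map_def kappa_k R_def matrix_mul_assoc)
  qed
  also have "\<dots> = bundle_jet (\<lambda>a. a) R a" by (rule I.frame_jet_bundle_map'[OF assms])
  finally show ?thesis by simp
qed

lemma frame_jet_coordinates_eq:
  assumes "fj_src g \<in> U" "fj_tgt g \<in> U"
  shows "frame_jet_coordinates \<kappa> g = fj_mult (jF (fj_tgt g)) (fj_mult g (fj_inv (jF (fj_src g))))"
proof -
  interpret F: bundle_chart U \<kappa> "\<lambda>u. jacobian \<kappa> (at u)" by (rule frame_chart)
  show ?thesis
    using assms by (simp add: frame_jet_coordinates_def frame_map_eq_bundle_map F.frame_jet_bundle_map')
qed

text \<open>Conjugation by \<open>jF\<close> is absorbed into the two factors of \<open>G\<close>:
  by \<open>j_jF\<close> and its inverse, each \<open>j\<close> turns into the jet of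
  \<open>R\<close>. The cocycle keeps its form, with the identity as base map.\<close>

lemma frame_jet_coordinates_G:
  assumes "a \<in> \<kappa> ` U" "b \<in> \<kappa> ` U"
  shows "frame_jet_coordinates \<kappa> (G (k a) (k b)) = transition_jet (\<lambda>a. a) R a b"
proof -
  interpret F: bundle_chart U \<kappa> "\<lambda>u. jacobian \<kappa> (at u)" by (rule frame_chart)
  interpret I: bundle_chart "\<kappa> ` U" "\<lambda>a. a" R by (rule ident_chart)
  have kb: "k b \<in> U" using assms by (simp add: k_in)
  let ?H = "fj_mult (jF (k b)) (fj_inv (j (k b)))"
  have "fj_mult ?H (I.j b) = fj_mult (jF (k b)) (fj_mult (fj_mult (fj_inv (j (k b))) (j (k b))) (fj_inv (jF (k b))))"
    using j_jF[OF assms(2)] by (simp add: fj_mult_assoc)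
  also have "\<dots> = fj_id b"
    using assms(2)
    by (simp add: j_inverse[OF kb] F.j_inverse[OF kb] fj_mult_id_left F.fj_inv_j_tgt kappa_k)
  finally have "fj_mult (fj_mult ?H (I.j b)) (fj_inv (I.j b)) = fj_inv (I.j b)"
    by (simp add: fj_mult_id_left I.fj_inv_j_tgt)
  then have H: "?H = fj_inv (I.j b)"
    using assms(2)
    by (simp add: fj_mult_assoc I.j_inverse fj_mult_id_right fj_src_mult fj_inv_j_src kappa_k)
  have "frame_jet_coordinates \<kappa> (G (k a) (k b)) = fj_mult ?H (fj_mult (j (k a)) (fj_inv (jF (k a))))"
    using assms frame_jet_coordinates_eq[of "G (k a) (k b)"]
    by (simp add: G_src G_tgt k_in) (simp add: transition_jet_def fj_mult_assoc)
  then show ?thesis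
    unfolding H j_jF[OF assms(1)] by (simp add: transition_jet_def)
qed

section \<open>The parallelism in coordinates and the prescribed section\<close>

definition P :: "(real^'n) \<times> (real^'n) \<Rightarrow> real^'n^'n" where
  "P z = matrix_inv (R (snd z)) ** R (fst z)"

lemma smooth_on_P: "smooth_on (\<kappa> ` U \<times> \<kappa> ` U) P"
proof -
  interpret I: bundle_chart "\<kappa> ` U" "\<lambda>a. a" R by (rule ident_chart)
  have o: "open (\<kappa> ` U \<times> \<kappa> ` U)" by (intro open_Times open_image)
  have "smooth_on (\<kappa> ` U \<times> \<kappa> ` U) (\<lambda>z. R (fst z))" "smooth_on (\<kappa> ` U \<times> \<kappa> ` U) (\<lambda>z. R (snd z))"
    by (rule smooth_on_compose[OF o open_image I.smooth_Q smooth_on_linear[OF bounded_linear_fst]]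
        smooth_on_compose[OF o open_image I.smooth_Q smooth_on_linear[OF bounded_linear_snd]]; auto)+
  then show ?thesis
    unfolding P_def[abs_def]
    by (intro smooth_on_matrix_mult smooth_on_matrix_inv_compose o) (auto intro: I.invertible_Q)
qed

lemma P_derivative:
  assumes "a \<in> \<kappa> ` U" "b \<in> \<kappa> ` U"
  shows "frechet_derivative P (at (a, b)) (v, w) = matrix_inv (R b) ** frechet_derivative R (at a) v -
    (matrix_inv (R b) ** frechet_derivative R (at b) w ** matrix_inv (R b)) ** R a"
proof -
  interpret I: bundle_chart "\<kappa> ` U" "\<lambda>a. a" R by (rule ident_chart)
  have 1: "((\<lambda>z. R (fst z)) has_derivative (\<lambda>h. frechet_derivative R (at a) (fst h))) (at (a, b))"
    by (rule has_derivative_compose[OF has_derivative_fst[OF has_derivative_ident]])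
       (simp add: I.Q_derivative assms)
  have 2: "((\<lambda>z. R (snd z)) has_derivative (\<lambda>h. frechet_derivative R (at b) (snd h))) (at (a, b))"
    by (rule has_derivative_compose[OF has_derivative_snd[OF has_derivative_ident]])
       (simp add: I.Q_derivative assms)
  have 3: "((\<lambda>z. matrix_inv (R (snd z))) has_derivative (\<lambda>h. - (matrix_inv (R b) **
      frechet_derivative R (at b) (snd h) ** matrix_inv (R b)))) (at (a, b))"
    using has_derivative_compose[OF 2, of matrix_inv] has_derivative_matrix_inv[OF I.invertible_Q[OF assms(2)]]
    by simp
  have "(P has_derivative (\<lambda>h. matrix_inv (R (snd (a, b))) ** frechet_derivative R (at a) (fst h) +
      - (matrix_inv (R b) ** frechet_derivative R (at b) (snd h) ** matrix_inv (R b)) ** R (fst (a, b))))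
      (at (a, b))"
    unfolding P_def[abs_def] by (rule bounded_bilinear.FDERIV[OF bounded_bilinear_matrix_mult 3 1])
  from frechet_derivative_eq[OF this] show ?thesis
    by (simp add: bounded_bilinear.minus_left[OF bounded_bilinear_matrix_mult])
qed

text \<open>Over the identity chart the transition covers the translation by \<open>b - a\<close>,
  so source and target move together and its matrix part is P(u, u + b - a). Hence the unit matrix
  and the derivative along \<open>(axis k 1, axis k 1)\<close>.\<close>

lemma transition_jet_ident:
  assumes "a \<in> \<kappa> ` U" "b \<in> \<kappa> ` U"
  shows "transition_jet (\<lambda>a. a) R a b = (a, b, P (a, b), mat 1,
    (\<chi> j i k. frechet_derivative P (at (a, b)) (axis k 1, axis k 1) $ j $ i))"
proof -
  interpret I: bundle_chart "\<kappa> ` U" "\<lambda>a. a" R by (rule ident_chart)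
  have J: "jacobian (\<lambda>a::real^'n. a) (at c) = mat 1" for c
    by (simp add: jacobian_def matrix_id_mat_1[unfolded id_def])
  have iJ: "matrix_inv (mat 1 :: real^'n^'n) = mat 1"
    by (metis invertible_mat_1 matrix_inv_mult(1) matrix_mul_lid)
  have lR: "linear (frechet_derivative R (at c))" if "c \<in> \<kappa> ` U" for c
    by (rule has_derivative_linear[OF I.Q_derivative[OF that]])
  have l: "linear (\<lambda>v. - (matrix_inv (R b) ** tensor_at (tensor_of (frechet_derivative R (at b))) (mat 1 *v v)
      ** matrix_inv (R b)))"
    by (intro linear_compose_neg linear_matrix_mult_left linear_matrix_mult_right linear_tensor_at_matrix)
  show ?thesis
    unfolding transition_jet_def bundle_jet_def fj_inv_tensor fj_mult_tensor J iJ tensor_at_of[OF l]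
    by (simp add: tensor_at_of lR assms P_def P_derivative[OF assms]
        bounded_bilinear.minus_left[OF bounded_bilinear_matrix_mult])
       (simp add: tensor_of_def)
qed

lemma open_src_tgt:
  assumes "open V" shows "open {g :: 'n frame_jet. fj_src g \<in> V \<and> fj_tgt g \<in> V}"
proof -
  have "{g :: 'n frame_jet. fj_src g \<in> V \<and> fj_tgt g \<in> V} = V \<times> V \<times> UNIV"
    by auto
  then show ?thesis using assms by (simp add: open_Times)
qed

text \<open>The reverse conjugation \<open>?\<Psi>\<close> is a smooth left inverse of the
  coordinate map near the units, and the chain rule gives injectivity. This is what later allows the
  coordinate map to be cancelled from membership in the image of an algebroid fibre.\<close>

lemma frame_jet_coordinates_derivative:
  assumes "p \<in> U"
  shows "(frame_jet_coordinates \<kappa> has_derivative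
      frechet_derivative (frame_jet_coordinates \<kappa>) (at (fj_id p))) (at (fj_id p))"
    and "inj (frechet_derivative (frame_jet_coordinates \<kappa>) (at (fj_id p)))"
proof -
  interpret F: bundle_chart U \<kappa> "\<lambda>u. jacobian \<kappa> (at u)" by (rule frame_chart)
  let ?O = "{g :: 'n frame_jet. fj_src g \<in> U \<and> fj_tgt g \<in> U}"
  let ?O' = "{g :: 'n frame_jet. fj_src g \<in> \<kappa> ` U \<and> fj_tgt g \<in> \<kappa> ` U}"
  let ?\<Psi> = "\<lambda>g. fj_mult (fj_inv (jF (k (fj_tgt g)))) (fj_mult g (jF (k (fj_src g))))"
  let ?\<Phi> = "frame_jet_coordinates \<kappa>"
  have O: "open ?O" "open ?O'" by (intro open_src_tgt open_U open_image)+
  have idO: "fj_id p \<in> ?O" using assms by (simp add: fj_id_def)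
  have inv: "smooth_on U (\<lambda>u. fj_inv (jF u))"
    by (rule smooth_on_fj_inv[OF open_U F.smooth_on_j]) (auto simp: bundle_jet_def invertible_D)
  have "smooth_on ?O (\<lambda>g. fj_mult (jF (fj_tgt g)) (fj_mult g (fj_inv (jF (fj_src g)))))"
    by (intro smooth_on_fj_mult O smooth_on_id
        smooth_on_compose[OF O(1) open_U F.smooth_on_j smooth_on_fj_tgt]
        smooth_on_compose[OF O(1) open_U inv smooth_on_fj_src]) auto
  then have "smooth_on ?O ?\<Phi>"
    by (rule smooth_on_cong[OF O(1), rotated]) (simp add: frame_jet_coordinates_eq)
  then show d: "(?\<Phi> has_derivative frechet_derivative ?\<Phi> (at (fj_id p))) (at (fj_id p))"
    using idO by (rule smooth_on_imp_has_derivative)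
  have sk: "smooth_on ?O' (\<lambda>g. k (fj_src g))" "smooth_on ?O' (\<lambda>g. k (fj_tgt g))"
    by (intro smooth_on_compose[OF O(2) open_image smooth_k] smooth_on_fj_src smooth_on_fj_tgt
        smooth_on_id O; simp)+
  have \<Psi>: "smooth_on ?O' ?\<Psi>"
    by (intro smooth_on_fj_mult O smooth_on_id
        smooth_on_compose[OF O(2) open_U F.smooth_on_j sk(1)]
        smooth_on_compose[OF O(2) open_U inv sk(2)]) (auto simp: k_in)
  have st: "fj_src (?\<Phi> g) = \<kappa> (fj_src g)" "fj_tgt (?\<Phi> g) = \<kappa> (fj_tgt g)" if "g \<in> ?O" for g
    using that F.fj_inv_j_src by (simp_all add: frame_jet_coordinates_eq fj_src_mult fj_tgt_mult)
      (simp_all add: bundle_jet_def)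
  have \<Psi>\<Phi>: "?\<Psi> (?\<Phi> g) = g" if g: "g \<in> ?O" for g
  proof -
    have "?\<Psi> (?\<Phi> g) = fj_mult (fj_mult (fj_inv (jF (fj_tgt g))) (jF (fj_tgt g)))
        (fj_mult g (fj_mult (fj_inv (jF (fj_src g))) (jF (fj_src g))))"
      using g unfolding st[OF g] by (simp add: k_kappa frame_jet_coordinates_eq fj_mult_assoc)
    then show ?thesis
      using g by (simp add: F.j_inverse fj_mult_id_left fj_mult_id_right)
  qed
  have "?\<Phi> (fj_id p) \<in> ?O'" using st[OF idO] idO by simp
  from has_derivative_compose[OF d smooth_on_imp_has_derivative[OF \<Psi> this]]
  have "((\<lambda>g. ?\<Psi> (?\<Phi> g)) has_derivative (\<lambda>h. frechet_derivative ?\<Psi> (at (?\<Phi> (fj_id p)))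
      (frechet_derivative ?\<Phi> (at (fj_id p)) h))) (at (fj_id p))" .
  moreover have "((\<lambda>g. ?\<Psi> (?\<Phi> g)) has_derivative (\<lambda>h. h)) (at (fj_id p))"
    by (rule has_derivative_transform_within_open[OF has_derivative_ident O(1) idO]) (rule \<Psi>\<Phi>[symmetric])
  ultimately have "(\<lambda>h. frechet_derivative ?\<Psi> (at (?\<Phi> (fj_id p)))
      (frechet_derivative ?\<Phi> (at (fj_id p)) h)) = (\<lambda>h. h)"
    by (rule has_derivative_unique)
  from fun_cong[OF this] show "inj (frechet_derivative ?\<Phi> (at (fj_id p)))"
    by (intro inj_on_inverseI)
qed

text \<open>The induced coordinates multiply \<open>matrix_inv (Q y) ** Q x\<close> by the Jacobian
  of the chart at the target and by its inverse at the source; these factors are exactly what turns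
  \<open>Q\<close> into \<open>R\<close>.\<close>

lemma local_expression_eq:
  assumes "\<And>x y. x \<in> U \<Longrightarrow> y \<in> U \<Longrightarrow> \<P> (x, y) = (x, y, matrix_inv (Q y) ** Q x)"
    and "z \<in> \<kappa> ` U \<times> \<kappa> ` U"
  shows "local_expression U \<kappa> \<P> z = P z"
proof -
  obtain a b where z: "z = (a, b)" "a \<in> \<kappa> ` U" "b \<in> \<kappa> ` U" using assms(2) by auto
  have "matrix_inv (R b) = jacobian \<kappa> (at (k b)) ** matrix_inv (Q (k b))"
  proof (rule matrix_inv_unique)
    let ?J = "jacobian \<kappa> (at (k b))" and ?q = "Q (k b)"
    have i: "invertible ?J" "invertible ?q"
      using k_in[OF z(3)] by (simp_all add: invertible_D invertible_Q)
    have "R b ** (?J ** matrix_inv ?q) = ?q ** (matrix_inv ?J ** ?J) ** matrix_inv ?q"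
      by (simp add: R_def matrix_mul_assoc)
    then show "R b ** (?J ** matrix_inv ?q) = mat 1"
      by (simp add: matrix_inv_mult i)
    have "(?J ** matrix_inv ?q) ** R b = ?J ** (matrix_inv ?q ** ?q) ** matrix_inv ?J"
      by (simp add: R_def matrix_mul_assoc)
    then show "(?J ** matrix_inv ?q) ** R b = mat 1"
      by (simp add: matrix_inv_mult i)
  qed
  then show ?thesis
    using assms(1)[OF k_in[OF z(2)] k_in[OF z(3)]]
    by (simp add: z(1) local_expression_def jet_coordinates_def jet1_def P_def R_def matrix_mul_assoc)
qed

text \<open>Both sides are derivatives of one map, the transition jet read in coordinates as its
  source \<open>s\<close> moves and its target \<open>a\<close> stays fixed. By
  \<open>transition_jet_ident\<close> its entries are \<open>s\<close>, \<open>a\<close>,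
  \<open>P (s, a)\<close>, the unit matrix and the sum of the two first partials of
  \<open>P\<close>. Differentiating in \<open>s\<close> gives the components of the section.\<close>

lemma section_eq_velocity:
  assumes \<P>: "\<And>x y. x \<in> U \<Longrightarrow> y \<in> U \<Longrightarrow> \<P> (x, y) = (x, y, matrix_inv (Q y) ** Q x)"
    and p: "p \<in> U"
  shows "(\<Sum>l\<in>UNIV. w $ l *\<^sub>R section_components (local_expression U \<kappa> \<P>) (\<kappa> p) l) =
    frechet_derivative (frame_jet_coordinates \<kappa>) (at (fj_id p)) (velocity w p)"
proof -
  define a where "a = \<kappa> p"
  have a: "a \<in> \<kappa> ` U" "k a = p" using p by (simp_all add: a_def k_kappa)
  let ?O = "\<kappa> ` U \<times> \<kappa> ` U"
  let ?L = "local_expression U \<kappa> \<P>"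
  let ?D = "\<lambda>f z. frechet_derivative f (at z)"
  have O: "open ?O" by (intro open_Times open_image)
  have aO: "(a, a) \<in> ?O" using a by simp
  \<comment> \<open>The local expression is controlled on \<open>?O\<close> only; equality on this
    open set, rather than at \<open>(a, a)\<close> alone, is what transfers the second
    derivatives.\<close>
  have LP: "?L z = P z" if "z \<in> ?O" for z
    by (rule local_expression_eq[OF \<P> that])
  have DLP: "?D ?L z = ?D P z" if "z \<in> ?O" for z
    by (rule frechet_derivative_cong_open[OF O that LP])
  have DDLP: "?D (\<lambda>z. ?D ?L z h) (a, a) = ?D (\<lambda>z. ?D P z h) (a, a)" for h
    by (rule frechet_derivative_cong_open[OF O aO]) (simp add: DLP)
  have LPs: "section_components ?L a l = section_components P a l" for l
    by (simp add: section_components_def DLP[OF aO] DDLP)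
  have dP: "((\<lambda>z. ?D P z h) has_derivative ?D (\<lambda>z. ?D P z h) (a, a)) (at (a, a))" for h
    by (rule smooth_on_imp_has_derivative[OF smooth_on_frechet_derivative[OF smooth_on_P] aO])
  have linP: "linear (?D P z)" if "z \<in> ?O" for z
    by (rule has_derivative_linear[OF smooth_on_imp_has_derivative[OF smooth_on_P that]])
  let ?f = "\<lambda>k z. ?D P z (axis k 1, axis k 1)"
  have f: "(?f k has_derivative (\<lambda>h. ?D (partial_x k P) (a, a) h + ?D (partial_y k P) (a, a) h)) (at (a, a))" for k
  proof (rule has_derivative_transform_within_open[OF has_derivative_add[OF dP dP] O aO])
    show "partial_x k P z + partial_y k P z = ?f k z" if "z \<in> ?O" for z
      using linear_add[OF linP[OF that], of "(axis k 1, 0)" "(0, axis k 1)"] by simp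
  qed
  have slice: "((\<lambda>s. g (s, a)) has_derivative (\<lambda>v. g' (v, 0))) (at a)"
    if "(g has_derivative g') (at (a, a))" for g :: "(real^'n) \<times> (real^'n) \<Rightarrow> real^'n^'n" and g'
    using has_derivative_compose[OF has_derivative_Pair[OF has_derivative_ident has_derivative_const] that]
    by simp
  let ?C = "\<lambda>v. (v, 0, ?D P (a, a) (v, 0), 0, (\<chi> j i k. (?D (partial_x k P) (a, a) (v, 0) +
      ?D (partial_y k P) (a, a) (v, 0)) $ j $ i)) :: 'n frame_jet"
  have "((\<lambda>s. (s, a, P (s, a), mat 1, (\<chi> j i k. ?f k (s, a) $ j $ i))) has_derivative ?C) (at a)"
    by (intro has_derivative_Pair has_derivative_ident has_derivative_const has_derivative_vec_lambda
        bounded_linear.has_derivative[OF bounded_linear_vec_nth] slice f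
        smooth_on_imp_has_derivative[OF smooth_on_P aO])
  then have C: "((\<lambda>s. frame_jet_coordinates \<kappa> (G (k s) p)) has_derivative ?C) (at a)"
  proof (rule has_derivative_transform_within_open[OF _ open_image a(1)])
    show "(s, a, P (s, a), mat 1, (\<chi> j i k. ?f k (s, a) $ j $ i)) = frame_jet_coordinates \<kappa> (G (k s) p)"
      if "s \<in> \<kappa> ` U" for s
      using frame_jet_coordinates_G[OF that a(1)] transition_jet_ident[OF that a(1)] by (simp add: a)
  qed
  have "((\<lambda>s. frame_jet_coordinates \<kappa> (G (k s) p)) has_derivative
      (\<lambda>w. ?D (frame_jet_coordinates \<kappa>) (fj_id p) (velocity w p))) (at a)"
    using has_derivative_compose[OF velocity_has_derivative[OF p]]
      frame_jet_coordinates_derivative(1)[OF p] by (simp add: G_id k_kappa p a_def)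
  note D = this
  have lin: "f (\<Sum>l\<in>UNIV. w $ l *\<^sub>R axis l 1) = (\<Sum>l\<in>UNIV. w $ l *\<^sub>R f (axis l 1))"
    if "linear f" for f :: "real^'n \<Rightarrow> 'n frame_jet"
    by (simp only: linear_sum[OF that] linear_cmul[OF that])
  from has_derivative_unique[OF C D]
  have "?D (frame_jet_coordinates \<kappa>) (fj_id p) (velocity w p) = ?C w" by metis
  also have "\<dots> = ?C (\<Sum>l\<in>UNIV. w $ l *\<^sub>R axis l 1)"
    using basis_expansion[of w] by (simp only: scalar_mult_eq_scaleR)
  also have "\<dots> = (\<Sum>l\<in>UNIV. w $ l *\<^sub>R ?C (axis l 1))"
    by (rule lin[OF has_derivative_linear[OF C]])
  also have "\<dots> = (\<Sum>l\<in>UNIV. w $ l *\<^sub>R section_components ?L a l)"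
    by (simp only: LPs) (simp only: section_components_def)
  finally show ?thesis by (simp add: a_def)
qed

end

section \<open>Curves in submanifolds\<close>

text \<open>Both norm bounds serve the distance estimate below: the first keeps the projected curve
  in the ball, the second bounds the component of the velocity normal to \<open>E\<close>.\<close>

lemma orthogonal_projection_exists:
  fixes E :: "'a::euclidean_space set"
  assumes "subspace E"
  obtains \<pi> where "linear \<pi>" "\<And>x. \<pi> x \<in> E" "\<And>x. x \<in> E \<Longrightarrow> \<pi> x = x"
    "\<And>x. norm (\<pi> x) \<le> norm x" "\<And>x. norm (x - \<pi> x) \<le> norm x"
proof -
  obtain B where B: "B \<subseteq> E" "pairwise orthogonal B" "\<And>x. x \<in> B \<Longrightarrow> norm x = 1"
      "independent B" "span B = E"
    using orthonormal_basis_subspace[OF assms] by metis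
  have fin: "finite B" using B(4) by (simp add: independent_imp_finite)
  define \<pi> where "\<pi> x = (\<Sum>b\<in>B. (x \<bullet> b) *\<^sub>R b)" for x
  have lin: "linear \<pi>"
    by (rule linearI) (simp_all add: \<pi>_def inner_add_left scaleR_add_left sum.distrib scaleR_sum_right)
  have inE: "\<pi> x \<in> E" for x
    unfolding \<pi>_def using B(1) assms by (intro subspace_sum subspace_scale) auto
  have "\<pi> x \<bullet> c = x \<bullet> c" if "c \<in> B" for x c
  proof -
    have "\<pi> x \<bullet> c = (\<Sum>b\<in>B. if b = c then x \<bullet> c else 0)"
      unfolding \<pi>_def inner_sum_left
    proof (rule sum.cong[OF refl])
      fix b assume "b \<in> B"
      then show "(x \<bullet> b) *\<^sub>R b \<bullet> c = (if b = c then x \<bullet> c else 0)"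
        using B(2,3) that by (auto simp: pairwise_def orthogonal_def norm_eq_1)
    qed
    then show ?thesis using fin that by simp
  qed
  then have "orthogonal (x - \<pi> x) b" if "b \<in> B" for x b
    using that by (simp add: orthogonal_def inner_diff_left)
  then have ortho: "orthogonal (x - \<pi> x) y" if "y \<in> E" for x y
    using orthogonal_to_span[of y B "x - \<pi> x"] that B(5) by blast
  have fixed: "\<pi> x = x" if "x \<in> E" for x
    using ortho[of "x - \<pi> x" x] that inE subspace_diff[OF assms] by (simp add: orthogonal_self)
  have pyth: "norm x ^ 2 = norm (x - \<pi> x) ^ 2 + norm (\<pi> x) ^ 2" for x
    using norm_add_Pythagorean[OF ortho[OF inE[of x], of x]] by simp
  have "norm (\<pi> x) ^ 2 \<le> norm x ^ 2" "norm (x - \<pi> x) ^ 2 \<le> norm x ^ 2" for x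
    using pyth[of x] zero_le_power2[of "norm (x - \<pi> x)"] zero_le_power2[of "norm (\<pi> x)"] by linarith+
  then have "norm (\<pi> x) \<le> norm x" "norm (x - \<pi> x) \<le> norm x" for x
    by (meson norm_ge_zero power2_le_imp_le)+
  with lin inE fixed show ?thesis by (rule that)
qed

text \<open>Smoothness controls directional derivatives only. Their maxima over \<open>Basis\<close>
  add up to a bound of the operator norm on the compact set, and convexity turns it into a Lipschitz
  constant.\<close>

lemma smooth_on_lipschitz:
  fixes Z :: "'a::euclidean_space \<Rightarrow> 'b::real_normed_vector"
  assumes "smooth_on Y Z" "compact C" "convex C" "C \<subseteq> Y"
  obtains L where "\<And>x y. x \<in> C \<Longrightarrow> y \<in> C \<Longrightarrow> norm (Z x - Z y) \<le> L * norm (x - y)"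
proof -
  have "\<exists>M. \<forall>x\<in>C. norm (frechet_derivative Z (at x) b) \<le> M" for b
  proof -
    have "continuous_on C (\<lambda>x. frechet_derivative Z (at x) b)"
      using smooth_on_imp_continuous_on[OF smooth_on_frechet_derivative[OF assms(1)]] assms(4)
      by (rule continuous_on_subset)
    from compact_imp_bounded[OF compact_continuous_image[OF this assms(2)]]
    show ?thesis unfolding bounded_iff by auto
  qed
  then obtain M where M: "\<And>b x. x \<in> C \<Longrightarrow> norm (frechet_derivative Z (at x) b) \<le> M b" by metis
  have "norm (Z x - Z y) \<le> (\<Sum>b\<in>Basis. M b) * norm (x - y)" if "x \<in> C" "y \<in> C" for x y
  proof (rule differentiable_bound[OF assms(3) _ _ that])
    fix x assume x: "x \<in> C"
    have d: "(Z has_derivative frechet_derivative Z (at x)) (at x)"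
      using assms x by (intro smooth_on_imp_has_derivative[OF assms(1)]) auto
    then show "(Z has_derivative frechet_derivative Z (at x)) (at x within C)"
      by (rule has_derivative_at_withinI)
    show "onorm (frechet_derivative Z (at x)) \<le> (\<Sum>b\<in>Basis. M b)"
    proof (rule onorm_le)
      fix v
      have "norm (frechet_derivative Z (at x) v) =
          norm (\<Sum>b\<in>Basis. (v \<bullet> b) *\<^sub>R frechet_derivative Z (at x) b)"
        by (subst frechet_derivative_euclidean_sum[OF differentiableI[OF d]]) (rule refl)
      also have "\<dots> \<le> (\<Sum>b\<in>Basis. norm v * M b)"
        by (rule sum_norm_le) (auto intro!: mult_mono simp: M[OF x] Basis_le_norm)
      finally show "norm (frechet_derivative Z (at x) v) \<le> (\<Sum>b\<in>Basis. M b) * norm v"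
        by (simp add: sum_distrib_left mult.commute)
    qed
  qed
  then show ?thesis by (rule that)
qed

text \<open>The distance of the curve from \<open>E\<close> satisfies a linear differential inequality, so
  Gronwall's argument applies.\<close>

lemma integral_curve_in_subspace:
  fixes Z :: "'a::euclidean_space \<Rightarrow> 'a"
  assumes "subspace E" "e \<in> E" "cball e \<rho> \<subseteq> Y" "smooth_on Y Z"
    and Z: "\<And>y. y \<in> E \<inter> Y \<Longrightarrow> Z y \<in> E"
    and c: "\<And>t. 0 \<le> t \<Longrightarrow> t \<le> 1 \<Longrightarrow> (c has_vector_derivative Z (c t)) (at t)"
    and ball: "\<And>t. 0 \<le> t \<Longrightarrow> t \<le> 1 \<Longrightarrow> c t \<in> cball e \<rho>"
    and "c 0 \<in> E"
  shows "c 1 \<in> E"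
proof -
  obtain \<pi> where \<pi>: "linear \<pi>" "\<And>x. \<pi> x \<in> E" "\<And>x. x \<in> E \<Longrightarrow> \<pi> x = x"
      "\<And>x. norm (\<pi> x) \<le> norm x" "\<And>x. norm (x - \<pi> x) \<le> norm x"
    using orthogonal_projection_exists[OF assms(1)] by metis
  obtain L where L: "\<And>x y. x \<in> cball e \<rho> \<Longrightarrow> y \<in> cball e \<rho> \<Longrightarrow> norm (Z x - Z y) \<le> L * norm (x - y)"
    using smooth_on_lipschitz[OF assms(4) compact_cball convex_cball assms(3)] by metis
  have bl: "bounded_linear (\<lambda>x. x - \<pi> x)"
    using \<pi>(1) by (intro bounded_linear_sub bounded_linear_ident) (simp add: linear_conv_bounded_linear)
  define r where "r t = c t - \<pi> (c t)" for t
  define r' where "r' t = Z (c t) - \<pi> (Z (c t))" for t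
  have r: "(r has_vector_derivative r' t) (at t)" if "0 \<le> t" "t \<le> 1" for t
    unfolding r_def[abs_def] r'_def by (rule bounded_linear.has_vector_derivative[OF bl c[OF that]])
  have r': "norm (r' t) \<le> L * norm (r t)" if t: "0 \<le> t" "t \<le> 1" for t
  proof -
    \<comment> \<open>The centre lies in \<open>E\<close>, so projecting does not leave the ball on
      which the Lipschitz bound holds.\<close>
    have "norm (\<pi> (c t) - e) \<le> norm (c t - e)"
      using \<pi>(4)[of "c t - e"] by (simp add: linear_diff[OF \<pi>(1)] \<pi>(3)[OF assms(2)])
    then have p: "\<pi> (c t) \<in> cball e \<rho>"
      using ball[OF t] by (auto simp: dist_norm norm_minus_commute)
    then have "Z (\<pi> (c t)) \<in> E" using Z \<pi>(2) assms(3) by blast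
    \<comment> \<open>The field at the projected point lies in \<open>E\<close>, so subtracting it
      leaves the normal component unchanged.\<close>
    then have "r' t = (Z (c t) - Z (\<pi> (c t))) - \<pi> (Z (c t) - Z (\<pi> (c t)))"
      by (simp add: r'_def linear_diff[OF \<pi>(1)] \<pi>(3))
    then have "norm (r' t) \<le> norm (Z (c t) - Z (\<pi> (c t)))" using \<pi>(5) by metis
    also have "\<dots> \<le> L * norm (r t)" unfolding r_def by (rule L[OF ball[OF t] p])
    finally show ?thesis .
  qed
  \<comment> \<open>The squared distance avoids differentiating a norm at its zeros; the exponential
    absorbs its growth rate, at most \<open>2 * L\<close>.\<close>
  define h where "h t = (r t \<bullet> r t) * exp (- 2 * L * t)" for t
  have "h 1 \<le> h 0"
  proof (rule DERIV_nonpos_imp_nonincreasing[of 0 1 h])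
    fix t :: real assume t: "0 \<le> t" "t \<le> 1"
    have "((\<lambda>t. r t \<bullet> r t) has_vector_derivative r t \<bullet> r' t + r' t \<bullet> r t) (at t)"
      by (rule bounded_bilinear.has_vector_derivative[OF bounded_bilinear_inner r[OF t] r[OF t]])
    then have d: "((\<lambda>t. r t \<bullet> r t) has_field_derivative 2 * (r t \<bullet> r' t)) (at t)"
      by (simp add: has_real_derivative_iff_has_vector_derivative inner_commute)
    have e: "((\<lambda>t. exp (- 2 * L * t)) has_field_derivative exp (- 2 * L * t) * (- 2 * L)) (at t)"
      by (auto intro!: derivative_eq_intros)
    have "(h has_field_derivative 2 * (r t \<bullet> r' t) * exp (- 2 * L * t) +
        (exp (- 2 * L * t) * (- 2 * L)) * (r t \<bullet> r t)) (at t)"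
      unfolding h_def[abs_def] by (rule DERIV_mult'[OF d e, THEN DERIV_cong]) simp
    moreover have "r t \<bullet> r' t \<le> L * (r t \<bullet> r t)"
    proof -
      have "r t \<bullet> r' t \<le> norm (r t) * norm (r' t)" by (rule norm_cauchy_schwarz)
      also have "\<dots> \<le> norm (r t) * (L * norm (r t))" by (intro mult_left_mono r' t norm_ge_zero)
      finally show ?thesis by (simp add: dot_square_norm power2_eq_square mult_ac)
    qed
    then have "(2 * (r t \<bullet> r' t) - 2 * (L * (r t \<bullet> r t))) * exp (- 2 * L * t) \<le> 0"
      by (intro mult_nonpos_nonneg) auto
    then have "2 * (r t \<bullet> r' t) * exp (- 2 * L * t) + (exp (- 2 * L * t) * (- 2 * L)) * (r t \<bullet> r t) \<le> 0"
      by (simp add: algebra_simps)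
    ultimately show "\<exists>y. (h has_real_derivative y) (at t) \<and> y \<le> 0" by blast
  qed simp
  also have "h 0 = 0" using assms(8) by (simp add: h_def r_def \<pi>(3))
  finally have "r 1 \<bullet> r 1 \<le> 0" by (simp add: h_def mult_le_0_iff)
  then have "r 1 = 0" by (metis inner_ge_zero inner_eq_zero_iff order_antisym)
  then have "c 1 = \<pi> (c 1)" by (simp add: r_def)
  then show ?thesis using \<pi>(2) by metis
qed

lemma has_vector_derivative_in_subspace:
  fixes f :: "real \<Rightarrow> 'a::euclidean_space"
  assumes "(f has_vector_derivative v) (at t)" "subspace E" "eventually (\<lambda>s. f s \<in> E) (nhds t)"
  shows "v \<in> E"
proof (rule Lim_in_closed_set[OF closed_subspace[OF assms(2)]])
  have "f t \<in> E" using assms(3) by (rule eventually_nhds_x_imp_x)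
  then show "eventually (\<lambda>h. (f (t + h) - f t) /\<^sub>R h \<in> E) (at 0)"
  proof -
    have "filterlim (\<lambda>h. t + h) (nhds t) (at 0)"
      by (auto intro!: tendsto_eq_intros)
    then have "eventually (\<lambda>h. f (t + h) \<in> E) (at 0)"
      using assms(3) by (rule eventually_compose_filterlim[rotated])
    then show ?thesis
      by eventually_elim (use \<open>f t \<in> E\<close> assms(2) in \<open>auto intro!: subspace_scale subspace_diff\<close>)
  qed
  show "((\<lambda>h. (f (t + h) - f t) /\<^sub>R h) \<longlongrightarrow> v) (at 0)"
  proof -
    have "((\<lambda>h. (norm (f (t + h) - f t - h *\<^sub>R v)) / norm h) \<longlongrightarrow> 0) (at 0)"
      using assms(1) by (simp add: has_vector_derivative_def has_derivative_at)
    then have "((\<lambda>h. norm ((f (t + h) - f t) /\<^sub>R h - v)) \<longlongrightarrow> 0) (at 0)"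
    proof (rule Lim_transform_eventually)
      show "eventually (\<lambda>h. norm (f (t + h) - f t - h *\<^sub>R v) / norm h =
          norm ((f (t + h) - f t) /\<^sub>R h - v)) (at 0)"
        using eventually_neq_at_within[of 0 0 UNIV]
      proof eventually_elim
        case (elim h)
        have "(f (t + h) - f t) /\<^sub>R h - v = (f (t + h) - f t - h *\<^sub>R v) /\<^sub>R h"
          using elim by (simp add: algebra_simps)
        then show ?case by (simp add: divide_inverse mult.commute)
      qed
    qed
    then show ?thesis by (simp add: tendsto_norm_zero_iff Lim_null[symmetric])
  qed
qed simp

section \<open>Transitions near the diagonal stay in an embedded piece\<close>

context bundle_chart
begin

text \<open>The curve of transitions with target \<open>z\<close> and source on the chart segment
  from \<open>z\<close> to \<open>x\<close> is an integral curve that starts at the unit of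
  \<open>z\<close>, hence in \<open>N\<close>, and ends at \<open>G x z\<close>. In the straightened
  picture the field is tangent to \<open>E\<close>, so the curve cannot leave it.\<close>

lemma transition_in_submanifold:
  fixes F :: "'n frame_jet \<Rightarrow> 'n frame_jet"
  assumes x0: "x0 \<in> U" "fj_id x0 \<in> X"
    and F: "diffeomorphism X Y F" and E: "subspace E" and XN: "F ` (X \<inter> N) = Y \<inter> E"
    and V0: "open V0" "x0 \<in> V0" "\<And>z. z \<in> V0 \<Longrightarrow> fj_id z \<in> N"
    and tangent: "\<And>q w. q \<in> X \<inter> N \<Longrightarrow> fj_src q \<in> U \<Longrightarrow>
      frechet_derivative F (at q) (left_velocity q (velocity w (fj_src q))) \<in> E"
  obtains V where "open V" "x0 \<in> V" "V \<subseteq> U" "\<And>x z. x \<in> V \<Longrightarrow> z \<in> V \<Longrightarrow> G x z \<in> N"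
proof -
  \<comment> \<open>The field is defined through \<open>velocity\<close> at the source, which is
    meaningful only for sources in \<open>U\<close>.\<close>
  define X' where "X' = X \<inter> {g. fj_src g \<in> U}"
  define Y' where "Y' = F ` X'"
  define I where "I = inv_into X' F"
  have XY: "open X" "open Y" "bij_betw F X Y" using F by (auto simp: diffeomorphism_def)
  have "open X'"
  proof -
    have "{g :: 'n frame_jet. fj_src g \<in> U} = U \<times> UNIV" by auto
    then show ?thesis using XY(1) open_U by (simp add: X'_def open_Int open_Times)
  qed
  then have F': "diffeomorphism X' Y' F"
    unfolding Y'_def using F by (intro diffeomorphism_restrict) (auto simp: X'_def)
  then have Y': "open Y'" "smooth_on X' F" "smooth_on Y' I" "inj_on F X'"
    by (auto simp: diffeomorphism_def I_def bij_betw_def)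
  have I: "I (F q) = q" if "q \<in> X'" for q
    using that Y'(4) by (simp add: I_def)
  have YE: "F q \<in> E \<longleftrightarrow> q \<in> N" if "q \<in> X'" for q
  proof
    assume "F q \<in> E"
    moreover have "F q \<in> Y" "q \<in> X" using that XY(3) by (auto simp: X'_def bij_betw_def)
    ultimately have "F q \<in> F ` (X \<inter> N)" by (simp add: XN)
    then obtain q' where q': "F q = F q'" "q' \<in> X" "q' \<in> N" by auto
    have "inj_on F X" using XY(3) by (simp add: bij_betw_def)
    from inj_onD[OF this q'(1) \<open>q \<in> X\<close> q'(2)] show "q \<in> N" using q'(3) by simp
  next
    assume "q \<in> N"
    then have "F q \<in> F ` (X \<inter> N)" using that by (auto simp: X'_def)
    then show "F q \<in> E" using XN by auto
  qed
  have id: "fj_id x0 \<in> X'" using x0 by (auto simp: X'_def fj_id_def)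
  define e where "e = F (fj_id x0)"
  have e: "e \<in> Y'" "e \<in> E" using id YE[OF id] V0 by (auto simp: e_def Y'_def)
  obtain \<rho> where \<rho>: "\<rho> > 0" "cball e \<rho> \<subseteq> Y'"
    using Y'(1) e(1) by (meson open_contains_cball)
  let ?G = "\<lambda>z. G (k (fst z)) (k (snd z))"
  define S1 where "S1 = X' \<inter> F -` ball e \<rho>"
  define S2 where "S2 = (\<kappa> ` U \<times> \<kappa> ` U) \<inter> ?G -` S1"
  have S1: "open S1" unfolding S1_def
    by (rule continuous_open_preimage[OF smooth_on_imp_continuous_on[OF Y'(2)] \<open>open X'\<close> open_ball])
  have o: "open (\<kappa> ` U \<times> \<kappa> ` U)" by (intro open_Times open_image)
  have "smooth_on (\<kappa> ` U \<times> \<kappa> ` U) ?G"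
  proof (rule smooth_on_G[OF o])
    show "smooth_on (\<kappa> ` U \<times> \<kappa> ` U) (\<lambda>z. k (fst z))"
      by (rule smooth_on_compose[OF o open_image smooth_k smooth_on_linear[OF bounded_linear_fst]]) auto
    show "smooth_on (\<kappa> ` U \<times> \<kappa> ` U) (\<lambda>z. k (snd z))"
      by (rule smooth_on_compose[OF o open_image smooth_k smooth_on_linear[OF bounded_linear_snd]]) auto
  qed (auto intro: k_in)
  then have S2: "open S2" unfolding S2_def
    by (rule continuous_open_preimage[OF smooth_on_imp_continuous_on o S1])
  have "(\<kappa> x0, \<kappa> x0) \<in> S2"
    using x0(1) id \<rho>(1) by (simp add: S2_def S1_def k_kappa G_id e_def)
  from open_prod_elim[OF S2 this] obtain A B where AB: "open A" "open B" "(\<kappa> x0, \<kappa> x0) \<in> A \<times> B" "A \<times> B \<subseteq> S2"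
    by metis
  then have "open (A \<inter> B)" "\<kappa> x0 \<in> A \<inter> B" by auto
  then obtain d where d: "d > 0" "ball (\<kappa> x0) d \<subseteq> A \<inter> B"
    using openE by blast
  \<comment> \<open>A chart ball is convex, so whole segments keep the transitions in the small ball
    about \<open>e\<close>; \<open>V0\<close> supplies the starting units.\<close>
  define V where "V = (U \<inter> \<kappa> -` ball (\<kappa> x0) d) \<inter> V0"
  have VV: "(a, b) \<in> S2" if "a \<in> ball (\<kappa> x0) d" "b \<in> ball (\<kappa> x0) d" for a b
    using that d(2) AB(4) by blast
  show ?thesis
  proof (rule that)
    show "open V" unfolding V_def
      by (rule open_Int[OF continuous_open_preimage[OF smooth_on_imp_continuous_on[OF smooth_kappa]
            open_U open_ball] V0(1)])
    show "x0 \<in> V" "V \<subseteq> U" using x0(1) d(1) V0(2) by (auto simp: V_def)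
    fix x z assume xz: "x \<in> V" "z \<in> V"
    define w where "w = \<kappa> x - \<kappa> z"
    \<comment> \<open>The left invariant field for the constant chart vector \<open>w\<close>,
      transported by the straightening \<open>F\<close>. It is autonomous because the source is read
      off from the jet.\<close>
    define Z where "Z y = frechet_derivative F (at (I y)) (left_velocity (I y) (velocity w (fj_src (I y))))" for y
    define \<gamma> where "\<gamma> t = G (k (\<kappa> z + t *\<^sub>R w)) z" for t
    have xzU: "x \<in> U" "z \<in> U" using xz by (auto simp: V_def)
    have line: "\<kappa> z + t *\<^sub>R w \<in> ball (\<kappa> x0) d" if "0 \<le> t" "t \<le> 1" for t
    proof -
      have "\<kappa> z + t *\<^sub>R w = (1 - t) *\<^sub>R \<kappa> z + t *\<^sub>R \<kappa> x" by (simp add: w_def algebra_simps)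
      moreover have "\<kappa> z \<in> ball (\<kappa> x0) d" "\<kappa> x \<in> ball (\<kappa> x0) d" using xz by (auto simp: V_def)
      ultimately show ?thesis
        using convexD_alt[OF convex_ball] that by metis
    qed
    have inS2: "(\<kappa> z + t *\<^sub>R w, \<kappa> z) \<in> S2" if "0 \<le> t" "t \<le> 1" for t
      using VV[OF line[OF that]] xz by (auto simp: V_def)
    have \<gamma>: "\<gamma> t \<in> X'" "F (\<gamma> t) \<in> ball e \<rho>" "\<kappa> z + t *\<^sub>R w \<in> \<kappa> ` U" if "0 \<le> t" "t \<le> 1" for t
      using inS2[OF that] xzU by (auto simp: S2_def S1_def \<gamma>_def k_kappa)
    have IX: "I y \<in> X'" if "y \<in> Y'" for y
      using that by (simp add: I_def Y'_def inv_into_into)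
    have srcU: "fj_src q \<in> U" if "q \<in> X'" for q using that by (simp add: X'_def)
    have "F (\<gamma> 1) \<in> E"
    proof (rule integral_curve_in_subspace[where Z = Z and c = "\<lambda>t. F (\<gamma> t)", OF E e(2) \<rho>(2)])
      have "smooth_on Y' (\<lambda>y. velocity w (fj_src (I y)))"
        by (rule smooth_on_compose[OF Y'(1) open_U smooth_on_velocity smooth_on_fj_src[OF Y'(1,3)] srcU[OF IX]])
      then have "smooth_on Y' (\<lambda>y. left_velocity (I y) (velocity w (fj_src (I y))))"
        by (intro smooth_on_left_velocity Y')
      then show "smooth_on Y' Z"
        unfolding Z_def[abs_def]
        by (rule smooth_on_frechet_derivative_apply[OF Y'(1) \<open>open X'\<close> Y'(2,3)]) (rule IX)
      show "Z y \<in> E" if "y \<in> E \<inter> Y'" for y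
      proof -
        have "F (I y) = y" using that by (auto simp: I_def Y'_def f_inv_into_f)
        then have "I y \<in> N" using YE[OF IX, of y] that by simp
        then show ?thesis
          unfolding Z_def using IX[of y] that by (intro tangent) (auto simp: X'_def)
      qed
      show "((\<lambda>t. F (\<gamma> t)) has_vector_derivative Z (F (\<gamma> t))) (at t)" if t: "0 \<le> t" "t \<le> 1" for t
      proof -
        let ?D = "frechet_derivative F (at (\<gamma> t))"
        have "(F has_derivative ?D) (at (\<gamma> t))"
          using \<gamma>(1)[OF t] by (rule smooth_on_imp_has_derivative[OF Y'(2)])
        moreover have "(\<gamma> has_vector_derivative left_velocity (\<gamma> t) (velocity w (fj_src (\<gamma> t)))) (at t)"
          using G_has_vector_derivative[OF \<gamma>(3)[OF t]] by (simp add: \<gamma>_def[abs_def] G_src)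
        ultimately have "((F \<circ> \<gamma>) has_vector_derivative
            ?D (left_velocity (\<gamma> t) (velocity w (fj_src (\<gamma> t))))) (at t)"
          using vector_derivative_diff_chain_within[of \<gamma> _ t UNIV F ?D] has_derivative_at_withinI by blast
        then show ?thesis by (simp add: Z_def o_def I[OF \<gamma>(1)[OF t]])
      qed
      show "F (\<gamma> t) \<in> cball e \<rho>" if "0 \<le> t" "t \<le> 1" for t using \<gamma>(2)[OF that] by auto
      have "\<gamma> 0 = fj_id z" using xzU by (simp add: \<gamma>_def k_kappa G_id)
      moreover have "fj_id z \<in> N" using V0(3) xz(2) by (simp add: V_def)
      ultimately show "F (\<gamma> 0) \<in> E" using YE \<gamma>(1)[of 0] by simp
    qed
    then have "\<gamma> 1 \<in> N" using YE \<gamma>(1)[of 1] by simp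
    then show "G x z \<in> N" using xzU by (simp add: \<gamma>_def w_def k_kappa)
  qed
qed

end

section \<open>Curves in immersed submanifolds\<close>

lemma Baire_closed_cover:
  fixes T :: "'i \<Rightarrow> 'a::euclidean_space set"
  assumes "countable P" "\<And>p. p \<in> P \<Longrightarrow> closed (T p)" "D \<subseteq> (\<Union>p\<in>P. T p)" "interior D \<noteq> {}"
  obtains p where "p \<in> P" "interior (T p) \<noteq> {}"
proof (rule ccontr)
  assume "\<not> thesis"
  then have *: "interior (T p) = {}" if "p \<in> P" for p
    using \<open>\<And>p. p \<in> P \<Longrightarrow> interior (T p) \<noteq> {} \<Longrightarrow> thesis\<close> that by blast
  have "UNIV \<subseteq> closure (\<Inter>((\<lambda>p. - T p) ` P))"
  proof (rule Baire[OF closed_UNIV])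
    fix S assume "S \<in> (\<lambda>p. - T p) ` P"
    then obtain p where "p \<in> P" "S = - T p" by auto
    then show "openin (top_of_set UNIV) S \<and> UNIV \<subseteq> closure S"
      using assms(2)[of p] *[of p] by (simp add: closure_complement open_Compl)
  qed (simp add: assms(1))
  also have "\<dots> \<subseteq> closure (- D)"
    using assms(3) by (intro closure_mono) auto
  finally show False
    using assms(4) by (auto simp: closure_complement)
qed

lemma smooth_map_imp_continuous_map: "smooth_map \<sigma> \<tau> f \<Longrightarrow> continuous_map \<sigma> \<tau> f"
  by (simp add: smooth_map_def)

lemma continuous_on_imp_continuous_map_immersed:
  assumes "openin \<tau> N" "subtopology \<tau> N = top_of_set N" "continuous_on S f" "f ` S \<subseteq> N"
  shows "continuous_map (top_of_set S) \<tau> f"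
proof -
  have "continuous_map (top_of_set S) (subtopology \<tau> N) f"
    unfolding assms(2) using assms(3,4) by (simp add: image_subset_iff_funcset)
  then show ?thesis by (rule continuous_map_into_fulltopology)
qed

text \<open>An immersed submanifold is a countable union of compact sets on which its topology is the
  subspace topology.\<close>

lemma continuous_into_immersed_dense:
  fixes f :: "'a::euclidean_space \<Rightarrow> 'b::euclidean_space"
  assumes "immersed_submanifold \<tau>" "open S" "S \<noteq> {}" "continuous_on S f" "f ` S \<subseteq> topspace \<tau>"
  obtains S' where "open S'" "S' \<noteq> {}" "S' \<subseteq> S" "continuous_map (top_of_set S') \<tau> f"
proof -
  \<comment> \<open>Three nested sets with three tasks: \<open>M\<close> is open for the Lindelof
    cover, \<open>C\<close> is closed in the ambient space for Baire's theorem, and on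
    \<open>N\<close> the two topologies agree.\<close>
  have "\<exists>M C N. openin \<tau> M \<and> p \<in> M \<and> M \<subseteq> C \<and> C \<subseteq> N \<and> closed C \<and> openin \<tau> N \<and>
      subtopology \<tau> N = top_of_set N" if p: "p \<in> topspace \<tau>" for p
  proof -
    from assms(1) p obtain N where N: "openin \<tau> N" "p \<in> N" "embedded_submanifold N"
        "subtopology \<tau> N = top_of_set N"
      unfolding immersed_submanifold_def by blast
    then obtain X Y E and F :: "'b \<Rightarrow> 'b" where F: "p \<in> X" "diffeomorphism X Y F" "subspace E"
        "F ` (X \<inter> N) = Y \<inter> E"
      unfolding embedded_submanifold_def by blast
    have XY: "open X" "open Y" "bij_betw F X Y" "continuous_on X F" "continuous_on Y (inv_into X F)"
      using F(2) smooth_on_imp_continuous_on by (auto simp: diffeomorphism_def)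
    have "F p \<in> Y" using XY(3) F(1) by (auto simp: bij_betw_def)
    then obtain r where r: "r > 0" "cball (F p) r \<subseteq> Y"
      using XY(2) by (meson open_contains_cball)
    let ?C = "inv_into X F ` (cball (F p) r \<inter> E)"
    let ?O = "X \<inter> F -` ball (F p) r"
    have O: "open ?O" by (rule continuous_open_preimage[OF XY(4,1) open_ball])
    have "compact ?C"
      using closed_subspace[OF F(3)] r(2)
      by (intro compact_continuous_image continuous_on_subset[OF XY(5)] compact_Int_closed) auto
    moreover have "?C \<subseteq> N"
    proof
      fix q assume "q \<in> ?C"
      then obtain y where y: "q = inv_into X F y" "y \<in> Y \<inter> E" using r(2) by auto
      then obtain q' where "q' \<in> X \<inter> N" "y = F q'" using F(4) by auto
      then show "q \<in> N" using y XY(3) by (simp add: bij_betw_def)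
    qed
    moreover have "N \<inter> ?O \<subseteq> ?C"
    proof
      fix q assume q: "q \<in> N \<inter> ?O"
      then have "F q \<in> F ` (X \<inter> N)" by auto
      then have "F q \<in> cball (F p) r \<inter> E" using F(4) q by auto
      moreover have "inv_into X F (F q) = q" using q XY(3) by (simp add: bij_betw_def)
      ultimately show "q \<in> ?C" by (metis imageI)
    qed
    moreover have "openin \<tau> (N \<inter> ?O)"
    proof (rule openin_trans_full[OF _ N(1)])
      show "openin (subtopology \<tau> N) (N \<inter> ?O)"
        unfolding N(4) using O by (simp add: openin_open_Int)
    qed
    moreover have "p \<in> N \<inter> ?O" using N(2) F(1) r(1) by simp
    ultimately show ?thesis
      using N(1,4) compact_imp_closed[of ?C]
      by (intro exI[of _ "N \<inter> ?O"] exI[of _ ?C] exI[of _ N]) simp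
  qed
  then obtain M C N where MCN: "\<And>p. p \<in> topspace \<tau> \<Longrightarrow> openin \<tau> (M p) \<and> p \<in> M p \<and> M p \<subseteq> C p \<and> C p \<subseteq> N p \<and>
      closed (C p) \<and> openin \<tau> (N p) \<and> subtopology \<tau> (N p) = top_of_set (N p)"
    by metis
  have "\<Union>(M ` topspace \<tau>) = topspace \<tau>"
    using MCN openin_subset by (fastforce simp: set_eq_iff)
  then obtain \<V> where \<V>: "countable \<V>" "\<V> \<subseteq> M ` topspace \<tau>" "\<Union>\<V> = topspace \<tau>"
    using Lindelof_spaceD[OF second_countable_imp_Lindelof_space, of \<tau> "M ` topspace \<tau>"] assms(1) MCN
    by (auto simp: immersed_submanifold_def)
  then obtain P where P: "countable P" "P \<subseteq> topspace \<tau>" "\<V> = M ` P"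
    using countable_subset_image[of \<V> M "topspace \<tau>"] by auto
  obtain x where "x \<in> S" using assms(3) by auto
  then obtain r where r: "r > 0" "cball x r \<subseteq> S"
    using assms(2) by (meson open_contains_cball)
  \<comment> \<open>Ambient continuity of \<open>f\<close> makes these sets closed; countably many
    cover the ball, so one has interior, and there \<open>f\<close> stays in a single piece
    \<open>N p\<close>.\<close>
  let ?T = "\<lambda>p. cball x r \<inter> f -` C p"
  have cont: "continuous_on (cball x r) f" using assms(4) r(2) by (rule continuous_on_subset)
  obtain p where p: "p \<in> P" "interior (?T p) \<noteq> {}"
  proof (rule Baire_closed_cover[OF P(1), of ?T "cball x r"])
    show "closed (?T p)" if "p \<in> P" for p
      using continuous_closed_preimage[OF cont closed_cball] MCN that P(2) by blast
    show "cball x r \<subseteq> (\<Union>p\<in>P. ?T p)"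
    proof
      fix y assume y: "y \<in> cball x r"
      then have "f y \<in> topspace \<tau>" using r(2) assms(5) by blast
      then obtain p where "p \<in> P" "f y \<in> M p" using \<V>(3) P(3) by auto
      then show "y \<in> (\<Union>p\<in>P. ?T p)" using y MCN P(2) by blast
    qed
    show "interior (cball x r) \<noteq> {}" using r(1) by (simp add: interior_cball)
  qed
  have sub: "interior (?T p) \<subseteq> ?T p" by (rule interior_subset)
  have N: "openin \<tau> (N p)" "subtopology \<tau> (N p) = top_of_set (N p)" "C p \<subseteq> N p"
    using MCN p(1) P(2) by blast+
  show ?thesis
  proof (rule that)
    show "interior (?T p) \<subseteq> S" using sub r(2) by blast
    show "continuous_map (top_of_set (interior (?T p))) \<tau> f"
      using N sub by (intro continuous_on_imp_continuous_map_immersed[OF N(1,2)]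
          continuous_on_subset[OF cont]) auto
  qed (use p(2) in auto)
qed

text \<open>Continuity for the manifold topology matters here: a curve which is only continuous in the ambient
  space can leave the piece \<open>N\<close> at once.\<close>

lemma curve_tangent:
  fixes F :: "'a::euclidean_space \<Rightarrow> 'a"
  assumes N: "openin \<tau> N" and F: "diffeomorphism X Y F" "subspace E" "F ` (X \<inter> N) = Y \<inter> E"
    and m: "\<epsilon> > 0" "continuous_map (top_of_set {-\<epsilon><..<\<epsilon>}) \<tau> m" "(m has_vector_derivative u) (at 0)"
    and q: "m 0 = q" "q \<in> X \<inter> N"
  shows "frechet_derivative F (at q) u \<in> E"
proof -
  have XF: "open X" "smooth_on X F" using F(1) by (auto simp: diffeomorphism_def)
  have "openin (top_of_set {-\<epsilon><..<\<epsilon>}) {s \<in> {-\<epsilon><..<\<epsilon>}. m s \<in> N}"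
    using openin_continuous_map_preimage[OF m(2) N] by simp
  then have "open {s \<in> {-\<epsilon><..<\<epsilon>}. m s \<in> N}"
    by (rule openin_open_trans) simp
  then have 1: "eventually (\<lambda>s. s \<in> {s \<in> {-\<epsilon><..<\<epsilon>}. m s \<in> N}) (nhds 0)"
    using q m(1) by (intro eventually_nhds_in_open) auto
  have "isCont m 0" using m(3) has_vector_derivative_continuous by blast
  then have "(m \<longlongrightarrow> q) (nhds 0)"
    using tendsto_at_iff_tendsto_nhds[of m 0] q(1) by (simp add: isCont_def)
  then have 2: "eventually (\<lambda>s. m s \<in> X) (nhds 0)"
    using XF(1) q(2) by (intro topological_tendstoD) auto
  from 1 2 have "eventually (\<lambda>s. (F \<circ> m) s \<in> E) (nhds 0)"
  proof eventually_elim
    case (elim s)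
    then have "F (m s) \<in> F ` (X \<inter> N)" by auto
    then show ?case using F(3) by simp
  qed
  moreover have "((F \<circ> m) has_vector_derivative frechet_derivative F (at q) u) (at 0)"
    using vector_derivative_diff_chain_within[of m u 0 UNIV F "frechet_derivative F (at q)"] m(3) q
      smooth_on_imp_has_derivative[OF XF(2), of q] has_derivative_at_withinI by blast
  ultimately show ?thesis
    using has_vector_derivative_in_subspace F(2) by blast
qed

section \<open>Tangency to a Lie subgroupoid of frame jets\<close>

locale frame_subgroupoid =
  fixes B :: "(real^'n) set" and \<Omega> :: "'n::finite frame_jet topology"
  assumes open_B: "open B" and sub: "lie_subgroupoid (frame_jet_groupoid B) \<Omega>"
begin

lemma id_in: "x \<in> B \<Longrightarrow> fj_id x \<in> topspace \<Omega>"
  and mult_continuous: "continuous_map (subtopology (prod_topology \<Omega> \<Omega>)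
      (composable (frame_jet_groupoid B) (topspace \<Omega>))) \<Omega> (\<lambda>(g, h). fj_mult g h)"
  and id_continuous: "continuous_map (top_of_set B) \<Omega> fj_id"
  and immersed: "immersed_submanifold \<Omega>"
  and src_submersion: "g \<in> topspace \<Omega> \<Longrightarrow> frechet_derivative fj_src (at g) ` tangent_space \<Omega> g = UNIV"
  using sub by (auto simp: lie_subgroupoid_def frame_jet_groupoid_def Let_def smooth_map_def)

lemma left_mult_continuous:
  assumes "g \<in> topspace \<Omega>" "continuous_map \<sigma> \<Omega> h" "\<And>t. t \<in> topspace \<sigma> \<Longrightarrow> fj_tgt (h t) = fj_src g"
  shows "continuous_map \<sigma> \<Omega> (\<lambda>t. fj_mult g (h t))"
proof -
  have "continuous_map \<sigma> (subtopology (prod_topology \<Omega> \<Omega>)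
      (composable (frame_jet_groupoid B) (topspace \<Omega>))) (\<lambda>t. (g, h t))"
  proof (rule continuous_map_into_subtopology)
    show "continuous_map \<sigma> (prod_topology \<Omega> \<Omega>) (\<lambda>t. (g, h t))"
      using assms by (intro continuous_map_pairedI) auto
    show "(\<lambda>t. (g, h t)) \<in> topspace \<sigma> \<rightarrow> composable (frame_jet_groupoid B) (topspace \<Omega>)"
      using assms continuous_map_image_subset_topspace[OF assms(2)]
      by (auto simp: composable_def frame_jet_groupoid_def)
  qed
  from continuous_map_compose[OF this mult_continuous] show ?thesis by (simp add: o_def)
qed

text \<open>Multiplying by \<open>q\<close> moves a curve through the unit to one through
  \<open>q\<close> that is still continuous for the topology of \<Omega>. Tangency thus spreads from
  units to every point of the piece.\<close>

lemma left_translation_tangent: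
  fixes F :: "'n frame_jet \<Rightarrow> 'n frame_jet"
  assumes N: "openin \<Omega> N" and F: "diffeomorphism X Y F" "subspace E" "F ` (X \<inter> N) = Y \<inter> E"
    and q: "q \<in> X \<inter> N"
    and d: "\<epsilon> > 0" "continuous_map (top_of_set {-\<epsilon><..<\<epsilon>}) \<Omega> \<delta>" "(\<delta> has_vector_derivative v) (at 0)"
      "\<And>s. s \<in> {-\<epsilon><..<\<epsilon>} \<Longrightarrow> fj_tgt (\<delta> s) = fj_src q" "\<delta> 0 = fj_id (fj_src q)"
  shows "frechet_derivative F (at q) (left_velocity q v) \<in> E"
proof (rule curve_tangent[OF N F d(1)])
  show "continuous_map (top_of_set {-\<epsilon><..<\<epsilon>}) \<Omega> (\<lambda>s. fj_mult q (\<delta> s))"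
    using q openin_subset[OF N] d by (intro left_mult_continuous) auto
  show "((\<lambda>s. fj_mult q (\<delta> s)) has_vector_derivative left_velocity q v) (at 0)"
    by (rule fj_mult_left_has_vector_derivative[OF d(3,5)])
  show "fj_mult q (\<delta> 0) = q" by (simp add: d(5) fj_mult_id_right)
qed (rule q)

lemma straightening:
  assumes "g \<in> topspace \<Omega>"
  obtains N X Y E and F :: "'n frame_jet \<Rightarrow> 'n frame_jet" where "openin \<Omega> N" "g \<in> X \<inter> N"
    "subtopology \<Omega> N = top_of_set N" "diffeomorphism X Y F" "subspace E" "F ` (X \<inter> N) = Y \<inter> E"
proof -
  obtain N where N: "openin \<Omega> N" "g \<in> N" "embedded_submanifold N" "subtopology \<Omega> N = top_of_set N"
    using immersed assms unfolding immersed_submanifold_def by blast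
  then show ?thesis
    using that unfolding embedded_submanifold_def by blast
qed

lemma identities_near:
  assumes "openin \<Omega> N"
  shows "open {z \<in> B. fj_id z \<in> N}"
  using openin_continuous_map_preimage[OF id_continuous assms] open_B
  by (auto intro: openin_open_trans)

text \<open>An algebroid element is the velocity of a curve in a target fibre of \<Omega>. Left
  translation makes the generated field tangent at each point of the embedded piece, as the
  confinement argument requires.\<close>

lemma transitions_near_diagonal:
  assumes "bundle_chart U \<kappa> Q" "U \<subseteq> B" "x0 \<in> U"
    and alg: "\<And>p w. p \<in> U \<Longrightarrow> bundle_chart.velocity U \<kappa> Q w p \<in> algebroid_fibre (frame_jet_groupoid B) \<Omega> p"
  obtains V where "open V" "x0 \<in> V" "V \<subseteq> U"
    "\<And>x z. x \<in> V \<Longrightarrow> z \<in> V \<Longrightarrow> transition_jet \<kappa> Q x z \<in> topspace \<Omega>"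
proof -
  interpret bundle_chart U \<kappa> Q by (rule assms(1))
  have "x0 \<in> B" using assms by auto
  from straightening[OF id_in[OF this]]
  obtain N X Y E and F :: "'n frame_jet \<Rightarrow> 'n frame_jet" where N: "openin \<Omega> N" "fj_id x0 \<in> X \<inter> N"
    and F: "diffeomorphism X Y F" "subspace E" "F ` (X \<inter> N) = Y \<inter> E" by metis
  have tangent: "frechet_derivative F (at q) (left_velocity q (velocity w (fj_src q))) \<in> E"
    if q: "q \<in> X \<inter> N" "fj_src q \<in> U" for q w
  proof -
    from alg[OF q(2), of w] obtain \<delta> and \<epsilon> :: real where d: "\<epsilon> > 0"
        "smooth_map (top_of_set {-\<epsilon><..<\<epsilon>}) (subtopology \<Omega> {g \<in> topspace \<Omega>. fj_tgt g = fj_src q}) \<delta>"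
        "\<delta> 0 = fj_id (fj_src q)" "(\<delta> has_vector_derivative velocity w (fj_src q)) (at 0)"
      by (auto simp: algebroid_fibre_def tangent_space_def frame_jet_groupoid_def)
    then have "continuous_map (top_of_set {-\<epsilon><..<\<epsilon>}) (subtopology \<Omega> {g \<in> topspace \<Omega>. fj_tgt g = fj_src q}) \<delta>"
      by (simp add: smooth_map_def)
    then have "continuous_map (top_of_set {-\<epsilon><..<\<epsilon>}) \<Omega> \<delta>"
        "\<And>s. s \<in> {-\<epsilon><..<\<epsilon>} \<Longrightarrow> fj_tgt (\<delta> s) = fj_src q"
      by (auto simp: continuous_map_in_subtopology Pi_iff)
    then show ?thesis
      by (rule left_translation_tangent[OF N(1) F q(1) d(1) _ d(4) _ d(3)])
  qed
  obtain V where "open V" "x0 \<in> V" "V \<subseteq> U" "\<And>x z. x \<in> V \<Longrightarrow> z \<in> V \<Longrightarrow> G x z \<in> N"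
    by (rule transition_in_submanifold[OF assms(3) _ F identities_near[OF N(1)] _ _ tangent])
       (use N(2) \<open>x0 \<in> B\<close> in auto)
  then show ?thesis
    using that openin_subset[OF N(1)] by blast
qed

text \<open>The source map is open on \<Omega>. Tangent vectors over the coordinate directions span
  an affine slice in the straightened piece, along which the source has the identity as
  derivative.\<close>

lemma source_dense:
  fixes F :: "'n frame_jet \<Rightarrow> 'n frame_jet"
  assumes N: "openin \<Omega> N" and F: "diffeomorphism X Y F" "subspace E" "F ` (X \<inter> N) = Y \<inter> E"
    and q: "q \<in> X \<inter> N" and W: "open W" "q \<in> W" "W \<subseteq> X"
  shows "fj_src q \<in> interior (fj_src ` (W \<inter> N))"
proof -
  let ?I = "inv_into X F" and ?D = "frechet_derivative F (at q)"
  have XY: "open X" "open Y" "bij_betw F X Y" "smooth_on Y ?I"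
    using F(1) by (auto simp: diffeomorphism_def)
  have qX: "q \<in> X" using q by simp
  note dF = diffeomorphism_inverse_has_derivative[OF F(1) qX]
  have qT: "q \<in> topspace \<Omega>" using q openin_subset[OF N] by auto
  have fst': "frechet_derivative fj_src (at q) = fst"
    unfolding fj_src_eq by (rule frechet_derivative_eq) (rule bounded_linear_imp_has_derivative[OF bounded_linear_fst])
  have "\<exists>v. v \<in> tangent_space \<Omega> q \<and> fst v = axis i 1" for i :: 'n
  proof -
    have "axis i 1 \<in> fst ` tangent_space \<Omega> q"
      using src_submersion[OF qT] unfolding fst' by blast
    then obtain v where "axis i 1 = fst v" "v \<in> tangent_space \<Omega> q" by auto
    then show ?thesis by (intro exI[of _ v]) simp
  qed
  then obtain v where v: "\<And>i::'n. v i \<in> tangent_space \<Omega> q" "\<And>i. fst (v i) = axis i 1" by metis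
  have vE: "?D (v i) \<in> E" for i
  proof -
    obtain \<gamma> and \<epsilon> :: real where "\<epsilon> > 0" "smooth_map (top_of_set {-\<epsilon><..<\<epsilon>}) \<Omega> \<gamma>" "\<gamma> 0 = q"
        "(\<gamma> has_vector_derivative v i) (at 0)"
      using v(1)[of i] unfolding tangent_space_def by blast
    then show ?thesis
      using curve_tangent[OF N F _ smooth_map_imp_continuous_map _ _ q] by blast
  qed
  \<comment> \<open>The slice stays in \<open>E\<close>, so pulling it back by \<open>?I\<close>
    gives points of \<open>N\<close> wherever it stays in \<open>Y\<close>.\<close>
  define A where "A s = F q + (\<Sum>i\<in>UNIV. s $ i *\<^sub>R ?D (v i))" for s :: "real^'n"
  have A': "(A has_derivative (\<lambda>s. \<Sum>i\<in>UNIV. s $ i *\<^sub>R ?D (v i))) (at s)" for s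
    unfolding A_def[abs_def] by (auto intro!: derivative_eq_intros bounded_linear_imp_has_derivative bounded_linear_vec_nth)
  then have contA: "continuous_on UNIV A"
    by (meson continuous_at_imp_continuous_on has_derivative_continuous)
  have FqE: "F q \<in> E" using F(3) q by blast
  have AE: "A s \<in> E" for s
    unfolding A_def using FqE vE by (intro subspace_add subspace_sum subspace_scale F(2))
  have A0: "A 0 = F q" by (simp add: A_def)
  have FqY: "F q \<in> Y" using XY(3) qX by (auto simp: bij_betw_def)
  have IFq: "?I (F q) = q" using XY(3) qX by (simp add: bij_betw_def)
  define J where "J = Y \<inter> ?I -` W"
  have J: "open J" unfolding J_def
    by (rule continuous_open_preimage[OF smooth_on_imp_continuous_on[OF XY(4)] XY(2) W(1)])
  define S where "S = A -` J"
  have S: "open S" unfolding S_def using contA J by (simp add: open_vimage)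
  have S0: "0 \<in> S" using A0 FqY IFq W(2) by (simp add: S_def J_def)
  let ?f = "\<lambda>s. fst (?I (A s))"
  have "?f 0 \<in> interior (?f ` S)"
  \<comment> \<open>This open mapping theorem asks for continuity on \<open>S\<close> and a
    derivative with a right inverse at the single point 0.\<close>
  proof (rule sussmann_open_mapping[OF S _ S0 _ bounded_linear_ident])
    have "continuous_on S (\<lambda>s. ?I (A s))"
      by (rule continuous_on_compose2[OF smooth_on_imp_continuous_on[OF XY(4)] continuous_on_subset[OF contA]])
         (auto simp: S_def J_def)
    then show "continuous_on S ?f" by (rule continuous_on_fst)
    let ?D' = "frechet_derivative ?I (at (F q))"
    have lin: "linear ?D'" by (rule has_derivative_linear[OF dF(2)])
    have "((\<lambda>s. ?I (A s)) has_derivative (\<lambda>s. ?D' (\<Sum>i\<in>UNIV. s $ i *\<^sub>R ?D (v i)))) (at 0)"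
      by (rule has_derivative_compose[OF A']) (simp add: A0 dF(2))
    then have "(?f has_derivative (\<lambda>s. fst (?D' (\<Sum>i\<in>UNIV. s $ i *\<^sub>R ?D (v i))))) (at 0)"
      by (rule has_derivative_fst)
    moreover have "fst (?D' (\<Sum>i\<in>UNIV. s $ i *\<^sub>R ?D (v i))) = s" for s
    proof -
      have "?D' (\<Sum>i\<in>UNIV. s $ i *\<^sub>R ?D (v i)) = (\<Sum>i\<in>UNIV. s $ i *\<^sub>R v i)"
        by (simp only: linear_sum[OF lin] linear_cmul[OF lin] dF(3))
      then show ?thesis
        using basis_expansion[of s] by (simp add: fst_sum v(2) scalar_mult_eq_scaleR)
    qed
    ultimately show "(?f has_derivative (\<lambda>s. s)) (at 0)" by simp
    show "(\<lambda>s. s) \<circ> (\<lambda>s. s) = id" by auto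
    show "0 \<in> interior S" using S S0 by (simp add: interior_open)
  qed simp
  also have "?f 0 = fj_src q" by (simp add: A0 IFq fj_src_eq)
  also have "interior (?f ` S) \<subseteq> interior (fj_src ` (W \<inter> N))"
  proof (intro interior_mono subsetI)
    fix a assume "a \<in> ?f ` S"
    then obtain s where "a = ?f s" "s \<in> S" by blast
    then have s: "a = ?f s" "A s \<in> Y" "?I (A s) \<in> W" by (simp_all add: S_def J_def)
    then have "A s \<in> F ` (X \<inter> N)" using AE F(3) by simp
    then obtain q' where "q' \<in> X \<inter> N" "A s = F q'" by blast
    moreover from this have "?I (A s) = q'" using XY(3) by (simp add: bij_betw_def)
    ultimately show "a \<in> fj_src ` (W \<inter> N)"
      using s by (intro image_eqI[of _ _ q']) (simp_all add: fj_src_eq)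
  qed
  finally show ?thesis .
qed

text \<open>The hypothesis places the transitions in \<Omega> as a set only. Were the field not
  tangent somewhere in the piece, it would fail on a neighbourhood, whose sources fill an open set.
  By Baire some open set of these sources gives transitions continuous into \<Omega>, which forces
  tangency at a failing point.\<close>

lemma velocity_in_algebroid:
  assumes "bundle_chart U \<kappa> Q" "U \<subseteq> B"
    and trans: "\<And>x z. x \<in> U \<Longrightarrow> z \<in> U \<Longrightarrow> transition_jet \<kappa> Q x z \<in> topspace \<Omega>"
    and p: "p \<in> U"
  shows "bundle_chart.velocity U \<kappa> Q w p \<in> algebroid_fibre (frame_jet_groupoid B) \<Omega> p"
proof -
  interpret bundle_chart U \<kappa> Q by (rule assms(1))
  have pB: "p \<in> B" using assms(2) p by auto
  obtain N X Y E and F :: "'n frame_jet \<Rightarrow> 'n frame_jet" where N: "openin \<Omega> N" "fj_id p \<in> X \<inter> N"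
      "subtopology \<Omega> N = top_of_set N"
    and F: "diffeomorphism X Y F" "subspace E" "F ` (X \<inter> N) = Y \<inter> E"
    using straightening[OF id_in[OF pB]] by metis
  have XF: "open X" "smooth_on X F" using F(1) by (auto simp: diffeomorphism_def)
  have line: "\<exists>\<epsilon>>0. \<forall>s\<in>{-\<epsilon><..<\<epsilon>}. \<kappa> a + s *\<^sub>R w \<in> \<kappa> ` V"
    if V: "open V" "V \<subseteq> U" "a \<in> V" for a V and w :: "real^'n"
  proof -
    have "open (\<kappa> ` V)"
      using diffeomorphism_restrict[OF diffeo V(1,2)] by (simp add: diffeomorphism_def)
    moreover have "continuous_on UNIV (\<lambda>s. \<kappa> a + s *\<^sub>R w)" by (intro continuous_intros)
    ultimately have "open ((\<lambda>s. \<kappa> a + s *\<^sub>R w) -` (\<kappa> ` V))" by (simp add: open_vimage)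
    moreover have "0 \<in> (\<lambda>s. \<kappa> a + s *\<^sub>R w) -` (\<kappa> ` V)" using V by simp
    ultimately obtain \<epsilon> where "\<epsilon> > 0" "ball 0 \<epsilon> \<subseteq> (\<lambda>s. \<kappa> a + s *\<^sub>R w) -` (\<kappa> ` V)"
      using openE by blast
    then show ?thesis
      by (intro exI[of _ \<epsilon>]) (auto simp: subset_iff dist_real_def)
  qed
  have contk: "continuous_on S (\<lambda>s. k (\<kappa> a + s *\<^sub>R w))" if "\<And>s. s \<in> S \<Longrightarrow> \<kappa> a + s *\<^sub>R w \<in> \<kappa> ` U"
    for S a and w :: "real^'n"
    by (rule continuous_on_compose2[OF smooth_on_imp_continuous_on[OF smooth_k]])
       (use that in \<open>auto intro!: continuous_intros\<close>)
  have tangent: "frechet_derivative F (at q) (left_velocity q (velocity w (fj_src q))) \<in> E"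
    if q: "q \<in> X \<inter> N" "fj_src q \<in> U" for q w
  proof (rule ccontr)
    let ?H = "\<lambda>q. frechet_derivative F (at q) (left_velocity q (velocity w (fj_src q)))"
    assume H: "?H q \<notin> E"
    let ?X = "X \<inter> {g. fj_src g \<in> U}"
    have "{g :: 'n frame_jet. fj_src g \<in> U} = U \<times> UNIV" by auto
    then have X: "open ?X" using XF(1) open_U by (simp add: open_Int open_Times)
    have "smooth_on ?X (\<lambda>q. velocity w (fj_src q))"
      by (rule smooth_on_compose[OF X open_U smooth_on_velocity smooth_on_fj_src[OF X smooth_on_id]]) simp
    then have "smooth_on ?X ?H"
      using X by (intro smooth_on_frechet_derivative_apply[OF X XF(1,2)] smooth_on_left_velocity smooth_on_id) auto
    \<comment> \<open>Failure is an open condition since subspaces are closed; this makes the source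
      openness applicable to the failing points.\<close>
    then have W: "open (?X \<inter> ?H -` (- E))"
      using closed_subspace[OF F(2)]
      by (intro continuous_open_preimage[OF smooth_on_imp_continuous_on X]) (auto simp: open_Compl)
    have "fj_src q \<in> interior (fj_src ` (?X \<inter> ?H -` (- E) \<inter> N))"
      using q H by (intro source_dense[OF N(1) F q(1) W]) auto
    then have ne: "interior (fj_src ` (?X \<inter> ?H -` (- E) \<inter> N)) \<inter> U \<noteq> {}" using q(2) by blast
    have "smooth_on U (\<lambda>x. G x p)"
      using p by (intro smooth_on_G open_U smooth_on_id smooth_on_const)
    then have cont: "continuous_on U (\<lambda>x. G x p)"
      by (rule smooth_on_imp_continuous_on)
    obtain S where S: "open S" "S \<noteq> {}" "S \<subseteq> interior (fj_src ` (?X \<inter> ?H -` (- E) \<inter> N)) \<inter> U"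
        "continuous_map (top_of_set S) \<Omega> (\<lambda>x. G x p)"
    proof (rule continuous_into_immersed_dense[OF immersed _ ne])
      show "open (interior (fj_src ` (?X \<inter> ?H -` (- E) \<inter> N)) \<inter> U)"
        using open_U by (intro open_Int open_interior)
      show "continuous_on (interior (fj_src ` (?X \<inter> ?H -` (- E) \<inter> N)) \<inter> U) (\<lambda>x. G x p)"
        using cont by (rule continuous_on_subset) simp
      show "(\<lambda>x. G x p) ` (interior (fj_src ` (?X \<inter> ?H -` (- E) \<inter> N)) \<inter> U) \<subseteq> topspace \<Omega>"
        using trans p by auto
    qed
    obtain a where a: "a \<in> S" using S(2) by auto
    then have "a \<in> interior (fj_src ` (?X \<inter> ?H -` (- E) \<inter> N))" and aU: "a \<in> U"
      using S(3) by blast+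
    from subsetD[OF interior_subset this(1)]
    \<comment> \<open>The original \<open>q\<close> may lie over a source where continuity is
      unknown; \<open>q'\<close> is a failing point over a good source.\<close>
    obtain q' where "a = fj_src q'" "q' \<in> ?X \<inter> ?H -` (- E) \<inter> N" by (rule imageE)
    then have q': "fj_src q' = a" "q' \<in> X \<inter> N" "?H q' \<notin> E" "a \<in> U"
      using aU by simp_all
    obtain \<epsilon> where \<epsilon>: "\<epsilon> > 0" "\<And>s. s \<in> {-\<epsilon><..<\<epsilon>} \<Longrightarrow> \<kappa> a + s *\<^sub>R w \<in> \<kappa> ` S"
      using line[OF S(1) _ a] S(3) by blast
    have kS: "k (\<kappa> a + s *\<^sub>R w) \<in> S" "\<kappa> a + s *\<^sub>R w \<in> \<kappa> ` U" if "s \<in> {-\<epsilon><..<\<epsilon>}" for s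
      using \<epsilon>(2)[OF that] S(3) k_kappa by (auto simp: image_iff)
    have "continuous_map (top_of_set {-\<epsilon><..<\<epsilon>}) (top_of_set S) (\<lambda>s. k (\<kappa> a + s *\<^sub>R w))"
      using contk[of "{-\<epsilon><..<\<epsilon>}" a w] kS by auto
    from continuous_map_compose[OF this S(4)]
    have "continuous_map (top_of_set {-\<epsilon><..<\<epsilon>}) \<Omega> (\<lambda>s. G (k (\<kappa> a + s *\<^sub>R w)) p)"
      by (simp add: o_def)
    \<comment> \<open>Left multiplication by \<open>G p a\<close>, an element of \<Omega>, replaces
      the target \<open>p\<close> by \<open>a\<close>, so the curve passes through the unit at
      \<open>a\<close> and can be translated to \<open>q'\<close>.\<close>
    then have "continuous_map (top_of_set {-\<epsilon><..<\<epsilon>}) \<Omega> (\<lambda>s. fj_mult (G p a) (G (k (\<kappa> a + s *\<^sub>R w)) p))"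
      using trans[OF p q'(4)] by (intro left_mult_continuous) (auto simp: G_src G_tgt)
    then have "continuous_map (top_of_set {-\<epsilon><..<\<epsilon>}) \<Omega> (\<lambda>s. G (k (\<kappa> a + s *\<^sub>R w)) a)"
      by (simp add: G_mult[OF p])
    from left_translation_tangent[OF N(1) F q'(2) \<epsilon>(1) this velocity_has_vector_derivative[OF q'(4)]]
    have "?H q' \<in> E"
      using q'(1,4) by (simp add: G_tgt G_id k_kappa)
    then show False using q'(3) by simp
  qed
  \<comment> \<open>Tangency on the whole piece confines nearby transitions to \<open>N\<close>,
    where both topologies agree; this makes the curve with target \<open>p\<close> smooth into
    \<Omega>.\<close>
  obtain V where V: "open V" "p \<in> V" "V \<subseteq> U" "\<And>x z. x \<in> V \<Longrightarrow> z \<in> V \<Longrightarrow> G x z \<in> N"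
    by (rule transition_in_submanifold[OF p _ F identities_near[OF N(1)] _ _ tangent])
       (use N(2) pB in auto)
  obtain \<epsilon> where \<epsilon>: "\<epsilon> > 0" "\<And>s. s \<in> {-\<epsilon><..<\<epsilon>} \<Longrightarrow> \<kappa> p + s *\<^sub>R w \<in> \<kappa> ` V"
    using line[OF V(1,3,2)] by blast
  let ?I = "{-\<epsilon><..<\<epsilon>}" and ?\<gamma> = "\<lambda>s. G (k (\<kappa> p + s *\<^sub>R w)) p"
  have kV: "k (\<kappa> p + s *\<^sub>R w) \<in> V" "\<kappa> p + s *\<^sub>R w \<in> \<kappa> ` U" if "s \<in> ?I" for s
    using \<epsilon>(2)[OF that] V(3) k_kappa by (auto simp: image_iff)
  have "smooth_on ?I (\<lambda>s. \<kappa> p + s *\<^sub>R w)"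
    by (intro smooth_on_add smooth_on_scaleR smooth_on_const smooth_on_id) auto
  from smooth_on_compose[OF _ open_image smooth_k this]
  have "smooth_on ?I (\<lambda>s. k (\<kappa> p + s *\<^sub>R w))"
    using kV(2) by simp
  then have sm: "smooth_on ?I ?\<gamma>"
    using kV V(3) p by (intro smooth_on_G smooth_on_const) auto
  have "continuous_map (top_of_set ?I) \<Omega> ?\<gamma>"
    using kV V(2,4)
    by (intro continuous_on_imp_continuous_map_immersed[OF N(1,3)] smooth_on_imp_continuous_on[OF sm]) auto
  then have "continuous_map (top_of_set ?I) (subtopology \<Omega> {g \<in> topspace \<Omega>. fj_tgt g = p}) ?\<gamma>"
    using trans[OF subsetD[OF V(3) kV(1)] p]
    by (intro continuous_map_into_subtopology) (auto simp: G_tgt)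
  then have "smooth_map (top_of_set ?I) (subtopology \<Omega> {g \<in> topspace \<Omega>. fj_tgt g = p}) ?\<gamma>"
    unfolding smooth_map_def using sm by (auto intro!: exI[of _ ?I] exI[of _ ?\<gamma>])
  then show ?thesis
    using \<epsilon>(1) velocity_has_vector_derivative[OF p, of w] p
    by (auto simp: algebroid_fibre_def tangent_space_def frame_jet_groupoid_def k_kappa G_id
        intro!: exI[of _ ?\<gamma>] exI[of _ \<epsilon>])
qed

end

section \<open>Homogeneity and parallelisms\<close>

lemma jet_groupoid_arrow:
  fixes A :: "real^'n^'n"
  assumes "open U" "x \<in> U" "y \<in> U" "invertible A"
  shows "(x, y, A) \<in> gpd_arr (jet_groupoid U)"
proof -
  define \<psi> where "\<psi> u = y + A *v (u - x)" for u
  have d: "(\<psi> has_derivative (\<lambda>h. A *v h)) (at u)" for u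
  proof -
    have "((\<lambda>u. A *v (u - x)) has_derivative (\<lambda>h. A *v (h - 0))) (at u)"
      by (rule bounded_linear.has_derivative[OF bounded_bilinear.bounded_linear_right[OF
            bounded_bilinear_matrix_vector_mult]])
         (intro has_derivative_diff has_derivative_ident has_derivative_const)
    from has_derivative_add[OF has_derivative_const[of y] this] show ?thesis
      by (simp add: \<psi>_def[abs_def])
  qed
  have sm: "smooth_on S \<psi>" if "open S" for S
    unfolding \<psi>_def[abs_def]
    by (intro smooth_on_add smooth_on_matrix_vector_mult smooth_on_diff smooth_on_const smooth_on_id that)
  have injA: "inj (\<lambda>h. A *v h)"
    using assms(4) by (simp add: invertible_left_inverse matrix_left_invertible_injective)
  \<comment> \<open>An affine map realizes any invertible jet; the restriction keeps domain and
    image inside \<open>U\<close>.\<close>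
  define S where "S = U \<inter> \<psi> -` U"
  have S: "open S"
    unfolding S_def
    by (rule continuous_open_preimage[OF smooth_on_imp_continuous_on[OF sm[OF assms(1)]] assms(1,1)])
  have "diffeomorphism S (\<psi> ` S) \<psi>"
  proof (rule diffeomorphism_on_image[OF S sm[OF S]])
    show "inj_on \<psi> S"
    proof (rule inj_onI)
      fix u v assume "\<psi> u = \<psi> v"
      then have "A *v (u - x) = A *v (v - x)" by (simp add: \<psi>_def)
      from injD[OF injA this] show "u = v" by simp
    qed
    show "inj (frechet_derivative \<psi> (at u))" for u
      unfolding frechet_derivative_eq[OF d] by (rule injA)
  qed
  moreover have "jet1 \<psi> x = (x, y, A)"
    by (simp add: jet1_def jacobian_def frechet_derivative_eq[OF d]) (simp add: \<psi>_def)
  moreover have "S \<subseteq> U" "\<psi> ` S \<subseteq> U" "x \<in> S"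
    using assms(2,3) by (auto simp: S_def \<psi>_def)
  ultimately show ?thesis
    unfolding jet_groupoid_def groupoid.simps mem_Collect_eq
    by (intro exI[of _ \<psi>] exI[of _ x] conjI exI[of _ S] exI[of _ "\<psi> ` S"]) simp_all
qed

context bundle_chart
begin

definition parallelism :: "(real^'n) \<times> (real^'n) \<Rightarrow> 'n jet" where
  "parallelism z = (fst z, snd z, matrix_inv (Q (snd z)) ** Q (fst z))"

lemma parallelism_morphism: "lie_groupoid_morphism (pair_groupoid U) (jet_groupoid U) parallelism id"
proof -
  have o: "open (U \<times> U)" by (intro open_Times open_U)
  have "smooth_on (U \<times> U) (\<lambda>z. Q (fst z))" "smooth_on (U \<times> U) (\<lambda>z. Q (snd z))"
    by (rule smooth_on_compose[OF o open_U smooth_Q smooth_on_linear[OF bounded_linear_fst]]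
        smooth_on_compose[OF o open_U smooth_Q smooth_on_linear[OF bounded_linear_snd]]; auto)+
  then have "smooth_on (U \<times> U) parallelism"
    unfolding parallelism_def[abs_def]
    by (intro smooth_on_Pair smooth_on_matrix_mult smooth_on_matrix_inv_compose
        smooth_on_linear[OF bounded_linear_fst] smooth_on_linear[OF bounded_linear_snd] o)
       (auto intro: invertible_Q)
  moreover have "smooth_on U (id :: real^'n \<Rightarrow> _)"
    unfolding id_def by (rule smooth_on_id)
  moreover have "parallelism (x, y) \<in> gpd_arr (jet_groupoid U)" if "x \<in> U" "y \<in> U" for x y
    unfolding parallelism_def fst_conv snd_conv
    using that by (intro jet_groupoid_arrow open_U invertible_mult invertible_matrix_inv invertible_Q)
  moreover have "matrix_inv (Q z) ** Q y ** (matrix_inv (Q y) ** Q x) = matrix_inv (Q z) ** Q x"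
    if "y \<in> U" for x y z
  proof -
    have "matrix_inv (Q z) ** Q y ** (matrix_inv (Q y) ** Q x) =
        matrix_inv (Q z) ** (Q y ** matrix_inv (Q y)) ** Q x"
      by (simp add: matrix_mul_assoc)
    then show ?thesis by (simp add: matrix_inv_mult invertible_Q that)
  qed
  ultimately show ?thesis
    by (auto simp: lie_groupoid_morphism_def pair_groupoid_def composable_def)
       (auto simp: jet_groupoid_def parallelism_def matrix_inv_mult invertible_Q)
qed

end

text \<open>Fixing the target \<open>x0\<close> trivializes the morphism:
  \<open>A x x0 = A y x0 ** A x y\<close> can be solved for \<open>A x y\<close>, and
  \<open>A x0 u\<close> is the inverse of \<open>Q u\<close>.\<close>

lemma parallelism_bundle_chart:
  fixes \<phi> :: "real^'n \<Rightarrow> real^'n"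
  assumes \<phi>: "local_coordinates U \<phi>" and x0: "x0 \<in> U"
    and mor: "lie_groupoid_morphism (pair_groupoid U) (jet_groupoid U) \<P> id"
    and st: "\<forall>y\<in>U. \<forall>z\<in>U. gpd_src (jet_groupoid U) (\<P> (y, z)) = y \<and> gpd_tgt (jet_groupoid U) (\<P> (y, z)) = z"
  defines "Q \<equiv> \<lambda>u. snd (snd (\<P> (u, x0)))"
  shows "bundle_chart U \<phi> Q"
    and "x \<in> U \<Longrightarrow> y \<in> U \<Longrightarrow> \<P> (x, y) = (x, y, matrix_inv (Q y) ** Q x)"
proof -
  have d: "diffeomorphism U (\<phi> ` U) \<phi>" using \<phi> by (simp add: local_coordinates_def)
  then have U: "open U" by (simp add: diffeomorphism_def)
  define A where "A x y = snd (snd (\<P> (x, y)))" for x y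
  have P: "\<P> (x, y) = (x, y, A x y)" if "x \<in> U" "y \<in> U" for x y
    using st[rule_format, OF that] by (cases "\<P> (x, y)") (simp add: jet_groupoid_def A_def)
  have id: "A x x = mat 1" if "x \<in> U" for x
  proof -
    have "\<P> (x, x) = (x, x, mat 1)"
      using mor that by (auto simp: lie_groupoid_morphism_def pair_groupoid_def jet_groupoid_def)
    then show ?thesis by (simp add: A_def)
  qed
  have mult: "A x z = A y z ** A x y" if "x \<in> U" "y \<in> U" "z \<in> U" for x y z
  proof -
    have "\<forall>(g, h)\<in>composable (pair_groupoid U) (gpd_arr (pair_groupoid U)).
        \<P> (gpd_mult (pair_groupoid U) g h) = gpd_mult (jet_groupoid U) (\<P> g) (\<P> h)"
      using mor by (simp add: lie_groupoid_morphism_def)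
    moreover have "((y, z), (x, y)) \<in> composable (pair_groupoid U) (gpd_arr (pair_groupoid U))"
      using that by (simp add: composable_def pair_groupoid_def)
    ultimately have "\<P> (x, z) = jet1_mult (\<P> (y, z)) (\<P> (x, y))"
      by (fastforce simp: pair_groupoid_def jet_groupoid_def)
    then show ?thesis using that by (simp add: P)
  qed
  have QP: "Q u = A u x0" for u by (simp add: Q_def A_def)
  have inv: "invertible (Q u)" if "u \<in> U" for u
    unfolding QP invertible_def using mult[OF that x0 that] mult[OF x0 that x0] id[OF that] id[OF x0] by metis
  have "smooth_on (U \<times> U) \<P>"
    using mor by (simp add: lie_groupoid_morphism_def pair_groupoid_def)
  from smooth_on_compose[OF U open_Times[OF U U] this]
  have "smooth_on U (\<lambda>u. \<P> (u, x0))"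
    using x0 by (simp add: smooth_on_Pair U smooth_on_id smooth_on_const)
  then have "smooth_on U Q"
    unfolding Q_def by (intro smooth_on_snd U)
  with d inv show "bundle_chart U \<phi> Q" by unfold_locales
  assume xy: "x \<in> U" "y \<in> U"
  have "matrix_inv (Q y) ** Q x = (matrix_inv (Q y) ** Q y) ** A x y"
    unfolding QP mult[OF xy x0] by (simp add: matrix_mul_assoc)
  then show "\<P> (x, y) = (x, y, matrix_inv (Q y) ** Q x)"
    using xy by (simp add: P matrix_inv_mult inv)
qed

theorem proposition9p3:
  fixes B :: "(real^3) set"
    and W :: "3 frame_jet \<Rightarrow> 'v::real_normed_vector"
    and \<Omega> :: "3 frame_jet topology"
  assumes "open B"
    and "mechanical_response B W"
    and "topspace \<Omega> = material_groupoid B W"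
    and "lie_subgroupoid (frame_jet_groupoid B) \<Omega>"
  shows "locally_homogeneous B W \<longleftrightarrow>
    (\<forall>x\<in>B. \<exists>U \<phi> \<P>. x \<in> U \<and> U \<subseteq> B \<and> local_coordinates U \<phi> \<and>
       lie_groupoid_morphism (pair_groupoid U) (jet_groupoid U) \<P> id \<and>
       (\<forall>y\<in>U. \<forall>z\<in>U. gpd_src (jet_groupoid U) (\<P> (y, z)) = y \<and>
                    gpd_tgt (jet_groupoid U) (\<P> (y, z)) = z) \<and>
       (\<forall>p\<in>U. \<forall>w. (\<Sum>l\<in>UNIV. w $ l *\<^sub>R section_components (local_expression U \<phi> \<P>) (\<phi> p) l) \<in>
          frechet_derivative (frame_jet_coordinates \<phi>) (at (fj_id p)) `
            algebroid_fibre (frame_jet_groupoid B) \<Omega> p))"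
    (is "_ \<longleftrightarrow> (\<forall>x\<in>B. \<exists>U \<phi> \<P>. ?C x U \<phi> \<P>)")
proof
  interpret frame_subgroupoid B \<Omega>
    using assms(1,4) by unfold_locales
  assume L: "locally_homogeneous B W"
  show "\<forall>x\<in>B. \<exists>U \<phi> \<P>. ?C x U \<phi> \<P>"
  proof
    fix x assume "x \<in> B"
    with L obtain U where "x \<in> U" "homogeneous_on B W U"
      by (auto simp: locally_homogeneous_def)
    then obtain K where U: "x \<in> U" "U \<subseteq> B" "deformation U K"
      and hom: "\<forall>x\<in>U. \<forall>y\<in>U. frame_jet (inv_into (frames U) K \<circ>
        frame_map (translation (base_map K y - base_map K x)) \<circ> K) x \<in> material_groupoid B W"
      unfolding homogeneous_on_def by (elim conjE exE)
    let ?Q = "\<lambda>u. snd (K (u, mat 1))"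
    interpret bundle_chart U "base_map K" ?Q
      by (rule deformation_bundle_chart(1)[OF U(3)])
    have trans: "G x y \<in> topspace \<Omega>" if "x \<in> U" "y \<in> U" for x y
      using hom[rule_format, OF that] frame_jet_translated[OF that deformation_bundle_chart(2)[OF U(3)]]
        assms(3) by simp
    \<comment> \<open>The coordinate system is the base map of the deformation itself, which makes
      the component v^j_{,i} vanish.\<close>
    have "?C x U (base_map K) parallelism"
    proof (intro conjI ballI allI)
      show "local_coordinates U (base_map K)" by (simp add: local_coordinates_def diffeo)
      show "(\<Sum>l\<in>UNIV. w $ l *\<^sub>R section_components (local_expression U (base_map K) parallelism) (base_map K p) l)
        \<in> frechet_derivative (frame_jet_coordinates (base_map K)) (at (fj_id p)) `
            algebroid_fibre (frame_jet_groupoid B) \<Omega> p" if "p \<in> U" for p w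
      proof (rule image_eqI)
        show "(\<Sum>l\<in>UNIV. w $ l *\<^sub>R section_components (local_expression U (base_map K) parallelism) (base_map K p) l)
          = frechet_derivative (frame_jet_coordinates (base_map K)) (at (fj_id p)) (velocity w p)"
          by (rule section_eq_velocity[OF _ that]) (simp add: parallelism_def)
        show "velocity w p \<in> algebroid_fibre (frame_jet_groupoid B) \<Omega> p"
          by (rule velocity_in_algebroid[OF bundle_chart_axioms U(2) trans that])
      qed
    qed (use U parallelism_morphism in \<open>auto simp: jet_groupoid_def parallelism_def\<close>)
    then show "\<exists>U \<phi> \<P>. ?C x U \<phi> \<P>" by blast
  qed
next
  interpret frame_subgroupoid B \<Omega>
    using assms(1,4) by unfold_locales
  assume R: "\<forall>x\<in>B. \<exists>U \<phi> \<P>. ?C x U \<phi> \<P>"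
  show "locally_homogeneous B W"
    unfolding locally_homogeneous_def
  proof
    fix x0 assume "x0 \<in> B"
    from bspec[OF R this] obtain U \<phi> \<P> where C: "?C x0 U \<phi> \<P>" by (elim exE)
    define Q where "Q = (\<lambda>u. snd (snd (\<P> (u, x0))))"
    from C have U: "x0 \<in> U" "U \<subseteq> B" and \<phi>: "local_coordinates U \<phi>"
      and mor: "lie_groupoid_morphism (pair_groupoid U) (jet_groupoid U) \<P> id"
      and st: "\<forall>y\<in>U. \<forall>z\<in>U. gpd_src (jet_groupoid U) (\<P> (y, z)) = y \<and>
        gpd_tgt (jet_groupoid U) (\<P> (y, z)) = z"
      and sec: "\<forall>p\<in>U. \<forall>w. (\<Sum>l\<in>UNIV. w $ l *\<^sub>R section_components (local_expression U \<phi> \<P>) (\<phi> p) l) \<in>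
        frechet_derivative (frame_jet_coordinates \<phi>) (at (fj_id p)) `
          algebroid_fibre (frame_jet_groupoid B) \<Omega> p"
      by - (elim conjE, assumption)+
    have chart: "bundle_chart U \<phi> Q"
      unfolding Q_def by (rule parallelism_bundle_chart(1)[OF \<phi> U(1) mor st])
    have \<P>: "\<P> (x, y) = (x, y, matrix_inv (Q y) ** Q x)" if "x \<in> U" "y \<in> U" for x y
      unfolding Q_def by (rule parallelism_bundle_chart(2)[OF \<phi> U(1) mor st that])
    interpret bundle_chart U \<phi> Q by (rule chart)
    have "velocity w p \<in> algebroid_fibre (frame_jet_groupoid B) \<Omega> p" if p: "p \<in> U" for p w
    proof -
      have "frechet_derivative (frame_jet_coordinates \<phi>) (at (fj_id p)) (velocity w p) \<in>
          frechet_derivative (frame_jet_coordinates \<phi>) (at (fj_id p)) `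
            algebroid_fibre (frame_jet_groupoid B) \<Omega> p"
        using sec[rule_format, OF p, of w] section_eq_velocity[OF \<P> p, of w] by simp
      \<comment> \<open>The derivative of the coordinate map is injective, so membership in the
        image gives membership of the velocity itself.\<close>
      then show ?thesis
        using frame_jet_coordinates_derivative(2)[OF p] by (simp add: inj_image_mem_iff)
    qed
    then obtain V where V: "open V" "x0 \<in> V" "V \<subseteq> U"
        "\<And>x z. x \<in> V \<Longrightarrow> z \<in> V \<Longrightarrow> G x z \<in> topspace \<Omega>"
      using transitions_near_diagonal[OF chart U(2,1)] by metis
    interpret V: bundle_chart V \<phi> Q by (rule restrict[OF V(1,3)])
    \<comment> \<open>The deformation is built from the given chart and \<open>Q\<close>; its
      translated jets are the values of \<open>G\<close>, which lie in \<Omega> over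
      \<open>V\<close>.\<close>
    have "homogeneous_on B W V"
      unfolding homogeneous_on_def
      using V U(2) V.deformation_bundle_map V.frame_jet_translated[of _ _ "bundle_map \<phi> Q"] assms(3)
      by (intro conjI exI[of _ "bundle_map \<phi> Q"]) auto
    then show "\<exists>U. x0 \<in> U \<and> homogeneous_on B W U" using V(2) by blast
  qed
qed

end
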